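(* For all $B,c>0$ there exist $\epsilon_0(B,c)>0$ and $\gamma_0(B,c)>0$, with $\epsilon_0(B,c)=\mathcal{O}(c\,e^{-c/2})$ and $\gamma_0(B,c)=\mathcal{O}(e^{-c})$ as $c\to\infty$, with a decreasing dependence on the argument $B$, such that the following holds for all neural operator approximations $\hat k=\hat{\mathcal K}(\hat\beta)$ of accuracy $\epsilon\in(0,\epsilon_0)$ (as defined in the context), all $\gamma\in(0,\gamma_0)$, and all $\beta,\hat\beta(\cdot,0)$ on $[0,1]$ that are Lipschitz and satisfy $\|\beta\|_\infty,\|\hat\beta(\cdot,0)\|_\infty\le B$. For the plant $$u_t(x,t)=u_x(x,t)+\beta(x)u(0,t),\quad (x,t)\in[0,1)\times\mathbb R^+,\qquad u(1,t)=U(t),$$ the feedback law $$U(t)=\int_0^1\hat k(1-y,t)\,u(y,t)\,dy$$ and the update law $$\hat\beta_t(x,t)=\mathrm{Proj}\big(\tau(x,t),\hat\beta(x,t)\big),\qquad (x,t)\in[0,1]\times\mathbb R^+,$$ $$\tau(x,t)=\frac{\gamma}{1+\|w(t)\|_c^2}\left[e^{cx}w(x,t)-\int_x^1\hat k(y-x,t)e^{cy}w(y,t)\,dy\right]w(0,t),$$ where $w=u-\hat k*u$ and $\|w(t)\|_c^2=\int_0^1e^{cx}w^2(x,t)\,dx$, guarantee that all solutions for which $\hat\beta_t(\cdot,t)$ remains in $H$, $\hat k(\cdot,t)$ is differentiable (with respect to $t$), and $\hat\beta(\cdot,t)$ remains Lipschitz, for all time, satisfy $$\Gamma(t)\le R\big(e^{\rho\,\Gamma(0)}-1\big),\quad\forall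 t\ge0,\qquad \Gamma(t)=\int_0^1\left[u^2(x,t)+\big(\beta(x)-\hat\beta(x,t)\big)^2\right]dx,$$ for constants $\rho,R>0$ and, in addition, $u(x,t)\to0$ as $t\to\infty$ for all $x\in[0,1]$.
   Context: Notation: $\mathbb R^+=[0,\infty)$; subscripts $t,x$ denote partial derivatives; $(a*b)(x)=\int_0^x a(x-y)b(y)\,dy$, with convolution in the space variable $x\in[0,1]$ at each fixed $t$; $\|\cdot\|_\infty$ is the supremum norm. The function $\beta$ is the unknown plant coefficient and $\hat\beta(x,t)$ its online estimate. The set $H$: $H$ is the subset of $\mathcal C^0([0,1],\mathbb R)$, endowed with the supremum norm, of functions $\alpha$ with $\|\alpha\|_\infty\le M$ that are $K$-Lipschitz, where the constants $M,K>0$ can be as large as required. Exact operators: for $\varphi\in\mathcal C^0([0,1],\mathbb R)$, $\mathcal K(\varphi)$ is the continuous solution $k$ on $[0,1]$ of the Volterra equation $k=-\varphi+\varphi*k$. For $\varphi,\psi\in\mathcal C^0([0,1],\mathbb R)$, $\mathcal K_1(\varphi,\psi)$ is the continuous solution $k_1$ of $k_1-\varphi*k_1+\psi-\psi*\mathcal K(\varphi)=0$. Neural operator approximation of accuracy $\epsilon$: $\hat k(\cdot,t)=\hat{\mathcal K}(\hat\beta(\cdot,t))$, where $(\hat{\mathcal K},\hat{\mathcal K}_1)$ is a neural operator (DeepONet) such that for all $\varphi,\psi\in H$ and all $x\in[0,1]$, $$|\mathcal K(\varphi)(x)-\hat{\mathcal K}(\varphi)(x)|+|\mathcal K_1(\varphi,\psi)(x)-\hat{\mathcal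 K}_1(\varphi,\psi)(x)|<\epsilon .$$ A DeepONet is an operator of the form $u\mapsto\big(y\mapsto\sum_{k=1}^p g^{\mathcal N}(\mathbf u_m;v^{(k)})f^{\mathcal N}(y;\theta^{(k)})\big)$, where $\mathbf u_m=(u(x_1),\dots,u(x_m))$ are samples of the input function at finitely many points and $g^{\mathcal N}(\cdot;v^{(k)}),f^{\mathcal N}(\cdot;\theta^{(k)})$ are neural networks. Projection: $\mathrm{Proj}(a,b)=0$ if $|b|=B$ and $ab>0$, and $\mathrm{Proj}(a,b)=a$ otherwise. Since Proj is discontinuous, solutions are understood in the Filippov sense.
   Formalization: The estimate is assumed to remain Lipschitz with the constant K of H (M at least B, K arbitrary), since outside H the operator need not be accurate and the claim fails; Filippov solutions of the projected law are taken relative to |b| ≤ B, so the estimate stays bounded by B. *)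

theory Defs
  imports "HOL-Analysis.Analysis" "HOL-Library.Landau_Symbols"
begin

text \<open>
  Functions on \<open>[0,1]\<close> and on \<open>[0,1] \<times> [0,\<infinity>)\<close> are total functions on the reals of which only the
  values on these domains matter. In functions of two variables the space variable comes first.
\<close>

definition sup_norm :: "(real \<Rightarrow> real) \<Rightarrow> real" where
  "sup_norm f = (SUP x\<in>{0..1}. \<bar>f x\<bar>)"

definition conv :: "(real \<Rightarrow> real) \<Rightarrow> (real \<Rightarrow> real) \<Rightarrow> real \<Rightarrow> real" where
  "conv a b x = integral {0..x} (\<lambda>y. a (x - y) * b y)"

definition H :: "real \<Rightarrow> real \<Rightarrow> (real \<Rightarrow> real) set" where
  "H M K = {\<alpha>. continuous_on {0..1} \<alpha> \<and> sup_norm \<alpha> \<le> M \<and> K-lipschitz_on {0..1} \<alpha>}"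


section \<open>Exact kernel operators\<close>

text \<open>The value \<open>0\<close> outside \<open>[0,1]\<close> only serves to make the solution unique as a total function.\<close>

definition kernel_op :: "(real \<Rightarrow> real) \<Rightarrow> real \<Rightarrow> real" where
  "kernel_op \<phi> = (THE k. continuous_on {0..1} k \<and> (\<forall>x. x \<notin> {0..1} \<longrightarrow> k x = 0) \<and>
     (\<forall>x\<in>{0..1}. k x = - \<phi> x + conv \<phi> k x))"

definition kernel_op1 :: "(real \<Rightarrow> real) \<Rightarrow> (real \<Rightarrow> real) \<Rightarrow> real \<Rightarrow> real" where
  "kernel_op1 \<phi> \<psi> = (THE k1. continuous_on {0..1} k1 \<and> (\<forall>x. x \<notin> {0..1} \<longrightarrow> k1 x = 0) \<and>
     (\<forall>x\<in>{0..1}. k1 x - conv \<phi> k1 x + \<psi> x - conv \<psi> (kernel_op \<phi>) x = 0))"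


section \<open>Neural operators\<close>

text \<open>
  A layer \<open>(W, b)\<close> is the affine map \<open>x \<mapsto> W x + b\<close>, with \<open>W\<close> given by its rows. The parameters of a
  network are its layers; the activation function is applied between consecutive layers, so
  that the last layer is affine.
\<close>

type_synonym layer = "real list list \<times> real list"

definition affine_layer :: "layer \<Rightarrow> real list \<Rightarrow> real list" where
  "affine_layer l x = map2 (\<lambda>r b. (\<Sum>(a, y)\<leftarrow>zip r x. a * y) + b) (fst l) (snd l)"

fun forward :: "(real \<Rightarrow> real) \<Rightarrow> layer list \<Rightarrow> real list \<Rightarrow> real list" where
  "forward \<sigma> [] x = x"
| "forward \<sigma> [l] x = affine_layer l x"
| "forward \<sigma> (l # l' # ls) x = forward \<sigma> (l' # ls) (map \<sigma> (affine_layer l x))"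

fun layers_shape :: "nat \<Rightarrow> layer list \<Rightarrow> nat \<Rightarrow> bool" where
  "layers_shape n [] m \<longleftrightarrow> n = m"
| "layers_shape n (l # ls) m \<longleftrightarrow>
     length (fst l) = length (snd l) \<and> (\<forall>r\<in>set (fst l). length r = n) \<and>
     layers_shape (length (snd l)) ls m"

definition nn_params :: "nat \<Rightarrow> layer list \<Rightarrow> bool" where
  "nn_params n \<theta> \<longleftrightarrow> \<theta> \<noteq> [] \<and> layers_shape n \<theta> 1"

definition nn :: "(real \<Rightarrow> real) \<Rightarrow> layer list \<Rightarrow> real list \<Rightarrow> real" where
  "nn \<sigma> \<theta> x = hd (forward \<sigma> \<theta> x)"

text \<open>
  An operator acting on \<open>d\<close> input functions samples each of them at the points \<open>xs\<close>.
  The list \<open>ps\<close> holds the pairs \<open>(v\<^sup>(\<^sup>k\<^sup>), \<theta>\<^sup>(\<^sup>k\<^sup>))\<close> for \<open>k = 1, \<dots>, p\<close>. The activation functions are arbitrary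
  continuous functions.
\<close>

definition samples :: "real list \<Rightarrow> (real \<Rightarrow> real) list \<Rightarrow> real list" where
  "samples xs us = concat (map (\<lambda>u. map u xs) us)"

definition is_deeponet :: "nat \<Rightarrow> ((real \<Rightarrow> real) list \<Rightarrow> real \<Rightarrow> real) \<Rightarrow> bool" where
  "is_deeponet d F \<longleftrightarrow>
     (\<exists>\<sigma>g \<sigma>f xs ps.
        continuous_on UNIV \<sigma>g \<and> continuous_on UNIV \<sigma>f \<and> set xs \<subseteq> {0..1} \<and>
        (\<forall>(v, \<theta>)\<in>set ps. nn_params (d * length xs) v \<and> nn_params 1 \<theta>) \<and>
        (\<forall>us. length us = d \<longrightarrow> (\<forall>y\<in>{0..1}.
           F us y = (\<Sum>(v, \<theta>)\<leftarrow>ps. nn \<sigma>g v (samples xs us) * nn \<sigma>f \<theta> [y]))))"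

definition neural_approximation ::
    "real \<Rightarrow> real \<Rightarrow> real \<Rightarrow> ((real \<Rightarrow> real) \<Rightarrow> real \<Rightarrow> real) \<Rightarrow>
     ((real \<Rightarrow> real) \<Rightarrow> (real \<Rightarrow> real) \<Rightarrow> real \<Rightarrow> real) \<Rightarrow> bool" where
  "neural_approximation M K \<epsilon> Khat Khat1 \<longleftrightarrow>
     is_deeponet 1 (\<lambda>us. Khat (us ! 0)) \<and>
     is_deeponet 2 (\<lambda>us. Khat1 (us ! 0) (us ! 1)) \<and>
     (\<forall>\<phi>\<in>H M K. \<forall>\<psi>\<in>H M K. \<forall>x\<in>{0..1}.
        \<bar>kernel_op \<phi> x - Khat \<phi> x\<bar> + \<bar>kernel_op1 \<phi> \<psi> x - Khat1 \<phi> \<psi> x\<bar> < \<epsilon>)"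


section \<open>Projection and its Filippov regularization\<close>

definition Proj :: "real \<Rightarrow> real \<Rightarrow> real \<Rightarrow> real" where
  "Proj B a b = (if \<bar>b\<bar> = B \<and> a * b > 0 then 0 else a)"

text \<open>
  The set-valued regularization of \<open>Proj\<close> on its domain of use \<open>\<bar>b\<bar> \<le> B\<close>, to which the projection
  confines the estimate. Null sets are not discarded in the convex hull: the boundary \<open>\<bar>b\<bar> = B\<close> is
  itself a null set, and discarding it would remove the projection altogether.
  The lemmas below compute the regularization.
\<close>

definition filippov_Proj :: "real \<Rightarrow> real \<Rightarrow> real \<Rightarrow> real set" where
  "filippov_Proj B a b =
     (\<Inter>\<delta>\<in>{0<..}. closure (convex hull
        {Proj B a' b' |a' b'. \<bar>b'\<bar> \<le> B \<and> dist (a', b') (a, b) < \<delta>}))"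

lemma filippov_Proj_outside:
  assumes "\<bar>b\<bar> > B"
  shows "filippov_Proj B a b = {}"
proof -
  have "{Proj B a' b' |a' b'. \<bar>b'\<bar> \<le> B \<and> dist (a', b') (a, b) < \<bar>b\<bar> - B} = {}"
  proof -
    have False if "\<bar>b'\<bar> \<le> B" "dist (a', b') (a, b) < \<bar>b\<bar> - B" for a' b'
    proof -
      have "\<bar>b' - b\<bar> \<le> dist (a', b') (a, b)"
        using dist_snd_le[of "(a', b')" "(a, b)"] by (simp add: dist_real_def)
      then show False using that by linarith
    qed
    then show ?thesis by blast
  qed
  then have "filippov_Proj B a b \<subseteq> closure (convex hull {})"
    unfolding filippov_Proj_def using assms
    by (intro INF_lower2[of "\<bar>b\<bar> - B"]) auto
  then show ?thesis by simp
qed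

lemma filippov_Proj_subset_segment:
  "filippov_Proj B a b \<subseteq> closed_segment 0 a"
proof
  fix v assume v: "v \<in> filippov_Proj B a b"
  have "min 0 a - \<delta> \<le> v \<and> v \<le> max 0 a + \<delta>" if "\<delta> > 0" for \<delta>
  proof -
    let ?S = "{Proj B a' b' |a' b'. \<bar>b'\<bar> \<le> B \<and> dist (a', b') (a, b) < \<delta>}"
    have "?S \<subseteq> {min 0 a - \<delta>..max 0 a + \<delta>}"
    proof
      fix y assume "y \<in> ?S"
      then obtain a' b' where y: "y = Proj B a' b'" "dist (a', b') (a, b) < \<delta>" by blast
      have "\<bar>a' - a\<bar> < \<delta>"
        using dist_fst_le[of "(a', b')" "(a, b)"] y(2) by (simp add: dist_real_def)
      then show "y \<in> {min 0 a - \<delta>..max 0 a + \<delta>}"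
        using that by (auto simp: y(1) Proj_def)
    qed
    then have "closure (convex hull ?S) \<subseteq> {min 0 a - \<delta>..max 0 a + \<delta>}"
      by (intro closure_minimal hull_minimal) auto
    moreover have "v \<in> closure (convex hull ?S)"
      using v that unfolding filippov_Proj_def by blast
    ultimately show ?thesis by auto
  qed
  then have "min 0 a \<le> v" "v \<le> max 0 a"
    by (meson field_le_epsilon diff_le_eq)+
  then show "v \<in> closed_segment 0 a"
    by (auto simp: closed_segment_eq_real_ivl min_def max_def split: if_splits)
qed

lemma filippov_Proj_boundary:
  assumes "\<bar>b\<bar> = B" "a * b > 0"
  shows "filippov_Proj B a b = closed_segment 0 a"
proof
  show "closed_segment 0 a \<subseteq> filippov_Proj B a b"
    unfolding filippov_Proj_def
  proof (rule INT_greatest)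
    fix \<delta> :: real assume "\<delta> \<in> {0<..}"
    then have \<delta>: "\<delta> > 0" by simp
    let ?S = "{Proj B a' b' |a' b'. \<bar>b'\<bar> \<le> B \<and> dist (a', b') (a, b) < \<delta>}"
    have "b \<noteq> 0" using assms(2) by auto
    have 0: "0 \<in> ?S"
      using assms \<delta> by (intro CollectI exI[of _ a] exI[of _ b]) (auto simp: Proj_def)
    define s where "s = 1 - min 1 (\<delta> / (2 * \<bar>b\<bar>))"
    have s: "0 \<le> s" "s < 1" "(1 - s) * \<bar>b\<bar> \<le> \<delta> / 2"
      using \<delta> \<open>b \<noteq> 0\<close> by (auto simp: s_def min_def field_simps)
    have "\<bar>s * b\<bar> < B"
      using s \<open>b \<noteq> 0\<close> assms(1) by (auto simp: abs_mult)
    moreover have "\<bar>s * b - b\<bar> = (1 - s) * \<bar>b\<bar>"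
    proof -
      have "s * b - b = - ((1 - s) * b)" by (simp add: algebra_simps)
      then show ?thesis using s by (simp add: abs_mult)
    qed
    then have "dist (a, s * b) (a, b) < \<delta>"
      using s \<delta> by (simp add: dist_Pair_Pair dist_real_def)
    ultimately have a: "a \<in> ?S"
      by (intro CollectI exI[of _ a] exI[of _ "s * b"]) (auto simp: Proj_def)
    have "closed_segment 0 a \<subseteq> convex hull ?S"
      unfolding segment_convex_hull using 0 a by (intro hull_mono) auto
    then show "closed_segment 0 a \<subseteq> closure (convex hull ?S)"
      using closure_subset by blast
  qed
qed (rule filippov_Proj_subset_segment)

lemma filippov_Proj_regular:
  assumes "\<bar>b\<bar> \<le> B" "\<not> (\<bar>b\<bar> = B \<and> a * b > 0)"
  shows "filippov_Proj B a b = {a}"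
proof (cases "a = 0")
  case False
  define \<delta>0 where "\<delta>0 = (if \<bar>b\<bar> < B then B - \<bar>b\<bar> else if b = 0 then 1 else min \<bar>a\<bar> \<bar>b\<bar>)"
  have \<delta>0: "\<delta>0 > 0" using False assms by (auto simp: \<delta>0_def)
  have close: "Proj B a' b' = a' \<and> \<bar>a' - a\<bar> < \<delta>"
    if "\<bar>b'\<bar> \<le> B" "dist (a', b') (a, b) < \<delta>" "\<delta> \<le> \<delta>0" for a' b' \<delta>
  proof -
    have 1: "\<bar>a' - a\<bar> < \<delta>"
      using dist_fst_le[of "(a', b')" "(a, b)"] that(2) by (simp add: dist_real_def)
    have 2: "\<bar>b' - b\<bar> < \<delta>"
      using dist_snd_le[of "(a', b')" "(a, b)"] that(2) by (simp add: dist_real_def)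
    consider "\<bar>b\<bar> < B" | "b = 0" "B = 0" | "\<bar>b\<bar> = B" "b \<noteq> 0" using assms(1) by fastforce
    then have "Proj B a' b' = a'"
    proof cases
      case 1
      then have "\<bar>b'\<bar> < B" using 2 that(3) by (auto simp: \<delta>0_def)
      then show ?thesis by (simp add: Proj_def)
    next
      case 2
      then show ?thesis using that(1) by (simp add: Proj_def)
    next
      case 3
      then have ab: "a * b < 0" using assms(2) False by (auto simp: not_less le_less)
      have "\<bar>a' - a\<bar> < \<bar>a\<bar>" "\<bar>b' - b\<bar> < \<bar>b\<bar>"
        using 1 2 3 that(3) by (auto simp: \<delta>0_def split: if_splits)
      then have "a' * b' < 0"
        using ab by (auto simp: mult_less_0_iff abs_if split: if_splits)
      then show ?thesis by (simp add: Proj_def)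
    qed
    then show ?thesis using 1 by simp
  qed
  have "v = a" if v: "v \<in> filippov_Proj B a b" for v
  proof -
    have "a - \<delta> \<le> v \<and> v \<le> a + \<delta>" if "\<delta> > 0" for \<delta>
    proof -
      define d where "d = min \<delta> \<delta>0"
      have d: "d > 0" "d \<le> \<delta>0" "d \<le> \<delta>" using that \<delta>0 by (auto simp: d_def)
      let ?S = "{Proj B a' b' |a' b'. \<bar>b'\<bar> \<le> B \<and> dist (a', b') (a, b) < d}"
      have "?S \<subseteq> {a - d..a + d}" using close[OF _ _ d(2)] by fastforce
      then have "closure (convex hull ?S) \<subseteq> {a - d..a + d}"
        by (intro closure_minimal hull_minimal) auto
      moreover have "v \<in> closure (convex hull ?S)"
        using v d(1) unfolding filippov_Proj_def by blast
      ultimately show ?thesis using d(3) by fastforce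
    qed
    then have "a \<le> v" "v \<le> a" by (meson field_le_epsilon diff_le_eq)+
    then show ?thesis by simp
  qed
  moreover have "a \<in> filippov_Proj B a b"
    unfolding filippov_Proj_def
  proof (rule INT_I)
    fix \<delta> :: real assume "\<delta> \<in> {0<..}"
    then have "a \<in> {Proj B a' b' |a' b'. \<bar>b'\<bar> \<le> B \<and> dist (a', b') (a, b) < \<delta>}"
      using assms by (intro CollectI exI[of _ a] exI[of _ b]) (auto simp: Proj_def)
    then show "a \<in> closure (convex hull {Proj B a' b' |a' b'. \<bar>b'\<bar> \<le> B \<and> dist (a', b') (a, b) < \<delta>})"
      by (meson closure_subset hull_inc subsetD)
  qed
  ultimately show ?thesis by blast
next
  case True
  have "0 \<in> filippov_Proj B a b"
    unfolding filippov_Proj_def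
  proof (rule INT_I)
    fix \<delta> :: real assume "\<delta> \<in> {0<..}"
    then have "0 \<in> {Proj B a' b' |a' b'. \<bar>b'\<bar> \<le> B \<and> dist (a', b') (a, b) < \<delta>}"
      using assms True by (intro CollectI exI[of _ a] exI[of _ b]) (auto simp: Proj_def)
    then show "0 \<in> closure (convex hull {Proj B a' b' |a' b'. \<bar>b'\<bar> \<le> B \<and> dist (a', b') (a, b) < \<delta>})"
      by (meson closure_subset hull_inc subsetD)
  qed
  then show ?thesis using filippov_Proj_subset_segment[of B a b] True by auto
qed


section \<open>The adaptive closed loop\<close>

definition abs_continuous_on_ivl :: "real \<Rightarrow> real \<Rightarrow> (real \<Rightarrow> real) \<Rightarrow> bool" where
  "abs_continuous_on_ivl a b f \<longleftrightarrow>
     (\<forall>\<epsilon>>0. \<exists>\<delta>>0. \<forall>I. finite I \<longrightarrow> (\<forall>(s, t)\<in>I. a \<le> s \<and> s \<le> t \<and> t \<le> b) \<longrightarrow>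
        pairwise (\<lambda>(s, t) (s', t'). {s<..<t} \<inter> {s'<..<t'} = {}) I \<longrightarrow>
        (\<Sum>(s, t)\<in>I. t - s) < \<delta> \<longrightarrow> (\<Sum>(s, t)\<in>I. \<bar>f t - f s\<bar>) < \<epsilon>)"

text \<open>
  As the right-hand side of the update law is discontinuous, the plant equation is required almost
  everywhere, for functions \<open>u\<close> that are continuous on \<open>[0,1] \<times> [0,\<infinity>)\<close> and locally Lipschitz on
  \<open>[0,1) \<times> [0,\<infinity>)\<close>. Every continuously differentiable solution is of this kind.
\<close>

definition plant_solution ::
    "(real \<Rightarrow> real) \<Rightarrow> (real \<Rightarrow> real) \<Rightarrow> (real \<Rightarrow> real \<Rightarrow> real) \<Rightarrow> bool" where
  "plant_solution \<beta> U u \<longleftrightarrow>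
     continuous_on ({0..1} \<times> {0..}) (\<lambda>(x, t). u x t) \<and>
     (\<forall>r<1. \<forall>T. \<exists>L. L-lipschitz_on ({0..r} \<times> {0..T}) (\<lambda>(x, t). u x t)) \<and>
     (AE (x, t) in lborel. x \<in> {0..<1} \<and> t \<ge> 0 \<longrightarrow>
        (\<exists>u_t u_x. ((\<lambda>s. u x s) has_real_derivative u_t) (at t) \<and>
                   ((\<lambda>y. u y t) has_real_derivative u_x) (at x) \<and>
                   u_t = u_x + \<beta> x * u 0 t)) \<and>
     (\<forall>t\<ge>0. u 1 t = U t)"

definition wnorm_sq :: "real \<Rightarrow> (real \<Rightarrow> real) \<Rightarrow> real" where
  "wnorm_sq c w = integral {0..1} (\<lambda>x. exp (c * x) * (w x)\<^sup>2)"

definition feedback :: "(real \<Rightarrow> real \<Rightarrow> real) \<Rightarrow> (real \<Rightarrow> real \<Rightarrow> real) \<Rightarrow> real \<Rightarrow> real" where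
  "feedback khat u t = integral {0..1} (\<lambda>y. khat (1 - y) t * u y t)"

definition backstepping ::
    "(real \<Rightarrow> real \<Rightarrow> real) \<Rightarrow> (real \<Rightarrow> real \<Rightarrow> real) \<Rightarrow> real \<Rightarrow> real \<Rightarrow> real" where
  "backstepping khat u x t = u x t - conv (\<lambda>y. khat y t) (\<lambda>y. u y t) x"

definition tau ::
    "real \<Rightarrow> real \<Rightarrow> (real \<Rightarrow> real \<Rightarrow> real) \<Rightarrow> (real \<Rightarrow> real \<Rightarrow> real) \<Rightarrow> real \<Rightarrow> real \<Rightarrow> real" where
  "tau c \<gamma> khat w x t =
     \<gamma> / (1 + wnorm_sq c (\<lambda>y. w y t)) *
     (exp (c * x) * w x t - integral {x..1} (\<lambda>y. khat (y - x) t * exp (c * y) * w y t)) * w 0 t"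

definition update_solution ::
    "real \<Rightarrow> (real \<Rightarrow> real \<Rightarrow> real) \<Rightarrow> (real \<Rightarrow> real \<Rightarrow> real) \<Rightarrow> bool" where
  "update_solution B \<tau> \<beta>hat \<longleftrightarrow>
     (\<forall>x\<in>{0..1}.
        (\<forall>T\<ge>0. abs_continuous_on_ivl 0 T (\<lambda>t. \<beta>hat x t)) \<and>
        (AE t in lborel. t \<ge> 0 \<longrightarrow>
           (\<exists>v\<in>filippov_Proj B (\<tau> x t) (\<beta>hat x t).
              ((\<lambda>s. \<beta>hat x s) has_real_derivative v) (at t))))"

definition closed_loop ::
    "real \<Rightarrow> real \<Rightarrow> real \<Rightarrow> ((real \<Rightarrow> real) \<Rightarrow> real \<Rightarrow> real) \<Rightarrow> (real \<Rightarrow> real) \<Rightarrow>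
     (real \<Rightarrow> real \<Rightarrow> real) \<Rightarrow> (real \<Rightarrow> real \<Rightarrow> real) \<Rightarrow> bool" where
  "closed_loop B c \<gamma> Khat \<beta> \<beta>hat u \<longleftrightarrow>
     (let khat = (\<lambda>x t. Khat (\<lambda>y. \<beta>hat y t) x); w = backstepping khat u in
        plant_solution \<beta> (feedback khat u) u \<and>
        update_solution B (tau c \<gamma> khat w) \<beta>hat)"

text \<open>
  The time derivative of an absolutely continuous \<open>\<beta>hat\<close> exists only almost everywhere, hence its
  membership in \<open>H M K\<close> is required for almost every time. The estimate itself has to remain
  Lipschitz with the constant \<open>K\<close> of \<open>H M K\<close>, the set on which the neural operator is accurate.
\<close>

definition regular_solution ::
    "real \<Rightarrow> real \<Rightarrow> ((real \<Rightarrow> real) \<Rightarrow> real \<Rightarrow> real) \<Rightarrow> (real \<Rightarrow> real \<Rightarrow> real) \<Rightarrow> bool" where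
  "regular_solution M K Khat \<beta>hat \<longleftrightarrow>
     (AE t in lborel. t \<ge> 0 \<longrightarrow>
        (\<exists>v\<in>H M K. \<forall>x\<in>{0..1}. ((\<lambda>s. \<beta>hat x s) has_real_derivative v x) (at t))) \<and>
     (\<forall>x\<in>{0..1}. \<forall>t\<ge>0. (\<lambda>s. Khat (\<lambda>y. \<beta>hat y s) x) differentiable (at t within {0..})) \<and>
     (\<forall>t\<ge>0. K-lipschitz_on {0..1} (\<lambda>x. \<beta>hat x t))"

definition Gamma_fun ::
    "(real \<Rightarrow> real) \<Rightarrow> (real \<Rightarrow> real \<Rightarrow> real) \<Rightarrow> (real \<Rightarrow> real \<Rightarrow> real) \<Rightarrow> real \<Rightarrow> real" where
  "Gamma_fun \<beta> \<beta>hat u t = integral {0..1} (\<lambda>x. (u x t)\<^sup>2 + (\<beta> x - \<beta>hat x t)\<^sup>2)"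

end

theory Submission
  imports Defs
begin

text \<open>
  Let \<open>k\<close> be the exact kernel of the current estimate and \<open>z = u - k * u\<close>, so that conversely
  \<open>u = z - \<beta>hat * z\<close>. The Lyapunov function is \<open>V = ln (1 + \<parallel>z\<parallel>\<^sub>c\<^sup>2) + \<parallel>\<beta> - \<beta>hat\<parallel>\<^sup>2 / \<gamma>\<close>. Because it is built
  from \<open>k\<close> and not from the neural approximation, the time derivative of the latter, on which the
  accuracy gives no control, never appears: the approximation enters only through the boundary value
  \<open>z(1, t)\<close> and through the difference between the actual update law and the one with \<open>k\<close> and \<open>z\<close>,
  and both are of order \<open>\<epsilon>\<close>. For small \<open>\<epsilon>\<close> and \<open>\<gamma>\<close> this gives
  \<open>V' \<le> - u(0, t)\<^sup>2 / (2 (1 + \<parallel>z\<parallel>\<^sub>c\<^sup>2))\<close> at almost every time. Hence \<open>V\<close> decreases, which bounds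
  \<open>\<Gamma>\<close>, and \<open>u(0, \<cdot>)\<close> is square integrable. Since the state is determined by the boundary values
  \<open>u(0, s)\<close> with \<open>t \<le> s \<le> t + 1\<close> and \<open>u(0, t + 1)\<close> is bounded by their mean, \<open>u\<close> tends to \<open>0\<close>.
\<close>

section \<open>Convolution and Volterra equations\<close>

text \<open>The logarithm in \<open>V\<close> is dictated by the normalization of the update law:
  its derivative divides the growth of the weighted norm by 1 + \<open>N\<close>, and the
  contribution of the estimation error then cancels against the derivative of the quadratic term, up
  to order \<open>\<epsilon>\<close>. The weight exp (c x) supplies the negative terms - c
  \<open>N\<close> and - u(0, t)^2, which absorb the errors; an error of order
  \<open>\<gamma>\<close> arises because the exact kernel moves with the estimate. The obstacle is
  regularity. The plant equation holds almost everywhere in the plane, which says nothing about one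
  given time, and the estimate is differentiable only at almost every time, so \<open>V\<close> has
  no classical derivative to compute. The plant equation is therefore integrated along
  characteristics, where it becomes an identity valid everywhere up to x = 1; this makes
  \<open>V\<close> Lipschitz on bounded time intervals. One-sided difference quotients of
  \<open>V\<close> along the single sequence \<open>step\<close> are bounded at almost every time,
  and for a Lipschitz function this suffices for monotonicity.\<close>

lemma triangle_integral_swap:
  fixes F :: "real \<Rightarrow> real \<Rightarrow> real"
  assumes F: "continuous_on {(y, s). 0 \<le> s \<and> s \<le> y \<and> y \<le> x} (\<lambda>(y, s). F y s)"
  shows "integral {0..x} (\<lambda>y. integral {0..y} (\<lambda>s. F y s)) =
         integral {0..x} (\<lambda>s. integral {s..x} (\<lambda>y. F y s))"
proof -
  define S where "S = {(y, s). 0 \<le> s \<and> s \<le> y \<and> y \<le> (x::real)}"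
  have S_eq: "S = {p. 0 \<le> snd p} \<inter> {p. snd p \<le> fst p} \<inter> {p. fst p \<le> x}"
    by (auto simp: S_def)
  have "closed S" unfolding S_eq
    by (intro closed_Int closed_Collect_le continuous_intros)
  moreover have "bounded S"
    by (rule bounded_subset[of "{0..x} \<times> {0..x}"]) (auto simp: S_def intro: bounded_Times)
  ultimately have "compact S" by (simp add: compact_eq_bounded_closed)
  \<comment> \<open>\<open>G\<close> extends the integrand by zero to the plane. The extension may
    jump at the boundary of the triangle, so the exchange is made with Lebesgue integrals;
    compactness of the triangle gives integrability.\<close>
  define G where "G = (\<lambda>y s. indicator S (y, s) * F y s)"
  have "integrable lborel (\<lambda>p. indicator S p *\<^sub>R (\<lambda>(y, s). F y s) p)"
    using \<open>compact S\<close> F by (intro borel_integrable_compact) (simp_all add: S_def)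
  also have "(\<lambda>p. indicator S p *\<^sub>R (\<lambda>(y, s). F y s) p) = (\<lambda>(y, s). G y s)"
    by (auto simp: G_def fun_eq_iff)
  finally have G: "integrable (lborel \<Otimes>\<^sub>M lborel) (\<lambda>(y, s). G y s)"
    by (simp add: lborel_prod)
  have swap: "(\<integral>s. \<integral>y. G y s \<partial>lborel \<partial>lborel) = (\<integral>y. \<integral>s. G y s \<partial>lborel \<partial>lborel)"
    using lborel_pair.Fubini_integral[OF G] .
  have in1: "(\<integral>s. G y s \<partial>lborel) = indicator {0..x} y * integral {0..y} (\<lambda>s. F y s)" for y
  proof -
    have c: "continuous_on {0..y} (\<lambda>s. F y s)" if "y \<in> {0..x}"
      using that by (intro continuous_on_compose2[OF F, of _ "\<lambda>s. (y, s)", simplified]) (auto intro!: continuous_intros)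
    have "(\<integral>s. G y s \<partial>lborel) = (\<integral>s. indicator {0..x} y * (indicator {0..y} s * F y s) \<partial>lborel)"
      by (intro Bochner_Integration.integral_cong) (auto simp: G_def S_def indicator_def)
    also have "\<dots> = indicator {0..x} y * (LINT s:{0..y}|lborel. F y s)"
      by (simp add: set_lebesgue_integral_def)
    finally show ?thesis
      using set_borel_integral_eq_integral(2)[OF borel_integrable_atLeastAtMost'[OF c]]
      by (auto simp: indicator_def)
  qed
  have in2: "(\<integral>y. G y s \<partial>lborel) = indicator {0..x} s * integral {s..x} (\<lambda>y. F y s)" for s
  proof -
    have c: "continuous_on {s..x} (\<lambda>y. F y s)" if "s \<in> {0..x}"
      using that by (intro continuous_on_compose2[OF F, of _ "\<lambda>y. (y, s)", simplified]) (auto intro!: continuous_intros)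
    have "(\<integral>y. G y s \<partial>lborel) = (\<integral>y. indicator {0..x} s * (indicator {s..x} y * F y s) \<partial>lborel)"
      by (intro Bochner_Integration.integral_cong) (auto simp: G_def S_def indicator_def)
    also have "\<dots> = indicator {0..x} s * (LINT y:{s..x}|lborel. F y s)"
      by (simp add: set_lebesgue_integral_def)
    finally show ?thesis
      using set_borel_integral_eq_integral(2)[OF borel_integrable_atLeastAtMost'[OF c]]
      by (auto simp: indicator_def)
  qed
  have int1: "integrable lborel (\<lambda>y. \<integral>s. G y s \<partial>lborel)"
    using lborel_pair.integrable_fst'[OF G] by simp
  have int2: "integrable lborel (\<lambda>s. \<integral>y. G y s \<partial>lborel)"
    using lborel_pair.integrable_snd[OF G] by simp
  have "(\<integral>y. \<integral>s. G y s \<partial>lborel \<partial>lborel) = integral {0..x} (\<lambda>y. integral {0..y} (\<lambda>s. F y s))"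
    using set_borel_integral_eq_integral(2)[of "{0..x}" "\<lambda>y. integral {0..y} (\<lambda>s. F y s)"] int1
    by (simp add: in1 set_integrable_def set_lebesgue_integral_def)
  moreover have "(\<integral>s. \<integral>y. G y s \<partial>lborel \<partial>lborel) = integral {0..x} (\<lambda>s. integral {s..x} (\<lambda>y. F y s))"
    using set_borel_integral_eq_integral(2)[of "{0..x}" "\<lambda>s. integral {s..x} (\<lambda>y. F y s)"] int2
    by (simp add: in2 set_integrable_def set_lebesgue_integral_def)
  ultimately show ?thesis using swap by simp
qed

lemma integral_stretch_unit:
  fixes f :: "real \<Rightarrow> real"
  assumes "0 \<le> x"
  shows "integral {0..x} f = x * integral {0..1} (\<lambda>r. f (x * r))"
proof (cases "x = 0")
  case False
  then have x: "x > 0" using assms by simp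
  have "(\<lambda>y. y / x) ` {0..x} = {0..1}"
  proof -
    have "y \<in> (\<lambda>y. y / x) ` {0..x}" if "y \<in> {0..1}" for y
      by (rule image_eqI[of _ _ "y * x"]) (use x that in \<open>auto simp: mult_left_le_one_le\<close>)
    then show ?thesis using x by auto
  qed
  then show ?thesis using integral_stretch_real[of x 0 x f] x by simp
qed simp

text \<open>The substitution y = x r moves the variable upper limit into the integrand; on the fixed
  interval that remains, continuity under the integral sign applies.\<close>

lemma continuous_on_volterra:
  fixes F :: "real \<Rightarrow> real \<Rightarrow> real"
  assumes F: "continuous_on {(x, y). 0 \<le> y \<and> y \<le> x \<and> x \<le> b} (\<lambda>(x, y). F x y)"
  shows "continuous_on {0..b} (\<lambda>x. integral {0..x} (F x))"
proof -
  have "continuous_on {0..b} (\<lambda>x. integral (cbox 0 1) (\<lambda>r. x * F x (x * r)))"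
  proof (rule integral_continuous_on_param)
    have "continuous_on ({0..b} \<times> cbox 0 1) (\<lambda>p. F (fst p) (fst p * snd p))"
      by (intro continuous_on_compose2[OF F, of _ "\<lambda>p. (fst p, fst p * snd p)", simplified])
        (auto intro!: continuous_intros simp: mult_left_le)
    then show "continuous_on ({0..b} \<times> cbox 0 1) (\<lambda>(x, r). x * F x (x * r))"
      by (auto simp: case_prod_unfold intro!: continuous_intros)
  qed
  then show ?thesis
    by (rule continuous_on_eq) (metis atLeastAtMost_iff box_real(2) integral_mult_right integral_stretch_unit)
qed

section \<open>Algebra and size of convolutions of continuous functions\<close>

lemma conv_cong:
  assumes "0 \<le> x" "x \<le> b" "\<And>y. y \<in> {0..b} \<Longrightarrow> a y = a' y" "\<And>y. y \<in> {0..b} \<Longrightarrow> f y = f' y"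
  shows "conv a f x = conv a' f' x"
  unfolding conv_def by (rule integral_cong) (use assms in auto)

lemma continuous_on_conv_integrand:
  fixes a f :: "real \<Rightarrow> real"
  assumes "continuous_on {0..b} a" "continuous_on {0..b} f" "x \<in> {0..b}"
  shows "continuous_on {0..x} (\<lambda>y. a (x - y) * f y)"
  by (intro continuous_intros continuous_on_compose2[OF assms(1)] continuous_on_compose2[OF assms(2)])
    (use assms(3) in auto)

lemma conv_integrable:
  fixes a f :: "real \<Rightarrow> real"
  assumes "continuous_on {0..b} a" "continuous_on {0..b} f" "x \<in> {0..b}"
  shows "(\<lambda>y. a (x - y) * f y) integrable_on {0..x}"
  using continuous_on_conv_integrand[OF assms] by (rule integrable_continuous_interval)

lemma continuous_on_conv [continuous_intros]:
  assumes "continuous_on {0..b} a" "continuous_on {0..b} f"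
  shows "continuous_on {0..b} (conv a f)"
proof -
  have "continuous_on {0..b} (\<lambda>x. integral {0..x} (\<lambda>y. a (x - y) * f y))"
    unfolding case_prod_unfold
    by (rule continuous_on_volterra, unfold case_prod_unfold)
      (intro continuous_intros continuous_on_compose2[OF assms(1)] continuous_on_compose2[OF assms(2)];
       auto)
  then show ?thesis by (simp add: conv_def[abs_def])
qed

lemma integral_flip:
  fixes f :: "real \<Rightarrow> real"
  shows "integral {0..x} (\<lambda>y. f (x - y)) = integral {0..x} f"
proof -
  have "integral {0..x} (\<lambda>y. f (x - y)) = integral {- x..0} (\<lambda>y. f (x + y))"
    using Henstock_Kurzweil_Integration.integral_reflect_real[of 0 "-x" "\<lambda>y. f (x + y)"] by simp
  also have "\<dots> = integral {0..x} f"
    using integral_shift_Icc_real[of "-x" 0 f x] by (simp add: o_def)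
  finally show ?thesis .
qed

lemma conv_commute: "conv a f x = conv f a x"
  using integral_flip[of x "\<lambda>y. a y * f (x - y)"] by (simp add: conv_def mult.commute)

text \<open>Swapping the integrals over the triangle s \<le> y \<le> x and shifting the inner
  variable by s leaves the convolution of \<open>a\<close> and \<open>f\<close> at x - s.\<close>

lemma conv_assoc:
  assumes a: "continuous_on {0..b} a" and f: "continuous_on {0..b} f"
    and g: "continuous_on {0..b} g" and x: "x \<in> {0..b}"
  shows "conv (conv a f) g x = conv a (conv f g) x"
proof -
  have "conv a (conv f g) x =
      integral {0..x} (\<lambda>y. integral {0..y} (\<lambda>s. a (x - y) * (f (y - s) * g s)))"
    by (simp add: conv_def)
  also have "\<dots> = integral {0..x} (\<lambda>s. integral {s..x} (\<lambda>y. a (x - y) * (f (y - s) * g s)))"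
    by (rule triangle_integral_swap, unfold case_prod_unfold)
      (intro continuous_intros continuous_on_compose2[OF a] continuous_on_compose2[OF f]
        continuous_on_compose2[OF g]; use x in auto)
  also have "\<dots> = integral {0..x} (\<lambda>s. conv a f (x - s) * g s)"
  proof (rule integral_cong)
    fix s assume "s \<in> {0..x}"
    have "integral {s..x} (\<lambda>y. a (x - y) * (f (y - s) * g s)) =
          integral {0..x - s} (\<lambda>r. a (x - s - r) * f r * g s)"
      using integral_shift_Icc_real[of 0 "x - s" "\<lambda>y. a (x - y) * (f (y - s) * g s)" s]
      by (simp add: o_def algebra_simps)
    then show "integral {s..x} (\<lambda>y. a (x - y) * (f (y - s) * g s)) = conv a f (x - s) * g s"
      by (simp add: conv_def)
  qed
  finally show ?thesis by (simp add: conv_def)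
qed

context
  fixes b x :: real
  assumes x: "x \<in> {0..b}"
begin

lemma conv_add_right:
  assumes "continuous_on {0..b} a" "continuous_on {0..b} f" "continuous_on {0..b} g"
  shows "conv a (\<lambda>y. f y + g y) x = conv a f x + conv a g x"
  unfolding conv_def
  using integral_add[OF conv_integrable[OF assms(1,2) x] conv_integrable[OF assms(1,3) x]]
  by (simp add: distrib_left)

lemma conv_diff_right:
  assumes "continuous_on {0..b} a" "continuous_on {0..b} f" "continuous_on {0..b} g"
  shows "conv a (\<lambda>y. f y - g y) x = conv a f x - conv a g x"
  unfolding conv_def
  using integral_diff[OF conv_integrable[OF assms(1,2) x] conv_integrable[OF assms(1,3) x]]
  by (simp add: right_diff_distrib)

lemma conv_diff_left:
  assumes "continuous_on {0..b} a" "continuous_on {0..b} f" "continuous_on {0..b} g"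
  shows "conv (\<lambda>y. f y - g y) a x = conv f a x - conv g a x"
  using conv_diff_right[OF assms] by (simp only: conv_commute)

lemma abs_conv_le_integral:
  assumes "continuous_on {0..b} a" "continuous_on {0..b} f" "\<And>y. y \<in> {0..b} \<Longrightarrow> \<bar>a y\<bar> \<le> A"
  shows "\<bar>conv a f x\<bar> \<le> A * integral {0..x} (\<lambda>y. \<bar>f y\<bar>)"
proof -
  have f: "continuous_on {0..x} f" using assms(2) by (rule continuous_on_subset) (use x in auto)
  have "norm (integral {0..x} (\<lambda>y. a (x - y) * f y)) \<le> integral {0..x} (\<lambda>y. A * \<bar>f y\<bar>)"
  proof (rule integral_norm_bound_integral[OF conv_integrable[OF assms(1,2) x]])
    show "(\<lambda>y. A * \<bar>f y\<bar>) integrable_on {0..x}"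
      by (intro integrable_continuous_interval continuous_intros f)
  qed (use assms(3) x in \<open>auto simp: abs_mult intro!: mult_right_mono\<close>)
  then show ?thesis by (simp add: conv_def)
qed

lemma abs_conv_le:
  assumes "continuous_on {0..b} a" "continuous_on {0..b} f"
    "\<And>y. y \<in> {0..b} \<Longrightarrow> \<bar>a y\<bar> \<le> A" "\<And>y. y \<in> {0..b} \<Longrightarrow> \<bar>f y\<bar> \<le> F"
  shows "\<bar>conv a f x\<bar> \<le> A * F * x"
proof -
  have "0 \<le> \<bar>a 0\<bar>" "0 \<in> {0..b}" using x by auto
  then have "0 \<le> A" using assms(3)[of 0] by linarith
  have f: "continuous_on {0..x} f" using assms(2) by (rule continuous_on_subset) (use x in auto)
  have "integral {0..x} (\<lambda>y. \<bar>f y\<bar>) \<le> integral {0..x} (\<lambda>y. F)"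
    by (intro integral_le integrable_continuous_interval continuous_intros f)
      (use assms(4) x in auto)
  then have "A * integral {0..x} (\<lambda>y. \<bar>f y\<bar>) \<le> A * (F * x)"
    using \<open>0 \<le> A\<close> x by (intro mult_left_mono) (simp_all add: mult.commute)
  then show ?thesis using abs_conv_le_integral[OF assms(1-3)] by (simp add: mult.assoc)
qed

end

section \<open>Bounds, existence and uniqueness for Volterra equations\<close>

lemma integral_exp_mult:
  assumes "0 \<le> x" "l \<noteq> 0"
  shows "integral {0..x} (\<lambda>y. exp (l * y)) = (exp (l * x) - 1) / (l::real)"
proof -
  have "((\<lambda>y. exp (l * y)) has_integral (exp (l * x) / l - exp (l * 0) / l)) {0..x}"
    using assms by (intro fundamental_theorem_of_calculus)
      (auto intro!: derivative_eq_intros simp: has_real_derivative_iff_has_vector_derivative[symmetric])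
  then show ?thesis by (simp add: integral_unique diff_divide_distrib)
qed

text \<open>In the weighted supremum norm with weight \<open>exp (- 2 B x)\<close> the Volterra operator has norm at
  most \<open>1/2\<close>.\<close>

lemma volterra_bound:
  fixes f :: "real \<Rightarrow> real"
  assumes f: "continuous_on {0..b} f" and B: "B > 0"
    and le: "\<And>x. x \<in> {0..b} \<Longrightarrow> \<bar>f x\<bar> \<le> A + B * integral {0..x} (\<lambda>y. \<bar>f y\<bar>)"
    and x: "x \<in> {0..b}"
  shows "\<bar>f x\<bar> \<le> 2 * A * exp (2 * B * x)"
proof -
  define m where "m = (\<lambda>x. \<bar>f x\<bar> * exp (- (2 * B * x)))"
  have "continuous_on {0..b} m" unfolding m_def by (intro continuous_intros f)
  \<comment> \<open>At a maximum point of the weighted function the integral inequality closes on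
    itself: it becomes m X \<le> A + m X / 2.\<close>
  then obtain X where X: "X \<in> {0..b}" "\<And>y. y \<in> {0..b} \<Longrightarrow> m y \<le> m X"
    using continuous_attains_sup[of "{0..b}" m] x by auto
  have f_le: "\<bar>f y\<bar> \<le> m X * exp (2 * B * y)" if "y \<in> {0..b}" for y
  proof -
    have "\<bar>f y\<bar> = m y * exp (2 * B * y)" by (simp add: m_def mult_exp_exp)
    then show ?thesis using X(2)[OF that] by simp
  qed
  have "0 \<le> m X" by (simp add: m_def)
  have fX: "continuous_on {0..X} f" using f by (rule continuous_on_subset) (use X in auto)
  have "A \<ge> 0" using le[of 0] x abs_ge_zero[of "f 0"] by auto
  have "integral {0..X} (\<lambda>y. \<bar>f y\<bar>) \<le> integral {0..X} (\<lambda>y. m X * exp (2 * B * y))"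
    by (intro integral_le integrable_continuous_interval continuous_intros fX) (use f_le X in auto)
  also have "\<dots> = m X * ((exp (2 * B * X) - 1) / (2 * B))"
    using integral_exp_mult[of X "2 * B"] X B by simp
  finally have "\<bar>f X\<bar> \<le> A + B * (m X * ((exp (2 * B * X) - 1) / (2 * B)))"
    using le[OF X(1)] B by (smt (verit) mult_left_mono)
  also have "\<dots> = A + m X * (exp (2 * B * X) - 1) / 2" using B by simp
  also have "\<dots> \<le> A + m X * exp (2 * B * X) / 2" using \<open>0 \<le> m X\<close> by (simp add: algebra_simps)
  finally have "\<bar>f X\<bar> * exp (- (2 * B * X)) \<le> (A + m X * exp (2 * B * X) / 2) * exp (- (2 * B * X))"
    by (intro mult_right_mono) auto
  then have "m X \<le> A * exp (- (2 * B * X)) + m X / 2"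
    by (simp add: m_def algebra_simps mult_exp_exp)
  moreover have "A * exp (- (2 * B * X)) \<le> A"
    using \<open>A \<ge> 0\<close> X B by (intro mult_left_le) auto
  ultimately have "m X \<le> 2 * A" by simp
  then show ?thesis using f_le[OF x] by (smt (verit) exp_gt_zero mult_right_mono)
qed

text \<open>The tool by which smallness of a source \<open>h\<close> is passed on to the solution.
  The endpoint \<open>b\<close> is kept free because the increments of the target state along
  characteristics satisfy their Volterra equation on \<open>{0..1 - h}\<close> only.\<close>

lemma conv_volterra_bound:
  assumes f: "continuous_on {0..b} f" and \<phi>: "continuous_on {0..b} \<phi>" and B: "B > 0"
    and \<phi>_le: "\<And>x. x \<in> {0..b} \<Longrightarrow> \<bar>\<phi> x\<bar> \<le> B"
    and eq: "\<And>x. x \<in> {0..b} \<Longrightarrow> f x = h x + conv \<phi> f x"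
    and h: "\<And>x. x \<in> {0..b} \<Longrightarrow> \<bar>h x\<bar> \<le> A"
    and x: "x \<in> {0..b}"
  shows "\<bar>f x\<bar> \<le> 2 * A * exp (2 * B * x)"
proof (rule volterra_bound[OF f B _ x])
  fix y assume y: "y \<in> {0..b}"
  show "\<bar>f y\<bar> \<le> A + B * integral {0..y} (\<lambda>y. \<bar>f y\<bar>)"
    using eq[OF y] h[OF y] abs_conv_le_integral[OF y \<phi> f \<phi>_le] by linarith
qed

text \<open>Contraction principle for the unknown f = k / e with e(x) = exp (2 B x): the plain
  supremum distance of f corresponds to the weighted distance of k, in which the Volterra operator
  contracts by the factor 1/2. Since \<open>bcontfun\<close> consists of functions on the whole
  line, \<open>p\<close> clamps the argument to the unit interval.\<close>

lemma volterra_kernel_exists: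
  assumes \<phi>: "continuous_on {0..1} \<phi>" and B: "B > 0"
    and \<phi>_le: "\<And>x. x \<in> {0..1} \<Longrightarrow> \<bar>\<phi> x\<bar> \<le> B"
  shows "\<exists>k. continuous_on {0..1} k \<and> (\<forall>x\<in>{0..1}. k x = - \<phi> x + conv \<phi> k x)"
proof -
  define e where "e = (\<lambda>x::real. exp (2 * B * x))"
  have e0: "e x > 0" for x by (simp add: e_def)
  define p where "p = (\<lambda>x::real. max 0 (min 1 x))"
  have p: "p x \<in> {0..1}" for x by (auto simp: p_def)
  have p_id: "p x = x" if "x \<in> {0..1}" for x using that by (auto simp: p_def)
  have cont_e: "continuous_on S e" for S unfolding e_def by (intro continuous_intros)
  have cont_p: "continuous_on S p" for S unfolding p_def by (intro continuous_intros)
  define q where "q = (\<lambda>(f :: real \<Rightarrow>\<^sub>C real) x. (- \<phi> x + conv \<phi> (\<lambda>y. e y * f y) x) / e x)"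
  have cont_ef: "continuous_on {0..1} (\<lambda>y. e y * apply_bcontfun f y)" for f
    by (intro continuous_intros cont_e continuous_on_apply_bcontfun)
  have cont_q: "continuous_on {0..1} (q f)" for f
    unfolding q_def using e0 
    by (intro continuous_intros cont_e \<phi> cont_ef) (auto simp: less_imp_neq[symmetric])
  have bcont: "(\<lambda>x. q f (p x)) \<in> bcontfun" for f
  proof -
    have "continuous_on UNIV (\<lambda>x. q f (p x))"
      by (rule continuous_on_compose2[OF cont_q cont_p]) (use p in auto)
    moreover have "bounded (range (\<lambda>x. q f (p x)))"
    proof (rule bounded_subset)
      show "bounded (q f ` {0..1})"
        by (intro compact_imp_bounded compact_continuous_image cont_q) auto
    qed (use p in auto)
    ultimately show ?thesis by (simp add: bcontfun_def)
  qed
  define T where "T = (\<lambda>f. Bcontfun (\<lambda>x. q f (p x)))"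
  have T: "apply_bcontfun (T f) x = q f (p x)" for f x
    unfolding T_def using bcont by (simp add: Bcontfun_inverse)
  have "dist (T f) (T g) \<le> 1/2 * dist f g" for f g
  proof (rule dist_bound)
    fix x
    let ?d = "\<lambda>y. e y * apply_bcontfun f y - e y * apply_bcontfun g y"
    have x: "p x \<in> {0..1}" by (rule p)
    have "\<bar>conv \<phi> ?d (p x)\<bar> \<le> B * integral {0..p x} (\<lambda>y. \<bar>?d y\<bar>)"
      by (rule abs_conv_le_integral[OF x \<phi> _ \<phi>_le]) (intro continuous_intros cont_ef)
    also have "integral {0..p x} (\<lambda>y. \<bar>?d y\<bar>) \<le> integral {0..p x} (\<lambda>y. dist f g * exp (2 * B * y))"
    proof (rule integral_le)
      fix y
      have "\<bar>?d y\<bar> = e y * \<bar>apply_bcontfun f y - apply_bcontfun g y\<bar>"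
        using e0[of y] by (simp add: right_diff_distrib[symmetric] abs_mult)
      also have "\<dots> \<le> e y * dist f g"
        using dist_bounded[of f y g] e0[of y] by (intro mult_left_mono) (auto simp: dist_real_def)
      finally show "\<bar>?d y\<bar> \<le> dist f g * exp (2 * B * y)" by (simp add: e_def mult.commute)
    qed (intro integrable_continuous_interval continuous_intros cont_e continuous_on_apply_bcontfun)+
    also have "\<dots> = dist f g * ((e (p x) - 1) / (2 * B))"
      using integral_exp_mult[of "p x" "2 * B"] x B by (simp add: e_def)
    also have "B * (dist f g * ((e (p x) - 1) / (2 * B))) \<le> 1/2 * dist f g * e (p x)"
      using B by (simp add: field_simps)
    finally have *: "\<bar>conv \<phi> ?d (p x)\<bar> \<le> 1/2 * dist f g * e (p x)"
      using B by simp
    have "apply_bcontfun (T f) x - apply_bcontfun (T g) x = conv \<phi> ?d (p x) / e (p x)"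
      unfolding T q_def using conv_diff_right[OF x \<phi> cont_ef cont_ef]
      by (simp add: diff_divide_distrib[symmetric])
    then have "dist (apply_bcontfun (T f) x) (apply_bcontfun (T g) x) = \<bar>conv \<phi> ?d (p x)\<bar> / e (p x)"
      using e0[of "p x"] by (simp add: dist_real_def abs_divide)
    also have "\<dots> \<le> 1/2 * dist f g"
      using * e0[of "p x"] by (simp add: pos_divide_le_eq)
    finally show "dist (apply_bcontfun (T f) x) (apply_bcontfun (T g) x) \<le> 1/2 * dist f g" .
  qed
  then obtain f where f: "T f = f"
    using banach_fix_type[of "1/2" T] by auto
  let ?k = "\<lambda>y. e y * apply_bcontfun f y"
  have "?k x = - \<phi> x + conv \<phi> ?k x" if "x \<in> {0..1}" for x
    using T[of f x] e0[of x] p_id[OF that] unfolding f by (simp add: q_def field_simps)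
  then show ?thesis using cont_ef by blast
qed

lemma volterra_kernel_unique:
  assumes "continuous_on {0..1} \<phi>" "B > 0" "\<And>x. x \<in> {0..1} \<Longrightarrow> \<bar>\<phi> x\<bar> \<le> B"
    and f: "continuous_on {0..1} f" "\<And>x. x \<in> {0..1} \<Longrightarrow> f x = h x + conv \<phi> f x"
    and g: "continuous_on {0..1} g" "\<And>x. x \<in> {0..1} \<Longrightarrow> g x = h x + conv \<phi> g x"
    and x: "x \<in> {0..1}"
  shows "f x = g x"
proof -
  have "\<bar>f x - g x\<bar> \<le> 2 * 0 * exp (2 * B * x)"
  proof (rule conv_volterra_bound[OF _ assms(1-3), where f = "\<lambda>x. f x - g x" and h = "\<lambda>_. 0"])
    show "f y - g y = 0 + conv \<phi> (\<lambda>x. f x - g x) y" if "y \<in> {0..1}" for y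
      using conv_diff_right[OF that assms(1) f(1) g(1)] f(2)[OF that] g(2)[OF that] by simp
  qed (use x f g in \<open>auto intro!: continuous_intros\<close>)
  then show ?thesis by simp
qed

text \<open>Existence and uniqueness give the definite description its meaning. Cutting a solution
  off outside the unit interval leaves its convolutions on the interval unchanged, so the convention
  of value 0 outside is harmless.\<close>

lemma kernel_op:
  assumes \<phi>: "continuous_on {0..1} \<phi>" and B: "B > 0"
    and \<phi>_le: "\<And>x. x \<in> {0..1} \<Longrightarrow> \<bar>\<phi> x\<bar> \<le> B"
  shows "continuous_on {0..1} (kernel_op \<phi>)"
    and "\<And>x. x \<in> {0..1} \<Longrightarrow> kernel_op \<phi> x = - \<phi> x + conv \<phi> (kernel_op \<phi>) x"
    and "\<And>x. x \<in> {0..1} \<Longrightarrow> \<bar>kernel_op \<phi> x\<bar> \<le> 2 * B * exp (2 * B)"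
proof -
  let ?P = "\<lambda>k. continuous_on {0..1} k \<and> (\<forall>x. x \<notin> {0..1} \<longrightarrow> k x = 0) \<and>
     (\<forall>x\<in>{0..1}. k x = - \<phi> x + conv \<phi> k x)"
  obtain k where k: "continuous_on {0..1} k" "\<forall>x\<in>{0..1}. k x = - \<phi> x + conv \<phi> k x"
    using volterra_kernel_exists[OF assms] by blast
  define k' where "k' = (\<lambda>x. if x \<in> {0..1} then k x else 0)"
  have eq: "conv \<phi> k' x = conv \<phi> k x" if "x \<in> {0..1}" for x
    by (rule conv_cong[of _ 1]) (use that in \<open>auto simp: k'_def\<close>)
  have "?P k'"
    using k eq continuous_on_cong[of "{0..1}" "{0..1}" k' k] by (auto simp: k'_def)
  moreover have "f = k'" if "?P f" for f
  proof
    fix x show "f x = k' x"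
      using volterra_kernel_unique[OF \<phi> B \<phi>_le, of f "\<lambda>x. - \<phi> x" k' x] that \<open>?P k'\<close>
      by (cases "x \<in> {0..1}") auto
  qed
  ultimately have P: "?P (kernel_op \<phi>)"
    unfolding kernel_op_def by (rule theI)
  then show c: "continuous_on {0..1} (kernel_op \<phi>)"
    and e: "\<And>x. x \<in> {0..1} \<Longrightarrow> kernel_op \<phi> x = - \<phi> x + conv \<phi> (kernel_op \<phi>) x" by blast+
  fix x :: real assume x: "x \<in> {0..1}"
  have "\<bar>kernel_op \<phi> x\<bar> \<le> 2 * B * exp (2 * B * x)"
    by (rule conv_volterra_bound[OF c \<phi> B \<phi>_le e]) (use \<phi>_le x in auto)
  also have "\<dots> \<le> 2 * B * exp (2 * B)" using B x by (auto simp: mult_left_le)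
  finally show "\<bar>kernel_op \<phi> x\<bar> \<le> 2 * B * exp (2 * B)" .
qed

text \<open>The kernel \<open>k = - \<phi> + \<phi> * k\<close> is characterised by
  \<open>(\<delta> - \<phi>) * (\<delta> - k) = \<delta>\<close> with the Dirac measure \<open>\<delta>\<close>.\<close>

lemma volterra_solution:
  fixes \<phi> k :: "real \<Rightarrow> real" and b :: real
  assumes \<phi>: "continuous_on {0..b} \<phi>" and k: "continuous_on {0..b} k"
    and kernel: "\<And>x. x \<in> {0..b} \<Longrightarrow> k x = - \<phi> x + conv \<phi> k x"
    and f: "continuous_on {0..b} f" and x: "x \<in> {0..b}"
  shows "f x - conv k f x = f x + conv \<phi> (\<lambda>y. f y - conv k f y) x"
proof -
  have c: "continuous_on {0..b} (conv k f)" "continuous_on {0..b} (conv \<phi> k)"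
    by (intro continuous_intros \<phi> f k)+
  have b: "0 \<le> x" "x \<le> b" using x by auto
  have "conv \<phi> (\<lambda>y. f y - conv k f y) x = conv \<phi> f x - conv \<phi> (conv k f) x"
    by (rule conv_diff_right[OF x \<phi> f c(1)])
  also have "conv \<phi> (conv k f) x = conv (conv \<phi> k) f x"
    by (rule conv_assoc[OF \<phi> k f x, symmetric])
  also have "conv \<phi> f x - conv (conv \<phi> k) f x = conv (\<lambda>y. \<phi> y - conv \<phi> k y) f x"
    by (rule conv_diff_left[OF x f \<phi> c(2), symmetric])
  also have "\<dots> = conv (\<lambda>y. 0 - k y) f x"
    by (rule conv_cong[OF b]) (use kernel in auto)
  also have "\<dots> = - conv k f x" by (simp add: conv_def)
  finally show ?thesis by simp
qed

section \<open>Absolutely continuous and Lipschitz functions\<close>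

text \<open>A tagged division is taken so fine that on intervals with tag outside \<open>E\<close>
  the increment of \<open>f\<close> is controlled by the derivative at the tag, while the intervals
  with tag in \<open>E\<close> have total length below the threshold of absolute continuity. The
  former contribute at most (C + e) (t - s), the latter less than e.\<close>

lemma abs_continuous_bounded_derivative_imp_lipschitz:
  fixes f :: "real \<Rightarrow> real"
  assumes ac: "abs_continuous_on_ivl a b f" and E: "negligible E" and C: "C \<ge> 0"
    and deriv: "\<And>t. t \<in> {a..b} - E \<Longrightarrow> \<exists>D. \<bar>D\<bar> \<le> C \<and> (f has_real_derivative D) (at t)"
    and st: "a \<le> s" "s \<le> t" "t \<le> b"
  shows "\<bar>f t - f s\<bar> \<le> C * (t - s)"
proof -
  have main: "\<bar>f t - f s\<bar> \<le> (C + e) * (t - s) + e" if e: "e > 0" for e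
  proof -
    from ac e obtain d where d: "d > 0"
      and dI: "\<And>I. finite I \<Longrightarrow> (\<forall>(s, t)\<in>I. a \<le> s \<and> s \<le> t \<and> t \<le> b) \<Longrightarrow>
        pairwise (\<lambda>(s, t) (s', t'). {s<..<t} \<inter> {s'<..<t'} = {}) I \<Longrightarrow>
        (\<Sum>(s, t)\<in>I. t - s) < d \<Longrightarrow> (\<Sum>(s, t)\<in>I. \<bar>f t - f s\<bar>) < e"
      unfolding abs_continuous_on_ivl_def by meson
    \<comment> \<open>Riemann sums of the indicator of \<open>E\<close> add up the lengths of the
      intervals tagged in \<open>E\<close>; the gauge for its vanishing integral makes them short in
      total.\<close>
    have "(indicat_real E has_integral 0) (cbox s t)"
      using E by (simp add: negligible_def)
    then obtain \<gamma>1 where \<gamma>1: "gauge \<gamma>1"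
      "\<And>p. p tagged_division_of cbox s t \<Longrightarrow> \<gamma>1 fine p \<Longrightarrow>
         norm ((\<Sum>(x, k)\<in>p. measure lborel k *\<^sub>R indicat_real E x) - 0) < d"
      unfolding has_integral using d by meson
    have "\<exists>r>0. x \<in> {a..b} - E \<longrightarrow> (\<forall>y. \<bar>y - x\<bar> < r \<longrightarrow> \<bar>f y - f x\<bar> \<le> (C + e) * \<bar>y - x\<bar>)" for x
    proof (cases "x \<in> {a..b} - E")
      case True
      from deriv[OF this] obtain D where D: "\<bar>D\<bar> \<le> C" "(f has_real_derivative D) (at x)" by blast
      from D(2) have "(f has_derivative (\<lambda>h. D * h)) (at x)"
        by (simp add: has_field_derivative_def)
      then obtain r where r: "r > 0"
        "\<And>y. norm (y - x) < r \<Longrightarrow> norm (f y - f x - D * (y - x)) \<le> e * norm (y - x)"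
        using e unfolding has_derivative_at_alt by meson
      have "\<bar>f y - f x\<bar> \<le> (C + e) * \<bar>y - x\<bar>" if "\<bar>y - x\<bar> < r" for y
      proof -
        have "\<bar>D * (y - x)\<bar> \<le> C * \<bar>y - x\<bar>"
          using D(1) by (simp add: abs_mult mult_right_mono)
        then show ?thesis using r(2)[of y] that by (simp add: algebra_simps)
      qed
      then show ?thesis using r(1) by blast
    qed (auto intro: exI[of _ 1])
    then obtain r where r: "\<And>x. r x > 0"
      "\<And>x y. x \<in> {a..b} - E \<Longrightarrow> \<bar>y - x\<bar> < r x \<Longrightarrow> \<bar>f y - f x\<bar> \<le> (C + e) * \<bar>y - x\<bar>"
      by metis
    have "gauge (\<lambda>x. \<gamma>1 x \<inter> ball x (r x))"
      using \<gamma>1(1) r(1) by (intro gauge_Int) (auto intro: gauge_ball_dependent)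
    then obtain p where p: "p tagged_division_of {s..t}" "(\<lambda>x. \<gamma>1 x \<inter> ball x (r x)) fine p"
      by (rule fine_division_exists_real)
    have fine: "\<gamma>1 fine p" "(\<lambda>x. ball x (r x)) fine p"
      using p(2) by (auto simp: fine_def)
    have fin: "finite p" using p(1) by blast
    have K: "\<exists>l u. K = {l..u} \<and> l \<le> x \<and> x \<le> u \<and> s \<le> l \<and> u \<le> t" if "(x, K) \<in> p" for x K
    proof -
      have "x \<in> K" "K \<subseteq> {s..t}" "\<exists>l u. K = cbox l u"
        using tagged_division_ofD(2-4)[OF p(1) that] by auto
      then show ?thesis by auto
    qed
    have KSup: "K = {Inf K..Sup K}" "Inf K \<le> x" "x \<le> Sup K" "s \<le> Inf K" "Sup K \<le> t"
        "measure lborel K = Sup K - Inf K"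
      if "(x, K) \<in> p" for x K
      using K[OF that] by auto
    let ?g = "\<lambda>(x :: real, K). f (Sup K) - f (Inf K)"
    let ?P1 = "{(x, K) \<in> p. x \<notin> E}" and ?P2 = "{(x, K) \<in> p. x \<in> E}"
    have P12: "p = ?P1 \<union> ?P2" "?P1 \<inter> ?P2 = {}" by auto
    have "(\<Sum>q\<in>?P1. \<bar>?g q\<bar>) \<le> (\<Sum>(x, K)\<in>?P1. (C + e) * measure lborel K)"
    proof (rule sum_mono, clarify)
      fix x K assume xK: "(x, K) \<in> p" "x \<notin> E"
      note k = KSup[OF xK(1)]
      have "K \<subseteq> ball x (r x)" using fine(2) xK(1) by (auto simp: fine_def)
      moreover have "Inf K \<in> K" "Sup K \<in> K" using k by (metis atLeastAtMost_iff order_refl order_trans)+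
      ultimately have "\<bar>Sup K - x\<bar> < r x" "\<bar>Inf K - x\<bar> < r x"
        by (auto simp: dist_real_def abs_minus_commute subset_iff)
      moreover have "x \<in> {a..b} - E" using xK k st by auto
      ultimately have "\<bar>f (Sup K) - f x\<bar> \<le> (C + e) * \<bar>Sup K - x\<bar>"
        "\<bar>f (Inf K) - f x\<bar> \<le> (C + e) * \<bar>Inf K - x\<bar>" using r(2) by blast+
      then show "\<bar>f (Sup K) - f (Inf K)\<bar> \<le> (C + e) * measure lborel K"
        using k(2,3) by (simp add: k(6) algebra_simps abs_if split: if_splits)
    qed
    also have "\<dots> \<le> (\<Sum>(x, K)\<in>p. (C + e) * measure lborel K)"
    proof (rule sum_mono2[OF fin])
      show "0 \<le> (case q of (x, K) \<Rightarrow> (C + e) * measure lborel K)" if "q \<in> p - ?P1" for q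
        using e C by (auto simp: case_prod_unfold)
    qed auto
    also have "\<dots> = (C + e) * (t - s)"
      using additive_content_tagged_division[of p s t] p(1) st
      by (simp add: case_prod_unfold sum_distrib_left[symmetric])
    finally have 1: "(\<Sum>q\<in>?P1. \<bar>?g q\<bar>) \<le> (C + e) * (t - s)" .
    \<comment> \<open>Absolute continuity speaks about a set of endpoint pairs, so the tags are
      dropped, and no two intervals may be merged thereby. Distinct tagged intervals with equal
      endpoints would be degenerate, which forces equal tags.\<close>
    define \<iota> where "\<iota> = (\<lambda>(x :: real, K :: real set). (Inf K, Sup K))"
    have disj: "{Inf K<..<Sup K} \<inter> {Inf K'<..<Sup K'} = {}"
      if "(x, K) \<in> p" "(x', K') \<in> p" "(x, K) \<noteq> (x', K')" for x K x' K'
      using tagged_division_ofD(5)[OF p(1) that] KSup(1)[OF that(1)] KSup(1)[OF that(2)]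
        interior_atLeastAtMost_real by metis
    have inj: "inj_on \<iota> ?P2"
    proof (rule inj_onI, clarify)
      fix x K x' K'
      assume A: "(x, K) \<in> p" "(x', K') \<in> p" and "\<iota> (x, K) = \<iota> (x', K')"
      then have eq: "Inf K = Inf K'" "Sup K = Sup K'" by (auto simp: \<iota>_def)
      have "K = K'" using KSup(1)[OF A(1)] KSup(1)[OF A(2)] eq by simp
      moreover have "x = x'"
      proof (rule ccontr)
        assume "x \<noteq> x'"
        then have "{Inf K<..<Sup K} = {}" using disj[OF A] eq by auto
        then have "Inf K = Sup K" using KSup(2,3)[OF A(1)] by auto
        then show False using KSup(2,3)[OF A(1)] KSup(2,3)[OF A(2)] eq \<open>x \<noteq> x'\<close> by simp
      qed
      ultimately show "x = x' \<and> K = K'" by simp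
    qed
    have "(\<Sum>(s, t)\<in>\<iota> ` ?P2. \<bar>f t - f s\<bar>) < e"
    proof (rule dI)
      show "finite (\<iota> ` ?P2)" using fin by (auto intro: finite_subset[of _ p])
      show "\<forall>(s, t)\<in>\<iota> ` ?P2. a \<le> s \<and> s \<le> t \<and> t \<le> b"
      proof (clarsimp simp: \<iota>_def)
        fix x K assume "(x, K) \<in> p"
        from KSup[OF this] st show "a \<le> Inf K \<and> Inf K \<le> Sup K \<and> Sup K \<le> b" by linarith
      qed
      show "pairwise (\<lambda>(s, t) (s', t'). {s<..<t} \<inter> {s'<..<t'} = {}) (\<iota> ` ?P2)"
      proof (rule pairwiseI)
        fix v v' assume "v \<in> \<iota> ` ?P2" "v' \<in> \<iota> ` ?P2" "v \<noteq> v'"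
        then obtain x K x' K' where A: "(x, K) \<in> p" "(x', K') \<in> p"
            "v = (Inf K, Sup K)" "v' = (Inf K', Sup K')" and ne: "(x, K) \<noteq> (x', K')"
          unfolding \<iota>_def by auto
        from disj[OF A(1,2) ne] show "(case v of (s, t) \<Rightarrow> \<lambda>(s', t'). {s<..<t} \<inter> {s'<..<t'} = {}) v'"
          unfolding A(3,4) by simp
      qed
      have "(\<Sum>(s, t)\<in>\<iota> ` ?P2. t - s) = (\<Sum>(x, K)\<in>?P2. measure lborel K)"
        unfolding sum.reindex[OF inj] by (intro sum.cong) (auto simp: \<iota>_def KSup(6))
      also have "\<dots> = (\<Sum>(x, k)\<in>p. measure lborel k *\<^sub>R indicat_real E x)"
        by (rule sum.mono_neutral_cong_left[OF fin]) (auto simp: indicator_def)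
      also have "\<dots> < d" using \<gamma>1(2)[OF _ fine(1)] p(1) by fastforce
      finally show "(\<Sum>(s, t)\<in>\<iota> ` ?P2. t - s) < d" .
    qed
    then have 2: "(\<Sum>q\<in>?P2. \<bar>?g q\<bar>) < e"
      unfolding sum.reindex[OF inj] by (simp add: \<iota>_def case_prod_unfold o_def)
    have "f t - f s = (\<Sum>q\<in>p. ?g q)"
      using additive_tagged_division_1[of s t p f] st p(1) by simp
    then have "\<bar>f t - f s\<bar> \<le> (\<Sum>q\<in>p. \<bar>?g q\<bar>)" by (simp only: sum_abs)
    also have "\<dots> = (\<Sum>q\<in>?P1. \<bar>?g q\<bar>) + (\<Sum>q\<in>?P2. \<bar>?g q\<bar>)"
      using sum.union_disjoint[of ?P1 ?P2 "\<lambda>q. \<bar>?g q\<bar>"] P12 fin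
      by (metis (no_types, lifting) finite_Un)
    finally show ?thesis using 1 2 by linarith
  qed
  show ?thesis
  proof (rule field_le_epsilon)
    fix e :: real assume "e > 0"
    define e' where "e' = e / (t - s + 1)"
    have "e' * (t - s + 1) = e" using st by (simp add: e'_def)
    then have e': "e' > 0" "e' * (t - s) + e' = e"
      using \<open>e > 0\<close> st by (auto simp: e'_def distrib_left)
    show "\<bar>f t - f s\<bar> \<le> C * (t - s) + e"
      using main[OF e'(1)] e'(2) by (simp add: algebra_simps)
  qed
qed

text \<open>One fixed null sequence with values in (0, 1] along which all time derivatives are
  taken. Sequential limits make dominated convergence available, and increments of at most 1 keep
  every shifted time within one unit.\<close>

definition step :: "nat \<Rightarrow> real" where
  "step n = inverse (real (Suc n))"

lemma step_pos: "step n > 0" and step_le_1: "step n \<le> 1"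
  by (simp_all add: step_def inverse_le_1_iff)

lemma step_tendsto_0: "step \<longlonglongrightarrow> 0"
  using LIMSEQ_inverse_real_of_nat by (simp add: step_def[abs_def])

lemma average_lipschitz:
  fixes f :: "real \<Rightarrow> real"
  assumes f: "L-lipschitz_on {s..s + h} f" and h: "h > 0"
  shows "\<bar>integral {s..s + h} f / h - f s\<bar> \<le> L * h"
proof -
  have "continuous_on {s..s + h} f" using f by (rule lipschitz_on_continuous_on)
  then have int: "f integrable_on {s..s + h}" by (rule integrable_continuous_interval)
  have "norm (integral {s..s + h} (\<lambda>y. f y - f s)) \<le> integral {s..s + h} (\<lambda>y. L * h)"
  proof (rule integral_norm_bound_integral)
    fix y assume y: "y \<in> {s..s + h}"
    have "\<bar>f y - f s\<bar> \<le> L * \<bar>y - s\<bar>"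
      using lipschitz_onD[OF f y, of s] h by (simp add: dist_real_def)
    also have "\<dots> \<le> L * h"
      using y lipschitz_on_nonneg[OF f] by (intro mult_left_mono) auto
    finally show "norm (f y - f s) \<le> L * h" by simp
  qed (use int in \<open>auto intro!: integrable_diff\<close>)
  also have "\<dots> = h * (L * h)" using h by simp
  finally have "\<bar>integral {s..s + h} f - h * f s\<bar> \<le> h * (L * h)"
    using integral_diff[OF int integrable_const_ivl, of "f s"] h by simp
  then have "\<bar>integral {s..s + h} f - h * f s\<bar> / h \<le> L * h"
    using h by (simp add: pos_divide_le_eq mult.commute)
  moreover have "\<bar>integral {s..s + h} f - h * f s\<bar> / h = \<bar>integral {s..s + h} f / h - f s\<bar>"
  proof -
    have "integral {s..s + h} f / h - f s = (integral {s..s + h} f - h * f s) / h"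
      using h by (simp add: diff_divide_distrib)
    then show ?thesis using h by (simp add: abs_divide)
  qed
  ultimately show ?thesis by simp
qed

text \<open>The integral telescopes to the difference of two averages over intervals of length h
  starting at b and at a, and each average is within L h of the value at the left end.\<close>

lemma integral_difference_quotient:
  fixes f :: "real \<Rightarrow> real"
  assumes f: "L-lipschitz_on {a..b + h} f" and ab: "a \<le> b" and h: "h > 0"
  shows "\<bar>integral {a..b} (\<lambda>t. (f (t + h) - f t) / h) - (f b - f a)\<bar> \<le> 2 * L * h"
proof -
  have cf: "continuous_on {a..b + h} f" using f by (rule lipschitz_on_continuous_on)
  have int: "f integrable_on {c..d}" if "a \<le> c" "d \<le> b + h" for c d
    using that by (intro integrable_continuous_interval continuous_on_subset[OF cf]) auto
  have "integral {a..b} (\<lambda>t. (f (t + h) - f t) / h) =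
        (integral {a..b} (\<lambda>t. f (t + h)) - integral {a..b} f) / h"
  proof -
    have "(\<lambda>t. f (t + h)) integrable_on {a..b}"
      using h by (intro integrable_continuous_interval continuous_on_compose2[OF cf] continuous_intros) auto
    then show ?thesis
      using integral_diff[of "\<lambda>t. f (t + h)" "{a..b}" f] int[of a b] h by simp
  qed
  also have "integral {a..b} (\<lambda>t. f (t + h)) = integral {a + h..b + h} f"
    using integral_shift_Icc_real[of a b f h] by (simp add: o_def add.commute)
  also have "integral {a + h..b + h} f - integral {a..b} f =
             integral {b..b + h} f - integral {a..a + h} f"
    using Henstock_Kurzweil_Integration.integral_combine[of a "a + h" "b + h" f]
      Henstock_Kurzweil_Integration.integral_combine[of a b "b + h" f] int[of a "b + h"] h ab by simp
  finally have "integral {a..b} (\<lambda>t. (f (t + h) - f t) / h) =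
      integral {b..b + h} f / h - integral {a..a + h} f / h"
    by (simp add: diff_divide_distrib)
  moreover have "\<bar>integral {b..b + h} f / h - f b\<bar> \<le> L * h" "\<bar>integral {a..a + h} f / h - f a\<bar> \<le> L * h"
    using h ab by (auto intro!: average_lipschitz lipschitz_on_subset[OF f])
  ultimately show ?thesis by linarith
qed

text \<open>The integral of the difference quotients tends to f b - f a. Their positive parts are at
  most L and tend to 0 outside \<open>E\<close>, so by dominated convergence the limit cannot be
  positive. The interval reaches to b + 1 because the quotients look forward by up to 1.\<close>

lemma lipschitz_nonincreasing:
  fixes f :: "real \<Rightarrow> real"
  assumes f: "L-lipschitz_on {a..b + 1} f" and ab: "a \<le> b" and E: "negligible E"
    and dini: "\<And>t e. t \<in> {a..b} - E \<Longrightarrow> e > 0 \<Longrightarrow>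
      eventually (\<lambda>n. (f (t + step n) - f t) / step n \<le> e) sequentially"
  shows "f b \<le> f a"
proof -
  have L: "L \<ge> 0" using f by (rule lipschitz_on_nonneg)
  have cf: "continuous_on {a..b + 1} f" using f by (rule lipschitz_on_continuous_on)
  define q where "q = (\<lambda>n t. (f (t + step n) - f t) / step n)"
  have cq: "continuous_on {a..b} (q n)" for n
    unfolding q_def using step_pos[of n] step_le_1[of n]
    by (intro continuous_intros continuous_on_compose2[OF cf]) auto
  have q_le: "q n t \<le> L" if "t \<in> {a..b}" for n t
  proof -
    have "\<bar>f (t + step n) - f t\<bar> \<le> L * step n"
      using lipschitz_onD[OF f, of "t + step n" t] that step_pos[of n] step_le_1[of n]
      by (simp add: dist_real_def)
    then show ?thesis using step_pos[of n] by (simp add: q_def pos_divide_le_eq)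
  qed
  \<comment> \<open>Nothing is known about the quotients on \<open>E\<close>, so they are replaced
    by 0 there. This leaves the integrals unchanged and gives convergence at every point.\<close>
  define g where "g = (\<lambda>n t. if t \<in> E then 0 else max 0 (q n t))"
  have int_max: "(\<lambda>t. max 0 (q n t)) integrable_on {a..b}" for n
    by (intro integrable_continuous_interval continuous_intros cq)
  have "(\<lambda>n. integral {a..b} (g n)) \<longlonglongrightarrow> integral {a..b} (\<lambda>_. 0)"
  proof (rule dominated_convergence(2))
    show "g n integrable_on {a..b}" for n
      by (rule integrable_spike[OF int_max E]) (auto simp: g_def)
    show "(\<lambda>_. L) integrable_on {a..b}" by (rule integrable_const_ivl)
    show "norm (g n t) \<le> L" if "t \<in> {a..b}" for n t
      using q_le[OF that, of n] L by (auto simp: g_def)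
    show "(\<lambda>n. g n t) \<longlonglongrightarrow> 0" if "t \<in> {a..b}" for t
    proof (cases "t \<in> E")
      case False
      show ?thesis
      proof (rule LIMSEQ_I)
        fix r :: real assume "r > 0"
        then have "eventually (\<lambda>n. q n t \<le> r / 2) sequentially"
          unfolding q_def using dini[of t "r/2"] that False by auto
        then obtain N where N: "\<And>n. n \<ge> N \<Longrightarrow> q n t \<le> r / 2"
          unfolding eventually_sequentially by blast
        have "norm (g n t - 0) < r" if "n \<ge> N" for n
          using N[OF that] \<open>r > 0\<close> False by (auto simp: g_def)
        then show "\<exists>N. \<forall>n\<ge>N. norm (g n t - 0) < r" by blast
      qed
    qed (simp add: g_def)
  qed
  then have lim0: "(\<lambda>n. integral {a..b} (g n) + 2 * L * step n) \<longlonglongrightarrow> 0 + 2 * L * 0"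
    by (intro tendsto_intros step_tendsto_0) simp
  have "f b - f a \<le> integral {a..b} (g n) + 2 * L * step n" for n
  proof -
    define h where "h = step n"
    have h: "h > 0" "h \<le> 1" using step_pos[of n] step_le_1[of n] by (auto simp: h_def)
    have "\<bar>integral {a..b} (q n) - (f b - f a)\<bar> \<le> 2 * L * h"
      unfolding q_def h_def[symmetric]
      using h ab by (intro integral_difference_quotient lipschitz_on_subset[OF f]) auto
    moreover have "integral {a..b} (q n) \<le> integral {a..b} (\<lambda>t. max 0 (q n t))"
      by (intro integral_le int_max integrable_continuous_interval cq) auto
    moreover have "integral {a..b} (\<lambda>t. max 0 (q n t)) = integral {a..b} (g n)"
      by (rule integral_spike[OF E]) (auto simp: g_def)
    ultimately show ?thesis unfolding h_def by linarith
  qed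
  then have "f b - f a \<le> 0"
    using tendsto_lowerbound[OF lim0, of "f b - f a"] by simp
  then show ?thesis by simp
qed

section \<open>The plant along its characteristics\<close>

lemma AE_lborel_negligible:
  assumes "AE x in lborel. P x"
  shows "\<exists>N. negligible N \<and> (\<forall>x. x \<notin> N \<longrightarrow> P x)"
proof -
  have "AE x in lebesgue. P x" using assms by (rule AE_completion)
  then show ?thesis unfolding eventually_ae_filter_negligible by blast
qed

lemma DERIV_sequence:
  assumes "(f has_real_derivative D) (at x)" "h \<longlonglongrightarrow> 0" "\<And>n. h n \<noteq> (0 :: real)"
  shows "(\<lambda>n. (f (x + h n) - f x) / h n) \<longlonglongrightarrow> D"
proof -
  have "((\<lambda>h. (f (x + h) - f x) / h) \<longlongrightarrow> D) (at 0)"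
    using assms(1) by (simp add: DERIV_def)
  then show ?thesis
    using assms(2,3) by (auto simp: tendsto_at_iff_sequentially o_def)
qed

lemma continuous_on_uncurry:
  assumes u: "continuous_on (A \<times> B) (\<lambda>(x, t). u x t)"
    and fg: "continuous_on S f" "continuous_on S g" "\<And>z. z \<in> S \<Longrightarrow> f z \<in> A \<and> g z \<in> B"
  shows "continuous_on S (\<lambda>z. u (f z) (g z))"
proof -
  have "continuous_on S (\<lambda>z. (\<lambda>(x, t). u x t) (f z, g z))"
    by (rule continuous_on_compose2[OF u continuous_on_Pair[OF fg(1,2)]]) (use fg(3) in auto)
  then show ?thesis by simp
qed

text \<open>In the coordinates p = x + t and s = t the plant equation says that the derivative in s
  at constant p is \<beta>(p - s) u(0, s). As it holds only almost everywhere in the plane, it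
  cannot be integrated along one given line p = const; it is integrated over a rectangle in (p, s)
  instead. The condition on \<open>p2\<close> keeps x = p - s away from 1.\<close>

lemma plant_integrated_along_characteristics:
  assumes sol: "plant_solution \<beta> U u" and \<beta>: "continuous_on {0..1} \<beta>"
    and s: "0 \<le> s1" "s1 \<le> s2" and p: "s2 \<le> p1" "p1 \<le> p2" "p2 < 1 + s1"
  shows "integral {p1..p2} (\<lambda>p. u (p - s2) s2 - u (p - s1) s1 -
           integral {s1..s2} (\<lambda>s. \<beta> (p - s) * u 0 s)) = 0"
proof -
  \<comment> \<open>A margin for the shifts: x + h stays at most p2 - s1 + \<eta> < 1, inside the
    region where \<open>u\<close> is Lipschitz.\<close>
  define \<eta> where "\<eta> = min 1 ((1 + s1 - p2) / 2)"
  have \<eta>: "0 < \<eta>" "\<eta> \<le> 1" "p2 - s1 + \<eta> < 1"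
  proof -
    have "\<eta> \<le> (1 + s1 - p2) / 2" unfolding \<eta>_def by (rule min.cobounded2)
    then have "2 * \<eta> \<le> 1 + s1 - p2" by simp
    then show "p2 - s1 + \<eta> < 1" using p(3) by linarith
  qed (use p in \<open>auto simp: \<eta>_def\<close>)
  define h where "h = (\<lambda>n. \<eta> * step n)"
  have h: "0 < h n" "h n \<le> \<eta>" "h n \<le> 1" for n
    using \<eta>(1,2) step_pos[of n] step_le_1[of n]
    by (auto simp: h_def mult_left_le mult_le_one)
  have h0: "h \<longlonglongrightarrow> 0" unfolding h_def
    using tendsto_mult_left[OF step_tendsto_0, of \<eta>] by simp
  have cu: "continuous_on ({0..1} \<times> {0..}) (\<lambda>(x, t). u x t)"
    using sol by (simp add: plant_solution_def)
  have cu': "continuous_on S (\<lambda>z. u (f z) (g z))"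
    if "continuous_on S f" "continuous_on S g" "\<And>z. z \<in> S \<Longrightarrow> 0 \<le> f z \<and> f z \<le> 1 \<and> 0 \<le> g z"
    for S :: "'z::topological_space set" and f g
    by (rule continuous_on_uncurry[OF cu that(1,2)]) (use that(3) in auto)
  have c\<beta>': "continuous_on S (\<lambda>z. \<beta> (f z))"
    if "continuous_on S f" "\<And>z. z \<in> S \<Longrightarrow> 0 \<le> f z \<and> f z \<le> 1"
    for S :: "'z::topological_space set" and f
    by (rule continuous_on_compose2[OF \<beta> that(1)]) (use that(2) in auto)
  obtain L where L: "L-lipschitz_on ({0..p2 - s1 + \<eta>} \<times> {0..s2 + \<eta>}) (\<lambda>(x, t). u x t)"
    using sol \<eta>(3) unfolding plant_solution_def by blast
  have L0: "L \<ge> 0" using L by (rule lipschitz_on_nonneg)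
  have Lu: "\<bar>u x t - u x' t'\<bar> \<le> L * (\<bar>x - x'\<bar> + \<bar>t - t'\<bar>)"
    if "0 \<le> x" "x \<le> p2 - s1 + \<eta>" "0 \<le> x'" "x' \<le> p2 - s1 + \<eta>"
      "0 \<le> t" "t \<le> s2 + \<eta>" "0 \<le> t'" "t' \<le> s2 + \<eta>" for x x' t t'
  proof -
    have "\<bar>u x t - u x' t'\<bar> \<le> L * dist (x, t) (x', t')"
      using lipschitz_onD[OF L, of "(x, t)" "(x', t')"] that by (simp add: dist_real_def)
    also have "dist (x, t) (x', t') \<le> \<bar>x - x'\<bar> + \<bar>t - t'\<bar>"
      using sqrt_sum_squares_le_sum_abs[of "x - x'" "t - t'"]
      by (simp add: dist_Pair_Pair dist_real_def)
    finally show ?thesis using L0 by (simp add: mult_left_mono)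
  qed
  have "AE (x, t) in lborel. x \<in> {0..<1} \<and> t \<ge> 0 \<longrightarrow>
        (\<exists>u_t u_x. ((\<lambda>s. u x s) has_real_derivative u_t) (at t) \<and>
                   ((\<lambda>y. u y t) has_real_derivative u_x) (at x) \<and>
                   u_t = u_x + \<beta> x * u 0 t)"
    using sol by (simp add: plant_solution_def)
  from AE_lborel_negligible[OF this] obtain N where N: "negligible N" and
    pde: "\<And>x t. (x, t) \<notin> N \<Longrightarrow> x \<in> {0..<1} \<Longrightarrow> t \<ge> 0 \<Longrightarrow>
        (\<exists>u_t u_x. ((\<lambda>s. u x s) has_real_derivative u_t) (at t) \<and>
                   ((\<lambda>y. u y t) has_real_derivative u_x) (at x) \<and>
                   u_t = u_x + \<beta> x * u 0 t)"
    by fastforce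
  \<comment> \<open>The exceptional set in the coordinates (p, s): a linear image of a null set,
    hence null.\<close>
  define E where "E = (\<lambda>z. (fst z + snd z, snd z)) ` N"
  have E: "negligible E" unfolding E_def
  proof (rule negligible_differentiable_image_negligible[OF _ N])
    have "bounded_linear (\<lambda>z :: real \<times> real. (fst z + snd z, snd z))"
      by (intro bounded_linear_Pair bounded_linear_add bounded_linear_fst bounded_linear_snd)
    then show "(\<lambda>z. (fst z + snd z, snd z)) differentiable_on N"
      by (rule bounded_linear_imp_differentiable_on)
  qed simp
  let ?R = "cbox (p1, s1) (p2, s2)"
  \<comment> \<open>The two values of \<open>u\<close> lie on one characteristic, at (x + h, t) and
    (x, t + h). The derivatives in both variables at (x, t) make the quotient converge to u_t - u_x,
    hence \<open>Q\<close> to 0, almost everywhere; Lipschitz continuity dominates it.\<close>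
  define Q where "Q = (\<lambda>n z. (u (fst z - snd z) (snd z + h n) - u (fst z - snd z + h n) (snd z)) / h n
      - \<beta> (fst z - snd z) * u 0 (snd z))"
  have cQ: "continuous_on ?R (Q n)" for n
    unfolding Q_def using s p \<eta> h[of n]
    by (intro continuous_intros cu' c\<beta>') auto
  have "continuous_on ?R (\<lambda>z. \<beta> (fst z - snd z) * u 0 (snd z))"
    using s p by (intro continuous_intros cu' c\<beta>') auto
  then have "bounded ((\<lambda>z. \<beta> (fst z - snd z) * u 0 (snd z)) ` ?R)"
    by (intro compact_imp_bounded compact_continuous_image compact_cbox)
  then obtain A where A: "\<And>z. z \<in> ?R \<Longrightarrow> \<bar>\<beta> (fst z - snd z) * u 0 (snd z)\<bar> \<le> A"
    unfolding bounded_iff by auto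
  have Q_le: "norm (Q n z) \<le> 2 * L + A" if zR: "z \<in> ?R" for n z
  proof -
    obtain q s where z: "z = (q, s)" "p1 \<le> q" "q \<le> p2" "s1 \<le> s" "s \<le> s2"
      using zR by (cases z) (auto simp: cbox_Pair_eq)
    have "\<bar>u (q - s) (s + h n) - u (q - s + h n) s\<bar> \<le> L * (\<bar>q - s - (q - s + h n)\<bar> + \<bar>s + h n - s\<bar>)"
      using z s p h[of n] by (intro Lu) auto
    then have "\<bar>u (q - s) (s + h n) - u (q - s + h n) s\<bar> / h n \<le> 2 * L"
      using h(1)[of n] by (simp add: pos_divide_le_eq)
    then have "\<bar>(u (q - s) (s + h n) - u (q - s + h n) s) / h n\<bar> \<le> 2 * L"
      using h(1)[of n] by (simp add: abs_divide)
    moreover have "\<bar>\<beta> (q - s) * u 0 s\<bar> \<le> A" using A[OF zR] by (simp add: z(1))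
    ultimately show ?thesis unfolding z(1) Q_def fst_conv snd_conv real_norm_def by linarith
  qed
  have Q_lim: "(\<lambda>n. Q n z) \<longlonglongrightarrow> 0" if z: "z \<in> ?R" "z \<notin> E" for z
  proof -
    obtain q s where z': "z = (q, s)" "p1 \<le> q" "q \<le> p2" "s1 \<le> s" "s \<le> s2"
      using z(1) by (cases z) (auto simp: cbox_Pair_eq)
    have "(q - s, s) \<notin> N" using z(2) by (force simp: E_def z'(1) image_iff)
    from pde[OF this] obtain u_t u_x where d: "((\<lambda>r. u (q - s) r) has_real_derivative u_t) (at s)"
       "((\<lambda>y. u y s) has_real_derivative u_x) (at (q - s))" "u_t = u_x + \<beta> (q - s) * u 0 s"
      using z' s p by auto
    have h_ne: "h n \<noteq> 0" for n using h(1)[of n] by simp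
    have "(\<lambda>n. (u (q - s) (s + h n) - u (q - s) s) / h n -
         (u (q - s + h n) s - u (q - s) s) / h n - \<beta> (q - s) * u 0 s) \<longlonglongrightarrow>
         u_t - u_x - \<beta> (q - s) * u 0 s"
      by (intro tendsto_diff tendsto_const DERIV_sequence d h0 h_ne)
    then show ?thesis using d(3) by (simp add: Q_def z'(1) diff_divide_distrib)
  qed
  have "(\<lambda>n. integral ?R (\<lambda>z. if z \<in> E then 0 else Q n z)) \<longlonglongrightarrow> integral ?R (\<lambda>_. 0)"
  proof (rule dominated_convergence(2))
    show "(\<lambda>z. if z \<in> E then 0 else Q n z) integrable_on ?R" for n
      by (rule integrable_spike[OF integrable_continuous[OF cQ] E]) auto
    show "(\<lambda>_. 2 * L + \<bar>A\<bar>) integrable_on ?R" by (rule integrable_const)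
    show "norm (if z \<in> E then 0 else Q n z) \<le> 2 * L + \<bar>A\<bar>" if "z \<in> ?R" for n z
      using Q_le[OF that, of n] L0 by auto
    show "(\<lambda>n. if z \<in> E then 0 else Q n z) \<longlonglongrightarrow> 0" if "z \<in> ?R" for z
      using Q_lim[OF that] by (cases "z \<in> E") auto
  qed
  moreover have "integral ?R (\<lambda>z. if z \<in> E then 0 else Q n z) = integral ?R (Q n)" for n
    by (rule integral_spike[OF E]) auto
  ultimately have lim: "(\<lambda>n. integral ?R (Q n)) \<longlonglongrightarrow> 0" by simp
  define D where "D = (\<lambda>p. u (p - s2) s2 - u (p - s1) s1 - integral {s1..s2} (\<lambda>s. \<beta> (p - s) * u 0 s))"
  have c\<beta>a: "continuous_on {s1..s2} (\<lambda>s. \<beta> (q - s) * u 0 s)" if "q \<in> {p1..p2}" for q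
    using that s p by (intro continuous_intros cu' c\<beta>') auto
  have cD: "continuous_on {p1..p2} D"
  proof -
    have "continuous_on ({p1..p2} \<times> cbox s1 s2) (\<lambda>z. \<beta> (fst z - snd z) * u 0 (snd z))"
      using s p by (intro continuous_intros cu' c\<beta>') auto
    then have "continuous_on {p1..p2} (\<lambda>p. integral (cbox s1 s2) (\<lambda>s. \<beta> (p - s) * u 0 s))"
      by (intro integral_continuous_on_param) (simp add: case_prod_unfold)
    then show ?thesis
      unfolding D_def using s p by (intro continuous_intros cu') auto
  qed
  have "\<bar>integral ?R (Q n) - integral {p1..p2} D\<bar> \<le> 6 * L * (p2 - p1) * h n" for n
  proof -
    define I where "I = (\<lambda>q. integral {s1..s2} (\<lambda>s. Q n (q, s)))"
    have int: "integral ?R (Q n) = integral {p1..p2} I"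
      using integral_prod_continuous[OF cQ] by (simp add: I_def)
    have cI: "continuous_on {p1..p2} I"
      unfolding I_def box_real(2)[symmetric]
      using continuous_on_compose2[OF cQ[of n], of "cbox p1 p2 \<times> cbox s1 s2" "\<lambda>z. z"]
      by (intro integral_continuous_on_param) (auto simp: cbox_Pair_eq case_prod_unfold)
    have "\<bar>I q - D q\<bar> \<le> 6 * L * h n" if q: "q \<in> {p1..p2}" for q
    proof -
      \<comment> \<open>\<open>Q\<close> at (q, s) compares points of the characteristic p = q + h,
        which \<open>f\<close> follows. Passing from it to p = q costs L h at each of
        \<open>s1\<close> and \<open>s2\<close>; together with 4 L h for the averaged difference
        quotient this makes 6 L h.\<close>
      define f where "f = (\<lambda>s. u (q + h n - s) s)"
      have f: "(2 * L)-lipschitz_on {s1..s2 + h n} f"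
      proof (rule lipschitz_onI)
        fix x y assume "x \<in> {s1..s2 + h n}" "y \<in> {s1..s2 + h n}"
        then have "\<bar>f x - f y\<bar> \<le> L * (\<bar>q + h n - x - (q + h n - y)\<bar> + \<bar>x - y\<bar>)"
          unfolding f_def using q s p h[of n] by (intro Lu) auto
        also have "\<bar>q + h n - x - (q + h n - y)\<bar> + \<bar>x - y\<bar> = 2 * \<bar>x - y\<bar>" by simp
        finally show "dist (f x) (f y) \<le> 2 * L * dist x y" by (simp add: dist_real_def)
      qed (use L0 in simp)
      have cf: "continuous_on {s1..s2 + h n} f" using f by (rule lipschitz_on_continuous_on)
      have *: "(\<lambda>s. (f (s + h n) - f s) / h n) integrable_on {s1..s2}"
        using h(1)[of n]
        by (intro integrable_continuous_interval continuous_intros continuous_on_compose2[OF cf]) auto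
      have "I q = integral {s1..s2} (\<lambda>s. (f (s + h n) - f s) / h n - \<beta> (q - s) * u 0 s)"
        by (simp add: I_def Q_def f_def algebra_simps)
      also have "\<dots> = integral {s1..s2} (\<lambda>s. (f (s + h n) - f s) / h n) -
          integral {s1..s2} (\<lambda>s. \<beta> (q - s) * u 0 s)"
        by (rule integral_diff[OF * integrable_continuous_interval[OF c\<beta>a[OF q]]])
      finally have "I q - D q = (integral {s1..s2} (\<lambda>s. (f (s + h n) - f s) / h n) - (f s2 - f s1))
         + (u (q + h n - s2) s2 - u (q - s2) s2) - (u (q + h n - s1) s1 - u (q - s1) s1)"
        by (simp add: D_def f_def)
      moreover have "\<bar>integral {s1..s2} (\<lambda>s. (f (s + h n) - f s) / h n) - (f s2 - f s1)\<bar> \<le> 2 * (2 * L) * h n"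
        by (rule integral_difference_quotient[OF f s(2) h(1)])
      moreover have "\<bar>u (q + h n - s2) s2 - u (q - s2) s2\<bar> \<le> L * (\<bar>q + h n - s2 - (q - s2)\<bar> + \<bar>s2 - s2\<bar>)"
        using q s p h[of n] by (intro Lu) auto
      moreover have "\<bar>u (q + h n - s1) s1 - u (q - s1) s1\<bar> \<le> L * (\<bar>q + h n - s1 - (q - s1)\<bar> + \<bar>s1 - s1\<bar>)"
        using q s p h[of n] \<eta> by (intro Lu) auto
      ultimately show ?thesis using h(1)[of n] by simp
    qed
    then have "norm (integral {p1..p2} (\<lambda>q. I q - D q)) \<le> integral {p1..p2} (\<lambda>_. 6 * L * h n)"
      by (intro integral_norm_bound_integral integrable_continuous_interval continuous_intros cI cD) auto
    then show ?thesis
      using integral_diff[OF integrable_continuous_interval[OF cI] integrable_continuous_interval[OF cD]] p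
      by (simp add: int algebra_simps)
  qed
  then have "norm (integral ?R (Q n) - integral {p1..p2} D) \<le> 6 * L * (p2 - p1) * h n" for n by simp
  moreover have "(\<lambda>n. 6 * L * (p2 - p1) * h n) \<longlonglongrightarrow> 0"
    using tendsto_mult_left[OF h0, of "6 * L * (p2 - p1)"] by simp
  ultimately have "(\<lambda>n. integral ?R (Q n) - integral {p1..p2} D) \<longlonglongrightarrow> 0"
    by (rule Lim_null_comparison[OF always_eventually[OF allI]])
  then have "(\<lambda>n. integral ?R (Q n)) \<longlonglongrightarrow> integral {p1..p2} D" by (simp add: LIM_zero_iff)
  with lim have "integral {p1..p2} D = 0" by (rule LIMSEQ_unique[symmetric])
  then show ?thesis by (simp add: D_def)
qed

text \<open>The defect \<open>D\<close> of the identity is continuous in p and its integrals over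
  the intervals from t + h vanish, so differentiating the integral in its upper limit gives D = 0 at
  every p. The almost everywhere equation has become an identity at every point.\<close>

lemma plant_characteristics:
  assumes sol: "plant_solution \<beta> U u" and \<beta>: "continuous_on {0..1} \<beta>"
    and t: "0 \<le> t" and h: "0 \<le> h" and x: "0 \<le> x" "x + h \<le> 1"
  shows "u x (t + h) = u (x + h) t + conv (\<lambda>y. \<beta> (x + y)) (\<lambda>r. u 0 (t + r)) h"
proof -
  have cu: "continuous_on ({0..1} \<times> {0..}) (\<lambda>(x, t). u x t)"
    using sol by (simp add: plant_solution_def)
  have cu': "continuous_on S (\<lambda>z. u (f z) (g z))"
    if "continuous_on S f" "continuous_on S g" "\<And>z. z \<in> S \<Longrightarrow> 0 \<le> f z \<and> f z \<le> 1 \<and> 0 \<le> g z"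
    for S :: "'z::topological_space set" and f g
    by (rule continuous_on_uncurry[OF cu that(1,2)]) (use that(3) in auto)
  have c\<beta>': "continuous_on S (\<lambda>z. \<beta> (f z))"
    if "continuous_on S f" "\<And>z. z \<in> S \<Longrightarrow> 0 \<le> f z \<and> f z \<le> 1"
    for S :: "'z::topological_space set" and f
    by (rule continuous_on_compose2[OF \<beta> that(1)]) (use that(2) in auto)
  define G where "G = (\<lambda>h. u x (t + h) - u (x + h) t - conv (\<lambda>y. \<beta> (x + y)) (\<lambda>r. u 0 (t + r)) h)"
  have cG: "continuous_on {0..1 - x} G"
    unfolding G_def using t x h by (intro continuous_intros cu' c\<beta>') auto
  have G0: "G h = 0" if h: "0 \<le> h" "x + h < 1" for h
  proof -
    define D where "D = (\<lambda>p. u (p - (t + h)) (t + h) - u (p - t) t - integral {t..t + h} (\<lambda>s. \<beta> (p - s) * u 0 s))"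
    \<comment> \<open>The midpoint of x + t + h and 1 + t: the interval up to \<open>q\<close>
      contains the point of interest and still satisfies the strict bound p < 1 + t.\<close>
    define q where "q = (x + t + h + 1 + t) / 2"
    have q: "x + t + h < q" "q < 1 + t" using h by (auto simp: q_def)
    have cD: "continuous_on {t + h..q} D"
    proof -
      have "continuous_on ({t + h..q} \<times> cbox t (t + h)) (\<lambda>z. \<beta> (fst z - snd z) * u 0 (snd z))"
        using t h q by (intro continuous_intros cu' c\<beta>') auto
      then have "continuous_on {t + h..q} (\<lambda>p. integral (cbox t (t + h)) (\<lambda>s. \<beta> (p - s) * u 0 s))"
        by (intro integral_continuous_on_param) (simp add: case_prod_unfold)
      then show ?thesis
        unfolding D_def using t h q by (intro continuous_intros cu') auto
    qed
    have p: "x + t + h \<in> {t + h..q}" using x q by auto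
    have "((\<lambda>p. integral {t + h..p} D) has_vector_derivative D (x + t + h)) (at (x + t + h) within {t + h..q})"
      by (rule integral_has_vector_derivative[OF cD p])
    moreover have "integral {t + h..p} D = 0" if "p \<in> {t + h..q}" for p
      unfolding D_def using that t h q
      by (intro plant_integrated_along_characteristics[OF sol \<beta>]) auto
    ultimately have "((\<lambda>p. 0) has_vector_derivative D (x + t + h)) (at (x + t + h) within {t + h..q})"
      using has_vector_derivative_transform[OF p] by metis
    then have "D (x + t + h) = 0"
      using vector_derivative_unique_within_closed_interval[of "t + h" q "x + t + h" "\<lambda>_. 0" "D (x + t + h)" 0]
        p x q by simp
    moreover have "integral {t..t + h} (\<lambda>s. \<beta> (x + t + h - s) * u 0 s) =
        conv (\<lambda>y. \<beta> (x + y)) (\<lambda>r. u 0 (t + r)) h"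
      using integral_shift_Icc_real[of 0 h "\<lambda>s. \<beta> (x + t + h - s) * u 0 s" t]
      by (simp add: conv_def o_def algebra_simps)
    ultimately show ?thesis by (simp add: D_def G_def)
  qed
  have "G h = 0"
  proof (cases "x = 1")
    case True
    then show ?thesis using G0[of 0] h x by (simp add: G_def conv_def)
  next
    case False
    \<comment> \<open>The case x + h = 1 lies outside the range of the integrated identity; it is
      reached by continuity of \<open>G\<close>.\<close>
    then have "closure {0..<1 - x} = {0..1 - x}"
      using x h by (intro closure_atLeastLessThan) auto
    then show ?thesis
      using continuous_constant_on_closure[of "{0..<1 - x}" G 0 h] cG G0 x h by auto
  qed
  then show ?thesis by (simp add: G_def)
qed

section \<open>Continuity of neural operators\<close>

lemma continuous_on_sum_list:
  fixes f :: "'i \<Rightarrow> 'a::topological_space \<Rightarrow> real"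
  shows "(\<And>i. i \<in> set is \<Longrightarrow> continuous_on S (f i)) \<Longrightarrow> continuous_on S (\<lambda>y. \<Sum>i\<leftarrow>is. f i y)"
  by (induction "is") (auto intro!: continuous_intros)

text \<open>Outputs are represented as a list of scalar functions evaluated at \<open>y\<close>, so
  that continuity of a list-valued map means continuity of every entry; this form is what the
  induction over the layers carries.\<close>

lemma affine_layer_continuous:
  fixes fs :: "('a::topological_space \<Rightarrow> real) list"
  assumes "\<And>f. f \<in> set fs \<Longrightarrow> continuous_on S f"
  shows "\<exists>gs. (\<forall>g\<in>set gs. continuous_on S g) \<and>
           (\<forall>y. affine_layer l (map (\<lambda>f. f y) fs) = map (\<lambda>g. g y) gs)"
proof (intro exI conjI allI ballI)
  let ?gs = "map2 (\<lambda>r b y. (\<Sum>p\<leftarrow>zip r fs. fst p * snd p y) + b) (fst l) (snd l)"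
  show "continuous_on S g" if "g \<in> set ?gs" for g
  proof -
    from that obtain r b where "g = (\<lambda>y. (\<Sum>p\<leftarrow>zip r fs. fst p * snd p y) + b)" by auto
    then show ?thesis
      using assms by (auto intro!: continuous_intros continuous_on_sum_list dest: set_zip_rightD)
  qed
  show "affine_layer l (map (\<lambda>f. f y) fs) = map (\<lambda>g. g y) ?gs" for y
    by (simp add: affine_layer_def zip_map2 o_def case_prod_unfold)
qed

lemma forward_continuous:
  fixes fs :: "('a::topological_space \<Rightarrow> real) list"
  assumes \<sigma>: "continuous_on UNIV \<sigma>" and "\<And>f. f \<in> set fs \<Longrightarrow> continuous_on S f"
  shows "\<exists>gs. (\<forall>g\<in>set gs. continuous_on S g) \<and>
           (\<forall>y. forward \<sigma> \<theta> (map (\<lambda>f. f y) fs) = map (\<lambda>g. g y) gs)"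
  using assms(2)
proof (induction \<theta> arbitrary: fs)
  case Nil
  then show ?case by (intro exI[of _ fs]) auto
next
  case (Cons l ls)
  obtain gs where gs: "\<And>g. g \<in> set gs \<Longrightarrow> continuous_on S g"
      "\<And>y. affine_layer l (map (\<lambda>f. f y) fs) = map (\<lambda>g. g y) gs"
    using affine_layer_continuous[OF Cons.prems, where l = l] by blast
  show ?case
  proof (cases ls)
    case Nil
    then show ?thesis using gs by (intro exI[of _ gs]) auto
  next
    case (Cons l' ls')
    let ?hs = "map (\<lambda>g y. \<sigma> (g y)) gs"
    have "continuous_on S f" if "f \<in> set ?hs" for f
      using that gs(1) by (auto intro!: continuous_on_compose2[OF \<sigma>])
    from Cons.IH[OF this] obtain ks where "\<forall>g\<in>set ks. continuous_on S g"
      "\<forall>y. forward \<sigma> ls (map (\<lambda>f. f y) ?hs) = map (\<lambda>g. g y) ks" by blast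
    then show ?thesis using gs(2) Cons by (intro exI[of _ ks]) (auto simp: o_def)
  qed
qed

lemma nn_continuous:
  assumes "continuous_on UNIV \<sigma>"
  shows "continuous_on S (\<lambda>y. nn \<sigma> \<theta> [y])"
proof -
  obtain gs where gs: "\<forall>g\<in>set gs. continuous_on S g"
      "\<forall>y. forward \<sigma> \<theta> (map (\<lambda>f. f y) [\<lambda>y. y]) = map (\<lambda>g. g y) gs"
    using forward_continuous[OF assms, where fs = "[\<lambda>y::real. y]" and S = S and \<theta> = \<theta>] by auto
  then show ?thesis by (cases gs) (auto simp: nn_def)
qed

text \<open>For fixed input functions the factors depending on the samples are constants, and
  continuity in y comes from the networks evaluated at y. Thus the approximate kernel at each time
  is continuous in space and may be used in convolutions.\<close>

lemma deeponet_continuous: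
  assumes "is_deeponet d F" "length us = d"
  shows "continuous_on {0..1} (F us)"
proof -
  from assms obtain \<sigma>g \<sigma>f xs ps where \<sigma>f: "continuous_on UNIV \<sigma>f"
    and F: "\<And>y. y \<in> {0..1} \<Longrightarrow> F us y = (\<Sum>(v, \<theta>)\<leftarrow>ps. nn \<sigma>g v (samples xs us) * nn \<sigma>f \<theta> [y])"
    unfolding is_deeponet_def by blast
  have "continuous_on {0..1} (\<lambda>y. \<Sum>p\<leftarrow>ps. nn \<sigma>g (fst p) (samples xs us) * nn \<sigma>f (snd p) [y])"
    by (intro continuous_on_sum_list continuous_intros nn_continuous[OF \<sigma>f])
  then show ?thesis
    by (rule continuous_on_eq) (simp add: F case_prod_unfold)
qed

section \<open>Integral estimates\<close>

lemma abs_integral_le: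
  fixes f g :: "real \<Rightarrow> real"
  assumes "continuous_on {a..b} f" "continuous_on {a..b} g" "\<And>x. x \<in> {a..b} \<Longrightarrow> \<bar>f x\<bar> \<le> g x"
  shows "\<bar>integral {a..b} f\<bar> \<le> integral {a..b} g"
  using integral_norm_bound_integral[of f "{a..b}" g] assms
  by (simp add: integrable_continuous_interval)

lemma integral_mono_interval:
  fixes f g :: "real \<Rightarrow> real"
  assumes "continuous_on {a..b} f" "continuous_on {a..b} g" "\<And>x. x \<in> {a..b} \<Longrightarrow> f x \<le> g x"
  shows "integral {a..b} f \<le> integral {a..b} g"
  using assms by (intro integral_le integrable_continuous_interval) auto

lemma integral_initial_le:
  fixes f :: "real \<Rightarrow> real"
  assumes f: "continuous_on {0..1} f" "\<And>x. x \<in> {0..1} \<Longrightarrow> 0 \<le> f x" and x: "x \<in> {0..1}"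
  shows "integral {0..x} f \<le> integral {0..1} f"
  using x f(2) by (intro integral_subset_le integrable_continuous_interval continuous_on_subset[OF f(1)]) auto

text \<open>Cauchy-Schwarz against the constant 1, obtained by expanding the nonnegative integral of
  (\<bar>f\<bar> - Z)^2, where Z is the mean of \<bar>f\<bar>.\<close>

lemma integral_abs_squared_le:
  fixes f :: "real \<Rightarrow> real"
  assumes f: "continuous_on {0..1} f"
  shows "(integral {0..1} (\<lambda>x. \<bar>f x\<bar>))\<^sup>2 \<le> integral {0..1} (\<lambda>x. (f x)\<^sup>2)"
proof -
  define Z where "Z = integral {0..1} (\<lambda>x. \<bar>f x\<bar>)"
  note int = integrable_continuous_interval
  have "0 \<le> integral {0..1} (\<lambda>x. (\<bar>f x\<bar> - Z)\<^sup>2)"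
    by (intro integral_nonneg int continuous_intros f) auto
  also have "\<dots> = integral {0..1} (\<lambda>x. (f x)\<^sup>2 - 2 * Z * \<bar>f x\<bar> + Z\<^sup>2)"
    by (intro integral_cong) (simp add: power2_eq_square algebra_simps)
  also have "\<dots> = integral {0..1} (\<lambda>x. (f x)\<^sup>2 - 2 * Z * \<bar>f x\<bar>) + integral {0..1} (\<lambda>x::real. Z\<^sup>2)"
    by (intro integral_add int continuous_intros f)
  also have "integral {0..1} (\<lambda>x. (f x)\<^sup>2 - 2 * Z * \<bar>f x\<bar>) =
      integral {0..1} (\<lambda>x. (f x)\<^sup>2) - integral {0..1} (\<lambda>x. 2 * Z * \<bar>f x\<bar>)"
    by (intro integral_diff int continuous_intros f)
  also have "integral {0..1} (\<lambda>x. 2 * Z * \<bar>f x\<bar>) = 2 * Z * Z"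
    by (simp add: Z_def)
  finally show ?thesis by (simp add: Z_def power2_eq_square)
qed

lemma abs_weighted_integral_le:
  fixes f q :: "real \<Rightarrow> real"
  assumes f: "continuous_on {0..1} f" and q: "continuous_on {0..1} q"
    and Q: "\<And>x. x \<in> {0..1} \<Longrightarrow> \<bar>q x\<bar> \<le> Q" and c: "c \<ge> 0"
  shows "\<bar>integral {0..1} (\<lambda>x. exp (c * x) * f x * q x)\<bar> \<le> exp c * Q * integral {0..1} (\<lambda>x. \<bar>f x\<bar>)"
proof -
  have "\<bar>integral {0..1} (\<lambda>x. exp (c * x) * f x * q x)\<bar> \<le> integral {0..1} (\<lambda>x. exp c * Q * \<bar>f x\<bar>)"
  proof (rule abs_integral_le)
    fix x :: real assume x: "x \<in> {0..1}"
    have "exp (c * x) \<le> exp c" using x c by (simp add: mult_left_le)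
    then have "exp (c * x) * \<bar>q x\<bar> \<le> exp c * Q" using Q[OF x] by (intro mult_mono) auto
    then have "exp (c * x) * \<bar>q x\<bar> * \<bar>f x\<bar> \<le> exp c * Q * \<bar>f x\<bar>" by (intro mult_right_mono) auto
    then show "\<bar>exp (c * x) * f x * q x\<bar> \<le> exp c * Q * \<bar>f x\<bar>"
      by (simp add: abs_mult ac_simps)
  qed (intro continuous_intros f q)+
  then show ?thesis by simp
qed

lemma wnorm_sq_bounds:
  assumes f: "continuous_on {0..1} f" and c: "c \<ge> 0"
  shows "integral {0..1} (\<lambda>x. (f x)\<^sup>2) \<le> wnorm_sq c f"
    and "wnorm_sq c f \<le> exp c * integral {0..1} (\<lambda>x. (f x)\<^sup>2)"
proof -
  show "integral {0..1} (\<lambda>x. (f x)\<^sup>2) \<le> wnorm_sq c f"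
    unfolding wnorm_sq_def
    by (intro integral_mono_interval continuous_intros f)
      (use c in \<open>auto intro!: mult_right_mono[of 1 _ "(f _)\<^sup>2", simplified]\<close>)
  have "wnorm_sq c f \<le> integral {0..1} (\<lambda>x. exp c * (f x)\<^sup>2)"
    unfolding wnorm_sq_def
    by (intro integral_mono_interval continuous_intros f)
      (use c in \<open>auto intro!: mult_right_mono simp: mult_left_le\<close>)
  then show "wnorm_sq c f \<le> exp c * integral {0..1} (\<lambda>x. (f x)\<^sup>2)" by simp
qed

text \<open>The integral operator in the update law is the adjoint of the convolution with \<open>kh\<close>.\<close>

lemma adjoint_conv_eq:
  fixes kh m :: "real \<Rightarrow> real"
  shows "integral {x..1} (\<lambda>y. kh (y - x) * m y) = conv kh (\<lambda>y. m (1 - y)) (1 - x)"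
proof -
  have "integral {x..1} (\<lambda>y. kh (y - x) * m y) = integral {0..1 - x} (\<lambda>r. kh r * m (x + r))"
    using integral_shift_Icc_real[of 0 "1 - x" "\<lambda>y. kh (y - x) * m y" x] by (simp add: o_def)
  also have "\<dots> = integral {0..1 - x} (\<lambda>r. kh (1 - x - r) * m (1 - r))"
    using integral_flip[of "1 - x" "\<lambda>r. kh r * m (x + r)"] by (simp add: algebra_simps)
  finally show ?thesis by (simp add: conv_def)
qed

lemma continuous_on_adjoint_conv:
  fixes kh m :: "real \<Rightarrow> real"
  assumes kh: "continuous_on {0..1} kh" and m: "continuous_on {0..1} m"
  shows "continuous_on {0..1} (\<lambda>x. integral {x..1} (\<lambda>y. kh (y - x) * m y))"
proof -
  have "continuous_on {0..1} (\<lambda>y. m (1 - y))"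
    by (intro continuous_on_compose2[OF m] continuous_intros) auto
  then have "continuous_on {0..1} (conv kh (\<lambda>y. m (1 - y)))" by (intro continuous_intros kh)
  then show ?thesis
    unfolding adjoint_conv_eq
    by (rule continuous_on_compose2) (auto intro!: continuous_intros)
qed

text \<open>After the reflection y \<mapsto> 1 - y of \<open>m\<close>, both sides are the threefold
  convolution of \<open>kh\<close>, the reflected \<open>m\<close> and \<open>b\<close> at the point
  1, so the identity is associativity.\<close>

lemma integral_adjoint_conv:
  fixes kh m b :: "real \<Rightarrow> real"
  assumes kh: "continuous_on {0..1} kh" and m: "continuous_on {0..1} m" and b: "continuous_on {0..1} b"
  shows "integral {0..1} (\<lambda>x. b x * integral {x..1} (\<lambda>y. kh (y - x) * m y)) =
         integral {0..1} (\<lambda>x. m x * conv kh b x)"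
proof -
  define m' where "m' = (\<lambda>y. m (1 - y))"
  have m': "continuous_on {0..1} m'"
    unfolding m'_def by (intro continuous_on_compose2[OF m] continuous_intros) auto
  have 1: "(1::real) \<in> {0..1}" by simp
  have "integral {0..1} (\<lambda>x. b x * integral {x..1} (\<lambda>y. kh (y - x) * m y)) = conv (conv kh m') b 1"
    unfolding adjoint_conv_eq by (simp add: m'_def conv_def[of _ b] mult.commute)
  also have "conv (conv kh m') b 1 = conv (conv m' kh) b 1"
    by (rule conv_cong[of _ 1]) (auto intro: conv_commute)
  also have "\<dots> = conv m' (conv kh b) 1"
    by (rule conv_assoc[OF m' kh b 1])
  also have "\<dots> = integral {0..1} (\<lambda>x. m x * conv kh b x)"
    by (simp add: conv_def m'_def)
  finally show ?thesis .
qed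

text \<open>Meant for \<open>f\<close> the speed of the estimate, which is bounded by a multiple of
  \<bar>w\<bar> plus a constant. Splitting the product with \<open>z\<close> into squares gives a
  bound by squared norms, which the normalization in the update law can then absorb.\<close>

lemma abs_conv_le_amgm:
  fixes f g w z :: "real \<Rightarrow> real"
  assumes f: "continuous_on {0..1} f" and z: "continuous_on {0..1} z" and w: "continuous_on {0..1} w"
    and le: "\<And>x. x \<in> {0..1} \<Longrightarrow> \<bar>f x\<bar> \<le> P * (\<bar>w x\<bar> + Q)" and P: "P \<ge> 0" and Q: "Q \<ge> 0"
    and x: "x \<in> {0..1}"
  shows "\<bar>conv f z x\<bar> \<le> P * ((integral {0..1} (\<lambda>y. (w y)\<^sup>2) + integral {0..1} (\<lambda>y. (z y)\<^sup>2)) / 2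
           + Q * integral {0..1} (\<lambda>y. \<bar>z y\<bar>))"
proof -
  have x1: "x \<le> 1" "0 \<le> x" using x by auto
  note sub = continuous_on_subset[of "{0..1}" _ "{0..x}"]
  have w': "continuous_on {0..x} (\<lambda>y. w (x - y))"
    by (intro continuous_on_compose2[OF w] continuous_intros) (use x1 in auto)
  have f': "continuous_on {0..x} (\<lambda>y. f (x - y))"
    by (intro continuous_on_compose2[OF f] continuous_intros) (use x1 in auto)
  have z': "continuous_on {0..x} z" using z x1 by (intro sub) auto
  note int = integrable_continuous_interval
  have "\<bar>conv f z x\<bar> \<le> integral {0..x} (\<lambda>y. P * (((w (x - y))\<^sup>2 + (z y)\<^sup>2) / 2 + Q * \<bar>z y\<bar>))"
    unfolding conv_def
  proof (rule abs_integral_le)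
    fix y assume y: "y \<in> {0..x}"
    have "\<bar>f (x - y) * z y\<bar> \<le> P * (\<bar>w (x - y)\<bar> + Q) * \<bar>z y\<bar>"
      using le[of "x - y"] y x1 by (simp add: abs_mult mult_right_mono)
    also have "\<dots> = P * (\<bar>w (x - y)\<bar> * \<bar>z y\<bar> + Q * \<bar>z y\<bar>)" by (simp add: algebra_simps)
    also have "\<bar>w (x - y)\<bar> * \<bar>z y\<bar> \<le> ((w (x - y))\<^sup>2 + (z y)\<^sup>2) / 2"
      using sum_squares_bound[of "\<bar>w (x - y)\<bar>" "\<bar>z y\<bar>"] by simp
    finally show "\<bar>f (x - y) * z y\<bar> \<le> P * (((w (x - y))\<^sup>2 + (z y)\<^sup>2) / 2 + Q * \<bar>z y\<bar>)"
      using P by (simp add: mult_left_mono)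
  qed (intro continuous_intros f' w' z'; simp)+
  also have "\<dots> = P * integral {0..x} (\<lambda>y. ((w (x - y))\<^sup>2 + (z y)\<^sup>2) / 2 + Q * \<bar>z y\<bar>)"
    by (rule integral_mult_right)
  also have "integral {0..x} (\<lambda>y. ((w (x - y))\<^sup>2 + (z y)\<^sup>2) / 2 + Q * \<bar>z y\<bar>) =
      integral {0..x} (\<lambda>y. ((w (x - y))\<^sup>2 + (z y)\<^sup>2) / 2) + integral {0..x} (\<lambda>y. Q * \<bar>z y\<bar>)"
    by (intro integral_add int continuous_intros w' z') simp
  also have "integral {0..x} (\<lambda>y. ((w (x - y))\<^sup>2 + (z y)\<^sup>2) / 2) =
      (integral {0..x} (\<lambda>y. (w (x - y))\<^sup>2) + integral {0..x} (\<lambda>y. (z y)\<^sup>2)) / 2"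
    using integral_add[of "\<lambda>y. (w (x - y))\<^sup>2" "{0..x}" "\<lambda>y. (z y)\<^sup>2"]
    by (simp add: int w' z' continuous_intros)
  also have "integral {0..x} (\<lambda>y. (w (x - y))\<^sup>2) = integral {0..x} (\<lambda>y. (w y)\<^sup>2)"
    by (rule integral_flip)
  also have "integral {0..x} (\<lambda>y. Q * \<bar>z y\<bar>) = Q * integral {0..x} (\<lambda>y. \<bar>z y\<bar>)" by simp
  also have "P * ((integral {0..x} (\<lambda>y. (w y)\<^sup>2) + integral {0..x} (\<lambda>y. (z y)\<^sup>2)) / 2 + Q * integral {0..x} (\<lambda>y. \<bar>z y\<bar>))
    \<le> P * ((integral {0..1} (\<lambda>y. (w y)\<^sup>2) + integral {0..1} (\<lambda>y. (z y)\<^sup>2)) / 2 + Q * integral {0..1} (\<lambda>y. \<bar>z y\<bar>))"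
    by (intro mult_left_mono add_mono divide_right_mono integral_initial_le continuous_intros w z x P Q) auto
  finally show ?thesis .
qed

section \<open>The Lyapunov inequality at a fixed time\<close>

text \<open>Everything is frozen at one time: \<open>\<phi>\<close> is the estimate,
  \<open>v\<close> its time derivative, \<open>k\<close> the exact and \<open>kh\<close> the
  approximate kernel, \<open>u\<close> the state. The number \<open>A\<close> dominates both the
  cost 1 + B of returning from \<open>z\<close> to \<open>u\<close> and the kernel bounds, so that
  all error terms are measured by the single product (exp c)^2 A^3.\<close>

locale lyapunov_inequality =
  fixes B c \<epsilon> \<gamma> \<kappa> A :: real and \<phi> k kh \<beta> u v :: "real \<Rightarrow> real"
  assumes B: "B > 0" and c: "c > 0" and \<epsilon>: "\<epsilon> > 0" and \<gamma>: "\<gamma> > 0"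
    and A: "1 + B \<le> A" "\<kappa> + 2 \<le> A" and \<kappa>: "\<kappa> \<ge> 0"
    and \<epsilon>_small: "128 * (exp c)\<^sup>2 * A ^ 3 * \<epsilon> \<le> min 1 c"
    and \<gamma>_small: "128 * (exp c)\<^sup>2 * A ^ 3 * \<gamma> \<le> min 1 c"
    and cont: "continuous_on {0..1} \<phi>" "continuous_on {0..1} k" "continuous_on {0..1} kh"
      "continuous_on {0..1} \<beta>" "continuous_on {0..1} u" "continuous_on {0..1} v"
    and \<phi>_le: "\<And>x. x \<in> {0..1} \<Longrightarrow> \<bar>\<phi> x\<bar> \<le> B"
    and \<beta>_le: "\<And>x. x \<in> {0..1} \<Longrightarrow> \<bar>\<beta> x\<bar> \<le> B"
    and kernel: "\<And>x. x \<in> {0..1} \<Longrightarrow> k x = - \<phi> x + conv \<phi> k x"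
    and k_le: "\<And>x. x \<in> {0..1} \<Longrightarrow> \<bar>k x\<bar> \<le> \<kappa>"
    and kh_close: "\<And>x. x \<in> {0..1} \<Longrightarrow> \<bar>k x - kh x\<bar> \<le> \<epsilon>"
    and u1: "u 1 = conv kh u 1"
begin

definition z where "z x = u x - conv k u x"
definition w where "w x = u x - conv kh u x"
definition bt where "bt x = \<beta> x - \<phi> x"
definition \<tau> where "\<tau> x = \<gamma> / (1 + wnorm_sq c w) *
   (exp (c * x) * w x - integral {x..1} (\<lambda>y. kh (y - x) * exp (c * y) * w y)) * w 0"
text \<open>The source of the target equation, formally z_t = z_x + g. With f = u(0) bt + v * z,
  differentiating z = u + \<phi> * z gives z_t - z_x = f + \<phi> * (z_t - z_x), and this Volterra
  equation is solved by f - k * f.\<close>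

definition g where "g x = (u 0 * bt x + conv v z x) - conv k (\<lambda>x. u 0 * bt x + conv v z x) x"
definition Z where "Z = integral {0..1} (\<lambda>x. \<bar>z x\<bar>)"
definition N where "N = wnorm_sq c z"
definition Nw where "Nw = wnorm_sq c w"
text \<open>The error of \<open>w\<close> relative to the L1 norm \<open>Z\<close> of
  \<open>z\<close>: the kernel error \<open>\<epsilon>\<close> times the factor 1 + B that bounds
  the L1 norm of \<open>u\<close> by that of \<open>z\<close>.\<close>

definition \<eta> where "\<eta> = \<epsilon> * (1 + B)"

lemma cont_z: "continuous_on {0..1} z" unfolding z_def by (intro continuous_intros cont)
lemma cont_w: "continuous_on {0..1} w" unfolding w_def by (intro continuous_intros cont)
lemma cont_bt: "continuous_on {0..1} bt" unfolding bt_def by (intro continuous_intros cont)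
lemmas cont_all = cont cont_z cont_w cont_bt

lemma E1: "exp c \<ge> 1" using c by simp
lemma A1: "A \<ge> 2" "B \<le> A" using A \<kappa> B by linarith+

text \<open>The threshold min 1 c answers two needs at once: the errors must be small absolutely and
  also small against the decay rate c.\<close>

lemma scaled_le:
  assumes "0 \<le> X" "X \<le> (exp c)\<^sup>2 * A ^ 3" "\<delta> \<in> {\<epsilon>, \<gamma>}"
  shows "128 * (X * \<delta>) \<le> min 1 c"
proof -
  have "X * \<delta> \<le> (exp c)\<^sup>2 * A ^ 3 * \<delta>" using assms \<epsilon> \<gamma> by (intro mult_right_mono) auto
  then show ?thesis using assms(3) \<epsilon>_small \<gamma>_small by auto
qed

lemma EA_le:
  shows "A \<le> (exp c)\<^sup>2 * A ^ 3" "exp c * A \<le> (exp c)\<^sup>2 * A ^ 3"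
proof -
  have "1 * 1 \<le> exp c * exp c" "exp c * 1 \<le> exp c * exp c" "1 * 1 \<le> A * A"
    using E1 A1 by (intro mult_mono; simp)+
  moreover from this(3) have "A * 1 \<le> A * (A * A)"
    using A1 by (intro mult_left_mono) auto
  ultimately have "1 * (A * 1) \<le> exp c * exp c * (A * (A * A))" "exp c * (A * 1) \<le> exp c * exp c * (A * (A * A))"
    using A1 by (intro mult_mono; simp)+
  then show "A \<le> (exp c)\<^sup>2 * A ^ 3" "exp c * A \<le> (exp c)\<^sup>2 * A ^ 3"
    by (simp_all add: power2_eq_square power3_eq_cube)
qed

lemma \<eta>: "0 \<le> \<eta>" "\<eta> \<le> A * \<epsilon>" "\<eta> \<le> 1" "3 * exp c * \<eta> \<le> 1/2"
proof -
  show 0: "0 \<le> \<eta>" using \<epsilon> B by (simp add: \<eta>_def)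
  show 1: "\<eta> \<le> A * \<epsilon>" using A \<epsilon> by (simp add: \<eta>_def mult.commute)
  have "128 * (A * \<epsilon>) \<le> min 1 c" using EA_le(1) A1 by (intro scaled_le) auto
  then show "\<eta> \<le> 1" using 1 by (auto simp: min_def split: if_splits)
  have "128 * (exp c * A * \<epsilon>) \<le> min 1 c" using EA_le(2) A1 by (intro scaled_le) auto
  moreover have "exp c * \<eta> \<le> exp c * (A * \<epsilon>)" using 1 by simp
  moreover have "min 1 c \<le> 1" by simp
  ultimately show "3 * exp c * \<eta> \<le> 1/2" unfolding mult.assoc by linarith
qed

lemma Z_nonneg: "Z \<ge> 0"
  unfolding Z_def by (intro integral_nonneg integrable_continuous_interval continuous_intros cont_z) auto

lemma z_eq: "x \<in> {0..1} \<Longrightarrow> z x = u x + conv \<phi> z x"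
  using volterra_solution[OF cont(1,2) kernel cont(5)] by (simp add: z_def[abs_def])

lemma u_integral_le: "integral {0..1} (\<lambda>x. \<bar>u x\<bar>) \<le> (1 + B) * Z"
proof -
  have "\<bar>u x\<bar> \<le> \<bar>z x\<bar> + B * Z" if x: "x \<in> {0..1}" for x
  proof -
    have "\<bar>conv \<phi> z x\<bar> \<le> B * integral {0..x} (\<lambda>y. \<bar>z y\<bar>)"
      by (rule abs_conv_le_integral[OF x cont(1) cont_z \<phi>_le])
    also have "integral {0..x} (\<lambda>y. \<bar>z y\<bar>) \<le> Z"
      unfolding Z_def using x by (intro integral_initial_le continuous_intros cont_z) auto
    finally show ?thesis using z_eq[OF x] B by (simp add: mult_left_mono)
  qed
  then have "integral {0..1} (\<lambda>x. \<bar>u x\<bar>) \<le> integral {0..1} (\<lambda>x. \<bar>z x\<bar> + B * Z)"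
    by (intro integral_mono_interval continuous_intros cont_all) auto
  also have "\<dots> = Z + integral {0..1} (\<lambda>x::real. B * Z)"
    unfolding Z_def by (intro integral_add integrable_continuous_interval continuous_intros cont_all)
  finally show ?thesis by (simp add: algebra_simps)
qed

lemma kernel_error_le:
  assumes x: "x \<in> {0..1}"
  shows "\<bar>conv (\<lambda>y. k y - kh y) u x\<bar> \<le> \<eta> * Z"
proof -
  have "\<bar>conv (\<lambda>y. k y - kh y) u x\<bar> \<le> \<epsilon> * integral {0..x} (\<lambda>y. \<bar>u y\<bar>)"
    by (rule abs_conv_le_integral[OF x _ cont(5)]) (use kh_close in \<open>auto intro!: continuous_intros cont\<close>)
  also have "\<dots> \<le> \<epsilon> * integral {0..1} (\<lambda>y. \<bar>u y\<bar>)"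
    using \<epsilon> x by (intro mult_left_mono integral_initial_le continuous_intros cont) auto
  also have "\<dots> \<le> \<epsilon> * ((1 + B) * Z)" using \<epsilon> u_integral_le by simp
  finally show ?thesis by (simp add: \<eta>_def mult.assoc)
qed

lemma w_minus_z: "x \<in> {0..1} \<Longrightarrow> w x - z x = conv (\<lambda>y. k y - kh y) u x"
  using conv_diff_left[OF _ cont(5,2,3), of x] by (simp add: w_def z_def)

lemma wz_close: "x \<in> {0..1} \<Longrightarrow> \<bar>w x - z x\<bar> \<le> \<eta> * Z"
  using kernel_error_le w_minus_z by simp

text \<open>The control makes \<open>w\<close> vanish at 1, so \<open>z 1\<close> consists of the
  kernel error alone.\<close>

lemma z1_le: "\<bar>z 1\<bar> \<le> \<eta> * Z"
  using wz_close[of 1] u1 by (simp add: w_def)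

lemma w_integral_le: "integral {0..1} (\<lambda>x. \<bar>w x\<bar>) \<le> 2 * Z"
proof -
  have "\<bar>w x\<bar> \<le> \<bar>z x\<bar> + Z" if "x \<in> {0..1}" for x
  proof -
    have "\<eta> * Z \<le> 1 * Z" using \<eta> Z_nonneg by (intro mult_right_mono) auto
    then show ?thesis using wz_close[OF that] by linarith
  qed
  then have "integral {0..1} (\<lambda>x. \<bar>w x\<bar>) \<le> integral {0..1} (\<lambda>x. \<bar>z x\<bar> + Z)"
    by (intro integral_mono_interval continuous_intros cont_all) auto
  also have "\<dots> = Z + integral {0..1} (\<lambda>x::real. Z)"
    unfolding Z_def by (intro integral_add integrable_continuous_interval continuous_intros cont_all)
  finally show ?thesis by simp
qed

lemma Z_sq_le: "Z\<^sup>2 \<le> integral {0..1} (\<lambda>x. (z x)\<^sup>2)" "Z\<^sup>2 \<le> N"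
proof -
  show 1: "Z\<^sup>2 \<le> integral {0..1} (\<lambda>x. (z x)\<^sup>2)"
    unfolding Z_def by (rule integral_abs_squared_le[OF cont_z])
  then show "Z\<^sup>2 \<le> N"
    unfolding N_def using wnorm_sq_bounds(1)[OF cont_z, of c] c by simp
qed

lemma N_diff_le: "\<bar>N - Nw\<bar> \<le> 3 * exp c * \<eta> * Z\<^sup>2"
proof -
  have "N - Nw = integral {0..1} (\<lambda>x. exp (c * x) * (z x)\<^sup>2 - exp (c * x) * (w x)\<^sup>2)"
    unfolding N_def Nw_def wnorm_sq_def
    by (intro integral_diff[symmetric] integrable_continuous_interval continuous_intros cont_all)
  also have "\<dots> = integral {0..1} (\<lambda>x. exp (c * x) * (z x + w x) * (z x - w x))"
    by (intro integral_cong) (simp add: power2_eq_square algebra_simps)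
  finally have "\<bar>N - Nw\<bar> \<le> exp c * (\<eta> * Z) * integral {0..1} (\<lambda>x. \<bar>z x + w x\<bar>)"
  proof (simp only:, intro abs_weighted_integral_le)
    show "\<bar>z x - w x\<bar> \<le> \<eta> * Z" if "x \<in> {0..1}" for x
      using wz_close[OF that] by (simp add: abs_minus_commute)
  qed (use c in \<open>auto intro!: continuous_intros cont_all\<close>)
  also have "\<dots> \<le> exp c * (\<eta> * Z) * (3 * Z)"
  proof (rule mult_left_mono)
    have "integral {0..1} (\<lambda>x. \<bar>z x + w x\<bar>) \<le> integral {0..1} (\<lambda>x. \<bar>z x\<bar> + \<bar>w x\<bar>)"
      by (intro integral_mono_interval continuous_intros cont_all) auto
    also have "\<dots> = Z + integral {0..1} (\<lambda>x. \<bar>w x\<bar>)"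
      unfolding Z_def by (intro integral_add integrable_continuous_interval continuous_intros cont_all)
    also have "\<dots> \<le> 3 * Z" using w_integral_le by simp
    finally show "integral {0..1} (\<lambda>x. \<bar>z x + w x\<bar>) \<le> 3 * Z" .
  qed (use \<eta>(1) Z_nonneg in simp)
  finally show ?thesis by (simp add: power2_eq_square ac_simps)
qed

lemma N_nonneg: "N \<ge> 0" "Nw \<ge> 0"
  unfolding N_def Nw_def wnorm_sq_def
  by (intro integral_nonneg integrable_continuous_interval continuous_intros cont_all; simp)+

lemma N_le: "N \<le> 2 * Nw"
proof -
  have "3 * exp c * \<eta> * Z\<^sup>2 \<le> 1/2 * Z\<^sup>2" using \<eta>(4) by (intro mult_right_mono) auto
  then show ?thesis using N_diff_le Z_sq_le(2) by linarith
qed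

lemma bt_le: "x \<in> {0..1} \<Longrightarrow> \<bar>bt x\<bar> \<le> 2 * B"
  using \<phi>_le[of x] \<beta>_le[of x] by (simp add: bt_def)

lemma k_bt_le:
  assumes x: "x \<in> {0..1}"
  shows "\<bar>bt x - conv k bt x\<bar> \<le> 2 * B * A"
proof -
  have "\<bar>conv k bt x\<bar> \<le> \<kappa> * (2 * B) * x"
    by (rule abs_conv_le[OF x cont(2) cont_bt k_le bt_le])
  also have "\<dots> \<le> \<kappa> * (2 * B)" using x \<kappa> B by (intro mult_left_le) auto
  finally have "\<bar>bt x - conv k bt x\<bar> \<le> 2 * B * (1 + \<kappa>)"
    using bt_le[OF x] by (simp add: algebra_simps)
  also have "\<dots> \<le> 2 * B * A" using A B by (intro mult_left_mono) auto
  finally show ?thesis .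
qed

lemma kh_le: "x \<in> {0..1} \<Longrightarrow> \<bar>kh x\<bar> \<le> \<kappa> + 1"
proof -
  assume x: "x \<in> {0..1}"
  have "128 * (A * \<epsilon>) \<le> min 1 c" using EA_le(1) A1 by (intro scaled_le) auto
  moreover have "1 * \<epsilon> \<le> A * \<epsilon>" using A1 \<epsilon> by (intro mult_right_mono) auto
  ultimately have "\<epsilon> \<le> 1" by (auto simp: min_def split: if_splits)
  then show "\<bar>kh x\<bar> \<le> \<kappa> + 1" using kh_close[OF x] k_le[OF x] by linarith
qed

lemma kh_bt_le:
  assumes x: "x \<in> {0..1}"
  shows "\<bar>bt x - conv kh bt x\<bar> \<le> 2 * B * A"
proof -
  have "\<bar>conv kh bt x\<bar> \<le> (\<kappa> + 1) * (2 * B) * x"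
    by (rule abs_conv_le[OF x cont(3) cont_bt kh_le bt_le])
  also have "\<dots> \<le> (\<kappa> + 1) * (2 * B)" using x \<kappa> B by (intro mult_left_le) auto
  finally have "\<bar>bt x - conv kh bt x\<bar> \<le> 2 * B * (2 + \<kappa>)"
    using bt_le[OF x] by (simp add: algebra_simps)
  also have "\<dots> \<le> 2 * B * A" using A B by (intro mult_left_mono) auto
  finally show ?thesis .
qed

text \<open>Per unit of u(0), \<open>Sz\<close> is half of what the estimation error contributes to
  the derivative of \<open>N\<close>. Its companion \<open>Sw\<close>, formed with the approximate
  kernel and \<open>w\<close>, is what the implemented update law produces against it.\<close>

definition Sz where "Sz = integral {0..1} (\<lambda>x. exp (c * x) * z x * (bt x - conv k bt x))"
definition Sw where "Sw = integral {0..1} (\<lambda>x. exp (c * x) * w x * (bt x - conv kh bt x))"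

lemma Sw_le: "\<bar>Sw\<bar> \<le> 4 * exp c * A\<^sup>2 * Z"
proof -
  have "\<bar>Sw\<bar> \<le> exp c * (2 * B * A) * integral {0..1} (\<lambda>x. \<bar>w x\<bar>)"
    unfolding Sw_def using kh_bt_le c
    by (intro abs_weighted_integral_le) (auto intro!: continuous_intros cont_all)
  also have "\<dots> \<le> exp c * (2 * A * A) * (2 * Z)"
    using w_integral_le A1 B Z_nonneg by (intro mult_mono) (auto intro!: integral_nonneg integrable_continuous_interval continuous_intros cont_all)
  finally show ?thesis by (simp add: power2_eq_square ac_simps)
qed

text \<open>The change is made in two moves: \<open>f1\<close> replaces \<open>z\<close> by
  \<open>w\<close> with the exact kernel kept, at the cost \<open>\<eta> * Z\<close>;
  \<open>f2\<close> replaces the kernel with \<open>w\<close> kept, at the cost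
  \<open>\<epsilon>\<close>.\<close>

lemma S_diff_le: "\<bar>Sz - Sw\<bar> \<le> 4 * exp c * A ^ 3 * \<epsilon> * Z"
proof -
  define f1 where "f1 = (\<lambda>x. exp (c * x) * (bt x - conv k bt x) * (z x - w x))"
  define f2 where "f2 = (\<lambda>x. exp (c * x) * w x * (conv (\<lambda>y. kh y - k y) bt x))"
  have c12: "continuous_on {0..1} f1" "continuous_on {0..1} f2"
    unfolding f1_def f2_def by (intro continuous_intros cont_all)+
  have "Sz - Sw = integral {0..1} (\<lambda>x. exp (c * x) * z x * (bt x - conv k bt x) -
      exp (c * x) * w x * (bt x - conv kh bt x))"
    unfolding Sz_def Sw_def
    by (intro integral_diff[symmetric] integrable_continuous_interval continuous_intros cont_all)
  also have "\<dots> = integral {0..1} (\<lambda>x. f1 x + f2 x)"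
    by (intro integral_cong)
      (simp add: f1_def f2_def conv_diff_left[OF _ cont_bt cont(3,2)] algebra_simps)
  also have "\<dots> = integral {0..1} f1 + integral {0..1} f2"
    by (intro integral_add integrable_continuous_interval c12)
  finally have S: "Sz - Sw = integral {0..1} f1 + integral {0..1} f2" .
  have "\<bar>integral {0..1} f1\<bar> \<le> exp c * (\<eta> * Z) * integral {0..1} (\<lambda>x. \<bar>bt x - conv k bt x\<bar>)"
    unfolding f1_def
  proof (rule abs_weighted_integral_le)
    show "\<bar>z x - w x\<bar> \<le> \<eta> * Z" if "x \<in> {0..1}" for x
      using wz_close[OF that] by (simp add: abs_minus_commute)
  qed (use c in \<open>auto intro!: continuous_intros cont_all\<close>)
  also have "\<dots> \<le> exp c * (A * \<epsilon> * Z) * (2 * A * A)"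
  proof (intro mult_mono)
    have "integral {0..1} (\<lambda>x. \<bar>bt x - conv k bt x\<bar>) \<le> integral {0..1} (\<lambda>x::real. 2 * B * A)"
      using k_bt_le by (intro integral_mono_interval continuous_intros cont_all) auto
    also have "\<dots> \<le> 2 * A * A" using A1 by simp
    finally show "integral {0..1} (\<lambda>x. \<bar>bt x - conv k bt x\<bar>) \<le> 2 * A * A" .
  qed (use \<eta> Z_nonneg A1 \<epsilon> in \<open>auto intro!: integral_nonneg integrable_continuous_interval continuous_intros cont_all\<close>)
  finally have 1: "\<bar>integral {0..1} f1\<bar> \<le> 2 * exp c * A ^ 3 * \<epsilon> * Z"
    by (simp add: power3_eq_cube ac_simps)
  have "\<bar>conv (\<lambda>y. kh y - k y) bt x\<bar> \<le> \<epsilon> * (2 * B)" if x: "x \<in> {0..1}" for x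
  proof -
    have "\<bar>conv (\<lambda>y. kh y - k y) bt x\<bar> \<le> \<epsilon> * (2 * B) * x"
      using kh_close
      by (intro abs_conv_le[OF x _ cont_bt _ bt_le]) (auto intro!: continuous_intros cont_all simp: abs_minus_commute)
    also have "\<dots> \<le> \<epsilon> * (2 * B)" using x \<epsilon> B by (intro mult_left_le) auto
    finally show ?thesis .
  qed
  then have "\<bar>integral {0..1} f2\<bar> \<le> exp c * (\<epsilon> * (2 * B)) * integral {0..1} (\<lambda>x. \<bar>w x\<bar>)"
    unfolding f2_def using c
    by (intro abs_weighted_integral_le) (auto intro!: continuous_intros cont_all)
  also have "\<dots> \<le> exp c * (\<epsilon> * (2 * A)) * (2 * Z)"
    using w_integral_le A1 B Z_nonneg \<epsilon> by (intro mult_mono) (auto intro!: integral_nonneg integrable_continuous_interval continuous_intros cont_all)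
  also have "\<dots> = exp c * \<epsilon> * Z * (A * 4)" by simp
  also have "\<dots> \<le> exp c * \<epsilon> * Z * (A * (2 * A\<^sup>2))"
  proof (intro mult_left_mono)
    have "2 * 2 \<le> A * A" using A1 by (intro mult_mono) auto
    then show "4 \<le> 2 * A\<^sup>2" by (simp add: power2_eq_square)
  qed (use \<epsilon> Z_nonneg A1 in auto)
  finally have 2: "\<bar>integral {0..1} f2\<bar> \<le> 2 * exp c * A ^ 3 * \<epsilon> * Z"
    by (simp add: power3_eq_cube power2_eq_square ac_simps)
  show ?thesis using 1 2 S by linarith
qed

text \<open>Cancellation fails both in the numerators and in the normalizations 1 + \<open>N\<close>
  and 1 + \<open>Nw\<close>. The difference of the norms is at most of order
  \<open>\<epsilon>\<close> times 1 + \<open>Nw\<close>, which removes the denominator and leaves a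
  bound linear in \<open>Z\<close>. The constant is 4 + 24, one summand for each defect.\<close>

lemma mismatch_le: "(1 + N) * \<bar>Sz / (1 + N) - Sw / (1 + Nw)\<bar> \<le> 28 * (exp c)\<^sup>2 * A ^ 3 * \<epsilon> * Z"
proof -
  have "(1 + N) * (Sz / (1 + N) - Sw / (1 + Nw)) = (Sz - Sw) + Sw * (Nw - N) / (1 + Nw)"
  proof -
    have "(1 + N) * (Sz / (1 + N) - Sw / (1 + Nw)) = Sz - ((1 + Nw) * Sw - Sw * (Nw - N)) / (1 + Nw)"
      using N_nonneg by (simp add: right_diff_distrib) (simp add: algebra_simps)
    then show ?thesis using N_nonneg by (simp add: diff_divide_distrib)
  qed
  then have "(1 + N) * \<bar>Sz / (1 + N) - Sw / (1 + Nw)\<bar> = \<bar>(Sz - Sw) + Sw * (Nw - N) / (1 + Nw)\<bar>"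
    using N_nonneg by (metis abs_mult abs_of_nonneg add_nonneg_nonneg zero_le_one)
  also have "\<dots> \<le> \<bar>Sz - Sw\<bar> + \<bar>Sw\<bar> * \<bar>N - Nw\<bar> / (1 + Nw)"
    using N_nonneg abs_triangle_ineq[of "Sz - Sw" "Sw * (Nw - N) / (1 + Nw)"]
    by (simp add: abs_mult abs_divide abs_minus_commute)
  finally have 1: "(1 + N) * \<bar>Sz / (1 + N) - Sw / (1 + Nw)\<bar> \<le> \<bar>Sz - Sw\<bar> + \<bar>Sw\<bar> * \<bar>N - Nw\<bar> / (1 + Nw)" .
  have 2: "\<bar>Sw\<bar> * \<bar>N - Nw\<bar> / (1 + Nw) \<le> 24 * (exp c)\<^sup>2 * A ^ 3 * \<epsilon> * Z"
  proof -
    have "3 * exp c * \<eta> * Z\<^sup>2 \<le> 3 * exp c * (A * \<epsilon>) * (2 * (1 + Nw))"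
      using \<eta> Z_sq_le(2) N_le N_nonneg \<epsilon> A1 by (intro mult_mono) auto
    with N_diff_le have "\<bar>N - Nw\<bar> \<le> 3 * exp c * (A * \<epsilon>) * (2 * (1 + Nw))" by linarith
    also have "\<dots> = 6 * exp c * (A * \<epsilon>) * (1 + Nw)" by simp
    finally have "\<bar>N - Nw\<bar> \<le> 6 * exp c * (A * \<epsilon>) * (1 + Nw)" .
    then have "\<bar>Sw\<bar> * \<bar>N - Nw\<bar> \<le> (4 * exp c * A\<^sup>2 * Z) * (6 * exp c * (A * \<epsilon>) * (1 + Nw))"
      using Sw_le Z_nonneg by (intro mult_mono) auto
    also have "\<dots> = 24 * (exp c)\<^sup>2 * A ^ 3 * \<epsilon> * Z * (1 + Nw)"
      by (simp add: power2_eq_square power3_eq_cube)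
    finally show ?thesis using N_nonneg by (simp add: pos_divide_le_eq)
  qed
  have 3: "\<bar>Sz - Sw\<bar> \<le> 4 * (exp c)\<^sup>2 * A ^ 3 * \<epsilon> * Z"
  proof -
    have "exp c * (4 * A ^ 3 * \<epsilon> * Z) \<le> (exp c)\<^sup>2 * (4 * A ^ 3 * \<epsilon> * Z)"
      using E1 A1 \<epsilon> Z_nonneg by (intro mult_right_mono) (auto simp: power2_eq_square)
    then show ?thesis using S_diff_le by (simp add: ac_simps)
  qed
  from 1 2 3 show ?thesis by linarith
qed

lemma w0: "w 0 = u 0" by (simp add: w_def conv_def)

text \<open>By the adjoint identity the integral operator of the update law passes to
  \<open>bt\<close>, where it becomes the convolution with \<open>kh\<close>. This is the reason for
  the form of the update law: paired with the estimation error it reproduces exactly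
  \<open>Sw\<close>.\<close>

lemma bt_\<tau>_integral: "integral {0..1} (\<lambda>x. bt x * \<tau> x) = \<gamma> / (1 + Nw) * u 0 * Sw"
proof -
  define m where "m = (\<lambda>x. exp (c * x) * w x)"
  have cm: "continuous_on {0..1} m" unfolding m_def by (intro continuous_intros cont_all)
  define J where "J = (\<lambda>x. integral {x..1} (\<lambda>y. kh (y - x) * m y))"
  have cJ: "continuous_on {0..1} J" unfolding J_def by (rule continuous_on_adjoint_conv[OF cont(3) cm])
  note int = integrable_continuous_interval
  have "integral {0..1} (\<lambda>x. bt x * \<tau> x) = integral {0..1} (\<lambda>x. \<gamma> / (1 + Nw) * u 0 * (bt x * m x - bt x * J x))"
    by (intro integral_cong) (simp add: \<tau>_def m_def J_def w0 Nw_def algebra_simps)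
  also have "\<dots> = \<gamma> / (1 + Nw) * u 0 * integral {0..1} (\<lambda>x. bt x * m x - bt x * J x)"
    by (rule integral_mult_right)
  also have "integral {0..1} (\<lambda>x. bt x * m x - bt x * J x) =
      integral {0..1} (\<lambda>x. bt x * m x) - integral {0..1} (\<lambda>x. bt x * J x)"
    by (intro integral_diff int continuous_intros cont_all cm cJ)
  also have "integral {0..1} (\<lambda>x. bt x * J x) = integral {0..1} (\<lambda>x. m x * conv kh bt x)"
    unfolding J_def by (rule integral_adjoint_conv[OF cont(3) cm cont_bt])
  also have "integral {0..1} (\<lambda>x. bt x * m x) - \<dots> = integral {0..1} (\<lambda>x. bt x * m x - m x * conv kh bt x)"
    by (intro integral_diff[symmetric] int continuous_intros cont_all cm)
  also have "\<dots> = Sw"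
    unfolding Sw_def by (intro integral_cong) (simp add: m_def algebra_simps)
  finally show ?thesis .
qed

lemma cont_\<tau>: "continuous_on {0..1} \<tau>"
proof -
  have "continuous_on {0..1} (\<lambda>x. integral {x..1} (\<lambda>y. kh (y - x) * (exp (c * y) * w y)))"
    by (intro continuous_on_adjoint_conv cont continuous_intros cont_all)
  then show ?thesis
    unfolding \<tau>_def using N_nonneg by (intro continuous_intros cont_all) (auto simp: Nw_def mult.assoc)
qed

lemma \<tau>_le:
  assumes x: "x \<in> {0..1}"
  shows "\<bar>\<tau> x\<bar> \<le> \<gamma> * \<bar>u 0\<bar> * exp c / (1 + Nw) * (\<bar>w x\<bar> + A * (2 * Z))"
proof -
  define m where "m = (\<lambda>x. exp (c * x) * w x)"
  have cm: "continuous_on {0..1} m" unfolding m_def by (intro continuous_intros cont_all)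
  have m_le: "\<bar>m y\<bar> \<le> exp c * \<bar>w y\<bar>" if "y \<in> {0..1}" for y
    using that c by (auto simp: m_def abs_mult mult_left_le intro!: mult_right_mono)
  have "\<bar>integral {x..1} (\<lambda>y. kh (y - x) * m y)\<bar> \<le> integral {x..1} (\<lambda>y. A * (exp c * \<bar>w y\<bar>))"
  proof (rule abs_integral_le)
    show "continuous_on {x..1} (\<lambda>y. kh (y - x) * m y)" "continuous_on {x..1} (\<lambda>y. A * (exp c * \<bar>w y\<bar>))"
      using x by (auto intro!: continuous_intros continuous_on_compose2[OF cont(3)]
         continuous_on_subset[OF cm] continuous_on_subset[OF cont_w])
    fix y assume y: "y \<in> {x..1}"
    then have "\<bar>kh (y - x)\<bar> \<le> A" using kh_le[of "y - x"] A x by auto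
    then show "\<bar>kh (y - x) * m y\<bar> \<le> A * (exp c * \<bar>w y\<bar>)"
      unfolding abs_mult using m_le[of y] x y A1 by (intro mult_mono) auto
  qed
  also have "\<dots> = A * exp c * integral {x..1} (\<lambda>y. \<bar>w y\<bar>)" by simp
  also have "integral {x..1} (\<lambda>y. \<bar>w y\<bar>) \<le> integral {0..1} (\<lambda>y. \<bar>w y\<bar>)"
    using x by (intro integral_subset_le integrable_continuous_interval continuous_intros continuous_on_subset[OF cont_w]) auto
  also have "\<dots> \<le> 2 * Z" by (rule w_integral_le)
  finally have J: "\<bar>integral {x..1} (\<lambda>y. kh (y - x) * m y)\<bar> \<le> A * exp c * (2 * Z)"
    using A1 by (simp add: mult_left_mono)
  have "\<bar>\<tau> x\<bar> = \<gamma> / (1 + Nw) * \<bar>m x - integral {x..1} (\<lambda>y. kh (y - x) * m y)\<bar> * \<bar>u 0\<bar>"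
    using \<gamma> N_nonneg by (simp add: \<tau>_def m_def w0 abs_mult abs_divide Nw_def[symmetric] mult.assoc)
  also have "\<dots> \<le> \<gamma> / (1 + Nw) * (exp c * \<bar>w x\<bar> + A * exp c * (2 * Z)) * \<bar>u 0\<bar>"
    using \<gamma> N_nonneg J m_le[OF x] by (intro mult_right_mono mult_left_mono) auto
  also have "\<dots> = \<gamma> * \<bar>u 0\<bar> * exp c / (1 + Nw) * (\<bar>w x\<bar> + A * (2 * Z))"
    by (simp add: field_simps)
  finally show ?thesis .
qed

text \<open>The projection enters through two properties only: the actual velocity is no larger than
  the unprojected one, and projecting does not worsen its product with the estimation error.\<close>

context
  assumes v_le: "\<And>x. x \<in> {0..1} \<Longrightarrow> \<bar>v x\<bar> \<le> \<bar>\<tau> x\<bar>"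
    and v_proj: "\<And>x. x \<in> {0..1} \<Longrightarrow> bt x * (\<tau> x - v x) \<le> 0"
begin

text \<open>The convolution is quadratic in the state, apart from the factor u(0), and is at most a
  multiple of \<open>Nw\<close>; the normalization divides by 1 + \<open>Nw\<close>. Hence the bound
  is of order \<open>\<gamma>\<close> and does not grow with the state beyond
  \<bar>u(0)\<bar>.\<close>

lemma conv_v_z_le:
  assumes x: "x \<in> {0..1}"
  shows "\<bar>conv v z x\<bar> \<le> 6 * \<gamma> * \<bar>u 0\<bar> * exp c * A"
proof -
  let ?P = "\<gamma> * \<bar>u 0\<bar> * exp c / (1 + Nw)"
  have P: "?P \<ge> 0" using \<gamma> N_nonneg by simp
  have "\<bar>conv v z x\<bar> \<le> ?P * ((integral {0..1} (\<lambda>y. (w y)\<^sup>2) + integral {0..1} (\<lambda>y. (z y)\<^sup>2)) / 2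
           + A * (2 * Z) * integral {0..1} (\<lambda>y. \<bar>z y\<bar>))"
  proof (rule abs_conv_le_amgm[OF cont(6) cont_z cont_w _ P _ x])
    show "\<bar>v x\<bar> \<le> ?P * (\<bar>w x\<bar> + A * (2 * Z))" if "x \<in> {0..1}" for x
      using v_le[OF that] \<tau>_le[OF that] by linarith
  qed (use A1 Z_nonneg in auto)
  also have "\<dots> \<le> ?P * (6 * A * Nw)"
  proof (rule mult_left_mono[OF _ P])
    have "integral {0..1} (\<lambda>y. (w y)\<^sup>2) \<le> Nw" "integral {0..1} (\<lambda>y. (z y)\<^sup>2) \<le> N"
      unfolding Nw_def N_def using c by (auto intro!: wnorm_sq_bounds cont_all)
    moreover have "A * (2 * Z) * Z \<le> A * (4 * Nw)"
      using Z_sq_le(2) N_le A1 by (simp add: power2_eq_square)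
    moreover have "2 * Nw \<le> A * Nw" using A1 N_nonneg by (intro mult_right_mono) auto
    moreover have "6 * A * Nw = A * (4 * Nw) + 2 * (A * Nw)" by simp
    ultimately show "(integral {0..1} (\<lambda>y. (w y)\<^sup>2) + integral {0..1} (\<lambda>y. (z y)\<^sup>2)) / 2
           + A * (2 * Z) * integral {0..1} (\<lambda>y. \<bar>z y\<bar>) \<le> 6 * A * Nw"
      unfolding Z_def[symmetric] using N_le N_nonneg by argo
  qed
  also have "\<dots> = 6 * \<gamma> * \<bar>u 0\<bar> * exp c * A * (Nw / (1 + Nw))" by simp
  also have "\<dots> \<le> 6 * \<gamma> * \<bar>u 0\<bar> * exp c * A"
    using N_nonneg \<gamma> A1 by (intro mult_left_le) auto
  finally show ?thesis .
qed

text \<open>By linearity \<open>g\<close> splits into the part due to the estimation error, whose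
  integral is exactly u(0) \<open>Sz\<close>, and the part due to the motion of the estimate, which
  is of order \<open>\<gamma>\<close>.\<close>

lemma zg_integral_le:
  "\<bar>integral {0..1} (\<lambda>x. exp (c * x) * z x * g x) - u 0 * Sz\<bar> \<le> 6 * (exp c)\<^sup>2 * A ^ 3 * \<gamma> * \<bar>u 0\<bar> * Z"
proof -
  define r where "r = conv v z"
  have cr: "continuous_on {0..1} r" unfolding r_def by (intro continuous_intros cont_all)
  let ?G = "6 * \<gamma> * \<bar>u 0\<bar> * exp c * A"
  have r_le: "\<bar>r x\<bar> \<le> ?G" if "x \<in> {0..1}" for x
    using conv_v_z_le[OF that] by (simp add: r_def)
  have r_k_le: "\<bar>r x - conv k r x\<bar> \<le> A * ?G" if x: "x \<in> {0..1}" for x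
  proof -
    have "\<bar>conv k r x\<bar> \<le> \<kappa> * ?G * x"
      by (rule abs_conv_le[OF x cont(2) cr k_le r_le])
    also have "\<dots> \<le> \<kappa> * ?G" using x \<kappa> \<gamma> A1 by (intro mult_left_le) auto
    finally have "\<bar>r x - conv k r x\<bar> \<le> (1 + \<kappa>) * ?G"
      using r_le[OF x] by (simp add: algebra_simps)
    also have "\<dots> \<le> A * ?G" using A \<gamma> A1 by (intro mult_right_mono) auto
    finally show ?thesis .
  qed
  have g_eq: "g x = u 0 * (bt x - conv k bt x) + (r x - conv k r x)" if x: "x \<in> {0..1}" for x
  proof -
    have "conv k (\<lambda>x. u 0 * bt x + r x) x = conv k (\<lambda>x. u 0 * bt x) x + conv k r x"
      by (rule conv_add_right[OF x]) (intro continuous_intros cont_all cr)+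
    also have "conv k (\<lambda>x. u 0 * bt x) x = u 0 * conv k bt x"
    proof -
      have "conv k (\<lambda>x. u 0 * bt x) x = integral {0..x} (\<lambda>y. u 0 * (k (x - y) * bt y))"
        by (simp add: conv_def ac_simps)
      then show ?thesis by (simp add: conv_def)
    qed
    finally show ?thesis by (simp add: g_def r_def algebra_simps)
  qed
  have "integral {0..1} (\<lambda>x. exp (c * x) * z x * g x) =
    integral {0..1} (\<lambda>x. u 0 * (exp (c * x) * z x * (bt x - conv k bt x)) + exp (c * x) * z x * (r x - conv k r x))"
    by (intro integral_cong) (simp add: g_eq algebra_simps)
  also have "\<dots> = integral {0..1} (\<lambda>x. u 0 * (exp (c * x) * z x * (bt x - conv k bt x))) +
      integral {0..1} (\<lambda>x. exp (c * x) * z x * (r x - conv k r x))"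
    by (intro integral_add integrable_continuous_interval continuous_intros cont_all cr)
  also have "integral {0..1} (\<lambda>x. u 0 * (exp (c * x) * z x * (bt x - conv k bt x))) = u 0 * Sz"
    by (simp add: Sz_def)
  finally have "\<bar>integral {0..1} (\<lambda>x. exp (c * x) * z x * g x) - u 0 * Sz\<bar> =
    \<bar>integral {0..1} (\<lambda>x. exp (c * x) * z x * (r x - conv k r x))\<bar>" by simp
  also have "\<dots> \<le> exp c * (A * ?G) * Z"
    unfolding Z_def using c r_k_le
    by (intro abs_weighted_integral_le) (auto intro!: continuous_intros cont_all cr)
  also have "\<dots> = A\<^sup>2 * (6 * (exp c)\<^sup>2 * \<gamma> * \<bar>u 0\<bar> * Z)" by (simp add: power2_eq_square ac_simps)
  also have "\<dots> \<le> A ^ 3 * (6 * (exp c)\<^sup>2 * \<gamma> * \<bar>u 0\<bar> * Z)"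
    using A1 \<gamma> Z_nonneg by (intro mult_right_mono power_increasing) auto
  finally show ?thesis by (simp add: ac_simps)
qed

text \<open>The first summand is the derivative of ln (1 + \<open>N\<close>) along the target
  equation, the second that of the squared estimation error over \<open>\<gamma>\<close>. Multiplied
  by 1 + \<open>N\<close>, the two estimation error terms cancel up to the mismatch, and what
  remains are multiples of \<bar>u(0)\<bar> Z, to be absorbed by the two negative terms.\<close>

lemma decay:
  "(- c * N - (u 0)\<^sup>2 + exp c * (z 1)\<^sup>2 + 2 * integral {0..1} (\<lambda>x. exp (c * x) * z x * g x)) / (1 + N)
     - 2 / \<gamma> * integral {0..1} (\<lambda>x. bt x * v x) \<le> - (u 0)\<^sup>2 / (2 * (1 + N))"
proof -
  define m where "m = min 1 c"
  have m: "0 \<le> m" "m \<le> 1" "m \<le> c" using c by (auto simp: m_def)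
  let ?a = "\<bar>u 0\<bar>" and ?F = "(exp c)\<^sup>2 * A ^ 3"
  define IG where "IG = integral {0..1} (\<lambda>x. exp (c * x) * z x * g x)"
  define IV where "IV = integral {0..1} (\<lambda>x. bt x * v x)"
  \<comment> \<open>Projecting can only increase the pairing with the estimation error, and it
    enters with a negative sign.\<close>
  have "integral {0..1} (\<lambda>x. bt x * \<tau> x) \<le> IV"
    unfolding IV_def using v_proj
    by (intro integral_mono_interval continuous_intros cont_all cont_\<tau>) (simp add: right_diff_distrib)
  then have "\<gamma> * (u 0 * Sw / (1 + Nw)) \<le> IV" using bt_\<tau>_integral by simp
  then have IV: "- (2 / \<gamma> * IV) \<le> - 2 * (u 0 * Sw / (1 + Nw))"
  proof -
    have "2 / \<gamma> * (\<gamma> * (u 0 * Sw / (1 + Nw))) \<le> 2 / \<gamma> * IV"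
      using \<open>\<gamma> * (u 0 * Sw / (1 + Nw)) \<le> IV\<close> \<gamma> by (intro mult_left_mono) auto
    then show ?thesis using \<gamma> by simp
  qed
  have N1: "1 + N > 0" using N_nonneg by simp
  have \<epsilon>F: "128 * (?F * \<epsilon>) \<le> m" and \<gamma>F: "128 * (?F * \<gamma>) \<le> m"
    unfolding m_def using A1 by (intro scaled_le; simp)+
  then have \<epsilon>F': "?F * \<epsilon> \<le> m / 128" and \<gamma>F': "?F * \<gamma> \<le> m / 128" by linarith+
  have "u 0 * (Sz / (1 + N) - Sw / (1 + Nw)) * (1 + N) \<le> ?a * ((1 + N) * \<bar>Sz / (1 + N) - Sw / (1 + Nw)\<bar>)"
  proof -
    have "u 0 * (Sz / (1 + N) - Sw / (1 + Nw)) \<le> ?a * \<bar>Sz / (1 + N) - Sw / (1 + Nw)\<bar>"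
      using abs_ge_self[of "u 0 * (Sz / (1 + N) - Sw / (1 + Nw))"] by (simp only: abs_mult)
    then have "u 0 * (Sz / (1 + N) - Sw / (1 + Nw)) * (1 + N) \<le> ?a * \<bar>Sz / (1 + N) - Sw / (1 + Nw)\<bar> * (1 + N)"
      using N1 by (intro mult_right_mono) auto
    then show ?thesis by (simp only: ac_simps)
  qed
  also have "\<dots> \<le> ?a * (28 * (exp c)\<^sup>2 * A ^ 3 * \<epsilon> * Z)"
    using mismatch_le by (intro mult_left_mono) auto
  also have "\<dots> = 28 * (?F * \<epsilon>) * (?a * Z)" by simp
  also have "\<dots> \<le> 28 * (m / 128) * (?a * Z)"
    using Z_nonneg by (intro mult_right_mono mult_left_mono \<epsilon>F') auto
  finally have 1: "(u 0 * (Sz / (1 + N)) - u 0 * (Sw / (1 + Nw))) * (1 + N) \<le> 28 / 128 * (m * (?a * Z))"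
    by (simp add: right_diff_distrib)
  have "IG - u 0 * Sz \<le> 6 * (?F * \<gamma>) * (?a * Z)"
    using zg_integral_le unfolding IG_def by (simp add: ac_simps)
  also have "\<dots> \<le> 6 * (m / 128) * (?a * Z)"
    using Z_nonneg by (intro mult_right_mono mult_left_mono \<gamma>F') auto
  finally have 2: "IG - u 0 * Sz \<le> 6 / 128 * (m * (?a * Z))" by simp
  have "exp c * (z 1)\<^sup>2 \<le> exp c * (A * \<epsilon> * Z)\<^sup>2"
  proof -
    have "\<bar>z 1\<bar> \<le> A * \<epsilon> * Z"
      using z1_le \<eta>(2) Z_nonneg by (meson mult_right_mono order_trans)
    then have "\<bar>z 1\<bar>\<^sup>2 \<le> (A * \<epsilon> * Z)\<^sup>2" by (intro power_mono) auto
    then show ?thesis by simp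
  qed
  also have "\<dots> = (exp c * A * \<epsilon>) * (A * \<epsilon>) * Z\<^sup>2" by (simp add: power2_eq_square)
  also have "\<dots> \<le> (m / 128) * (m / 128) * Z\<^sup>2"
  proof (intro mult_right_mono mult_mono)
    show "exp c * A * \<epsilon> \<le> m / 128" using scaled_le[of "exp c * A" \<epsilon>, folded m_def] EA_le(2) A1 by simp
    show "A * \<epsilon> \<le> m / 128" using scaled_le[of A \<epsilon>, folded m_def] EA_le(1) A1 by simp
  qed (use m A1 \<epsilon> in auto)
  also have "\<dots> \<le> m * m * Z\<^sup>2 / 128"
  proof -
    have "0 \<le> m * m * Z\<^sup>2" by (intro mult_nonneg_nonneg) (use m in auto)
    moreover have "m / 128 * (m / 128) * Z\<^sup>2 = m * m * Z\<^sup>2 / 16384" by simp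
    ultimately show ?thesis by linarith
  qed
  finally have 3: "exp c * (z 1)\<^sup>2 \<le> m * m * Z\<^sup>2 / 128" .
  \<comment> \<open>The mixed product is shared between the two available negative terms, u(0)^2 and
    c \<open>N\<close>.\<close>
  have "2 * (?a * (m * Z)) \<le> ?a\<^sup>2 + (m * Z)\<^sup>2"
    using sum_squares_bound[of ?a "m * Z"] by simp
  then have 4: "m * (?a * Z) \<le> (u 0)\<^sup>2 / 2 + m * m * Z\<^sup>2 / 2"
    by (simp add: power2_eq_square ac_simps)
  have 5: "m * m * Z\<^sup>2 \<le> c * N"
  proof -
    \<comment> \<open>Here \<open>m\<close> is needed below both 1 and c: one factor is spent on
      each.\<close>
    have "m * m * Z\<^sup>2 \<le> 1 * c * N" using m c Z_sq_le(2) by (intro mult_mono) auto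
    then show ?thesis by simp
  qed
  define q where "q = m * (?a * Z)"
  define d where "d = (u 0 * (Sz / (1 + N)) - u 0 * (Sw / (1 + Nw))) * (1 + N)"
  have "(1 + N) * ((- c * N - (u 0)\<^sup>2 + exp c * (z 1)\<^sup>2 + 2 * IG) / (1 + N) - 2 / \<gamma> * IV)
     \<le> (1 + N) * ((- c * N - (u 0)\<^sup>2 + exp c * (z 1)\<^sup>2 + 2 * IG) / (1 + N) - 2 * (u 0 * Sw / (1 + Nw)))"
    using IV N1 by (intro mult_left_mono) auto
  also have "\<dots> = - c * N - (u 0)\<^sup>2 + exp c * (z 1)\<^sup>2 + 2 * (IG - u 0 * Sz)
      + 2 * d"
  proof -
    define s where "s = u 0 * (Sw / (1 + Nw))"
    have s: "u 0 * Sw / (1 + Nw) = s" by (simp add: s_def)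
    have "u 0 * (Sz / (1 + N)) * (1 + N) = u 0 * Sz" using N1 by simp
    moreover have "(1 + N) * (X / (1 + N) - 2 * s) = X - 2 * s * (1 + N)" for X
      using N1 by (simp add: right_diff_distrib)
    ultimately show ?thesis
      unfolding s d_def s_def[symmetric] left_diff_distrib by simp
  qed
  also have "\<dots> \<le> - c * N - (u 0)\<^sup>2 + m * m * Z\<^sup>2 / 128 + 2 * (6 / 128 * q) + 2 * (28 / 128 * q)"
    by (intro add_mono mult_left_mono order_refl 3 1[folded q_def d_def] 2[folded q_def]) simp_all
  also have "\<dots> \<le> - (u 0)\<^sup>2 / 2"
  proof -
    \<comment> \<open>The multiples of q add up to 68/128, so the bound on q uses 34/128 of x and of
      y; together with y/128 the latter stays below n, and - x / 2 is left.\<close>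
    have *: "- n - x + y / 128 + 2 * (6 / 128 * q) + 2 * (28 / 128 * q) \<le> - x / 2"
      if "q \<le> x / 2 + y / 2" "y \<le> n" "0 \<le> x" "0 \<le> n" for n x y :: real
      using that by linarith
    have "0 \<le> c * N" using c N_nonneg by simp
    from *[OF 4[folded q_def] 5 zero_le_power2 this] show ?thesis by (simp only: mult_minus_left)
  qed
  finally have fin: "(1 + N) * ((- c * N - (u 0)\<^sup>2 + exp c * (z 1)\<^sup>2 + 2 * IG) / (1 + N) - 2 / \<gamma> * IV)
      \<le> - (u 0)\<^sup>2 / 2" .
  have *: "Y \<le> b / (1 + N)" if "(1 + N) * Y \<le> b" for Y b
    using that N1 by (simp add: pos_le_divide_eq mult.commute)
  from *[OF fin] show ?thesis by (simp add: IG_def IV_def)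
qed

end

end

section \<open>Difference quotients of the Lyapunov function\<close>

text \<open>The discrete form of the rule (a * f)' = a f(0) + a * f': the convolution over the short
  interval plays the part of the boundary term.\<close>

lemma conv_shift:
  fixes a f :: "real \<Rightarrow> real"
  assumes a: "continuous_on {0..1} a" and f: "continuous_on {0..1} f"
    and x: "0 \<le> x" and h: "0 \<le> h" and xh: "x + h \<le> 1"
  shows "conv a f (x + h) = conv (\<lambda>y. a (x + y)) f h + conv a (\<lambda>y. f (y + h)) x"
proof -
  have "(\<lambda>y. a (x + h - y) * f y) integrable_on {0..x + h}"
    using conv_integrable[OF a f, of "x + h"] x h xh by auto
  then have "conv a f (x + h) = integral {0..h} (\<lambda>y. a (x + h - y) * f y) + integral {h..x + h} (\<lambda>y. a (x + h - y) * f y)"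
    unfolding conv_def using Henstock_Kurzweil_Integration.integral_combine[of 0 h "x + h" "\<lambda>y. a (x + h - y) * f y"] x h by simp
  also have "integral {h..x + h} (\<lambda>y. a (x + h - y) * f y) = conv a (\<lambda>y. f (y + h)) x"
    using integral_shift_Icc_real[of 0 x "\<lambda>y. a (x + h - y) * f y" h]
    by (simp add: conv_def o_def algebra_simps)
  finally show ?thesis by (simp add: conv_def algebra_simps)
qed

text \<open>Identifies the boundary term of a shifted convolution to first order in h, with a
  remainder of order h^2 that survives division by h.\<close>

lemma conv_short:
  fixes a f :: "real \<Rightarrow> real"
  assumes a: "continuous_on {0..h} a" and f: "continuous_on {0..h} f" and h: "h \<ge> 0"
    and a_le: "\<And>y. y \<in> {0..h} \<Longrightarrow> \<bar>a y\<bar> \<le> P" "\<And>y. y \<in> {0..h} \<Longrightarrow> \<bar>a y - a 0\<bar> \<le> L1 * y"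
    and f_le: "\<And>y. y \<in> {0..h} \<Longrightarrow> \<bar>f y\<bar> \<le> Q" "\<And>y. y \<in> {0..h} \<Longrightarrow> \<bar>f y - f 0\<bar> \<le> L2 * y"
    and L: "L1 \<ge> 0" "L2 \<ge> 0"
  shows "\<bar>conv a f h - h * (a 0 * f 0)\<bar> \<le> h * (h * (L1 * Q + P * L2))"
proof -
  have P: "P \<ge> 0" and Q: "Q \<ge> 0" using a_le(1)[of 0] f_le(1)[of 0] h by auto
  have c: "continuous_on {0..h} (\<lambda>y. a (h - y) * f y)"
    by (rule continuous_on_conv_integrand[OF a f]) (use h in auto)
  have "conv a f h - h * (a 0 * f 0) = integral {0..h} (\<lambda>y. a (h - y) * f y - a 0 * f 0)"
    using integral_diff[OF integrable_continuous_interval[OF c] integrable_const_ivl, of "a 0 * f 0"] h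
    by (simp add: conv_def)
  also have "\<bar>\<dots>\<bar> \<le> integral {0..h} (\<lambda>y. h * (L1 * Q + P * L2))"
  proof (rule abs_integral_le)
    fix y assume y: "y \<in> {0..h}"
    have "a (h - y) * f y - a 0 * f 0 = (a (h - y) - a 0) * f y + a 0 * (f y - f 0)"
      by (simp add: algebra_simps)
    also have "\<bar>\<dots>\<bar> \<le> \<bar>a (h - y) - a 0\<bar> * \<bar>f y\<bar> + \<bar>a 0\<bar> * \<bar>f y - f 0\<bar>"
      using abs_triangle_ineq[of "(a (h - y) - a 0) * f y" "a 0 * (f y - f 0)"] by (simp add: abs_mult)
    also have "\<dots> \<le> (L1 * h) * Q + P * (L2 * h)"
    proof (intro add_mono mult_mono)
      have "L1 * (h - y) \<le> L1 * h" "L2 * y \<le> L2 * h" using y L by (auto intro: mult_left_mono)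
      then show "\<bar>a (h - y) - a 0\<bar> \<le> L1 * h" "\<bar>f y - f 0\<bar> \<le> L2 * h"
        using a_le(2)[of "h - y"] f_le(2)[OF y] y by auto
    qed (use a_le(1)[of 0] f_le(1)[OF y] h L P Q in auto)
    finally show "\<bar>a (h - y) * f y - a 0 * f 0\<bar> \<le> h * (L1 * Q + P * L2)" by (simp add: algebra_simps)
  qed (intro continuous_intros c)+
  also have "\<dots> = h * (h * (L1 * Q + P * L2))" using h by simp
  finally show ?thesis .
qed

text \<open>The L1 norm is put on the left factor. This is the form needed for the difference
  quotients of the estimate, whose convergence is available in L1.\<close>

lemma abs_conv_le_integral_left:
  fixes a f :: "real \<Rightarrow> real"
  assumes x: "x \<in> {0..1}" and a: "continuous_on {0..1} a" and f: "continuous_on {0..1} f"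
    and le: "\<And>y. y \<in> {0..1} \<Longrightarrow> \<bar>f y\<bar> \<le> F" and F: "F \<ge> 0"
  shows "\<bar>conv a f x\<bar> \<le> F * integral {0..1} (\<lambda>y. \<bar>a y\<bar>)"
proof -
  have "\<bar>conv f a x\<bar> \<le> F * integral {0..x} (\<lambda>y. \<bar>a y\<bar>)"
    by (rule abs_conv_le_integral[OF x f a le])
  also have "\<dots> \<le> F * integral {0..1} (\<lambda>y. \<bar>a y\<bar>)"
    using F x by (intro mult_left_mono integral_initial_le continuous_intros a) auto
  finally show ?thesis by (simp add: conv_commute)
qed

lemma average_left_tendsto:
  fixes G :: "real \<Rightarrow> real"
  assumes G: "continuous_on {0..1} G"
  shows "(\<lambda>n. integral {0..step n} G / step n) \<longlonglongrightarrow> G 0"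
proof -
  have "((\<lambda>x. integral {0..x} G) has_real_derivative G 0) (at 0 within {0..1})"
    by (rule integral_has_real_derivative[OF G]) simp
  then have "((\<lambda>x. integral {0..x} G / x) \<longlongrightarrow> G 0) (at 0 within {0..1})"
    by (simp add: has_field_derivative_iff)
  then have "((\<lambda>x. integral {0..x} G / x) \<circ> step) \<longlonglongrightarrow> G 0"
    unfolding tendsto_at_iff_sequentially
    using step_pos step_le_1 step_tendsto_0 by (auto simp: less_imp_le less_imp_neq[symmetric])
  then show ?thesis by (simp add: o_def)
qed

lemma average_right_tendsto:
  fixes G :: "real \<Rightarrow> real"
  assumes G: "continuous_on {0..1} G"
  shows "(\<lambda>n. integral {1 - step n..1} G / step n) \<longlonglongrightarrow> G 1"
proof -
  have "continuous_on {0..1} (\<lambda>x. G (1 - x))"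
    by (intro continuous_on_compose2[OF G] continuous_intros) auto
  from average_left_tendsto[OF this]
  have "(\<lambda>n. integral {0..step n} (\<lambda>x. G (1 - x)) / step n) \<longlonglongrightarrow> G 1" by simp
  moreover have "integral {0..h} (\<lambda>x. G (1 - x)) = integral {1 - h..1} G" for h
    using integral_flip[of h "\<lambda>x. G (1 - h + x)"] integral_shift_Icc_real[of 0 h G "1 - h"]
    by (simp add: o_def)
  ultimately show ?thesis by simp
qed

text \<open>Difference quotients at a fixed time along \<open>step\<close>: the quantities without index are
  taken at that time, those with index \<open>n\<close> at the time increased by \<open>step n\<close>, and \<open>a r\<close> is the
  boundary value at the time increased by \<open>r\<close>. The quotient of the target state is
  taken along the characteristic through \<open>(x + step n, t)\<close>, on which it needs no
  differentiability of \<open>u\<close>.\<close>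

locale quotient_limit =
  fixes B c L\<beta> L\<phi> La Lu Lz Am Zm C\<phi> :: real and \<beta> \<phi> k a u z v :: "real \<Rightarrow> real"
    and \<phi>n un zn :: "nat \<Rightarrow> real \<Rightarrow> real"
  assumes B: "B > 0" and c: "c > 0" and nonneg: "0 \<le> L\<beta>" "0 \<le> L\<phi>" "0 \<le> La" "0 \<le> Lu" "0 \<le> Lz"
    and cont: "continuous_on {0..1} \<beta>" "continuous_on {0..1} \<phi>" "continuous_on {0..1} k" "continuous_on {0..1} a"
      "continuous_on {0..1} u" "continuous_on {0..1} z" "continuous_on {0..1} v"
    and cont_n: "\<And>n. continuous_on {0..1} (\<phi>n n)" "\<And>n. continuous_on {0..1} (zn n)"
    and \<phi>_le: "\<And>x. x \<in> {0..1} \<Longrightarrow> \<bar>\<phi> x\<bar> \<le> B" and \<beta>_le: "\<And>x. x \<in> {0..1} \<Longrightarrow> \<bar>\<beta> x\<bar> \<le> B"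
    and a_le: "\<And>x. x \<in> {0..1} \<Longrightarrow> \<bar>a x\<bar> \<le> Am" "\<And>x. x \<in> {0..1} \<Longrightarrow> \<bar>a x - a 0\<bar> \<le> La * x"
    and \<beta>_lip: "L\<beta>-lipschitz_on {0..1} \<beta>" and \<phi>_lip: "L\<phi>-lipschitz_on {0..1} \<phi>"
    and u_le: "\<And>x. x \<in> {0..1} \<Longrightarrow> \<bar>u x - u 0\<bar> \<le> Lu * x" and u0: "u 0 = a 0"
    and z_le: "\<And>x. x \<in> {0..1} \<Longrightarrow> \<bar>z x\<bar> \<le> Zm" and zn_le: "\<And>n x. x \<in> {0..1} \<Longrightarrow> \<bar>zn n x\<bar> \<le> Zm"
    and zn_z: "\<And>n x. x \<in> {0..1} \<Longrightarrow> \<bar>zn n x - z x\<bar> \<le> Lz * step n"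
    and kernel: "\<And>x. x \<in> {0..1} \<Longrightarrow> k x = - \<phi> x + conv \<phi> k x"
    and z_eq: "\<And>x. x \<in> {0..1} \<Longrightarrow> z x = u x + conv \<phi> z x"
    and zn_eq: "\<And>n x. x \<in> {0..1} \<Longrightarrow> zn n x = un n x + conv (\<phi>n n) (zn n) x"
    and char: "\<And>n x. 0 \<le> x \<Longrightarrow> x + step n \<le> 1 \<Longrightarrow>
        un n x = u (x + step n) + conv (\<lambda>y. \<beta> (x + y)) a (step n)"
    and v_le: "\<And>x. x \<in> {0..1} \<Longrightarrow> \<bar>v x\<bar> \<le> C\<phi>"
    and \<phi>n_le: "\<And>n x. x \<in> {0..1} \<Longrightarrow> \<bar>(\<phi>n n x - \<phi> x) / step n\<bar> \<le> C\<phi>"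
    and \<phi>n_lim: "\<And>x. x \<in> {0..1} \<Longrightarrow> (\<lambda>n. (\<phi>n n x - \<phi> x) / step n) \<longlonglongrightarrow> v x"
begin

definition f where "f x = u 0 * (\<beta> x - \<phi> x) + conv v z x"
definition g where "g x = f x - conv k f x"
definition D where "D n x = zn n x - z (x + step n)"
text \<open>The difference quotients of the estimate converge pointwise in x with a uniform bound,
  hence in the mean over x. Mean convergence is enough, as they enter the equation for
  \<open>z\<close> through a convolution.\<close>

definition \<delta> where "\<delta> n = integral {0..1} (\<lambda>x. \<bar>(\<phi>n n x - \<phi> x) / step n - v x\<bar>)"

lemma cont_f: "continuous_on {0..1} f" unfolding f_def by (intro continuous_intros cont)
lemma cont_g: "continuous_on {0..1} g" unfolding g_def by (intro continuous_intros cont cont_f)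

lemma g_eq: "x \<in> {0..1} \<Longrightarrow> g x = f x + conv \<phi> g x"
  using volterra_solution[OF cont(2,3) kernel cont_f] by (simp add: g_def[abs_def])

lemma \<delta>_tendsto: "\<delta> \<longlonglongrightarrow> 0"
proof -
  have "(\<lambda>n. integral {0..1} (\<lambda>x. \<bar>(\<phi>n n x - \<phi> x) / step n - v x\<bar>)) \<longlonglongrightarrow> integral {0..1} (\<lambda>x::real. 0)"
  proof (rule dominated_convergence(2))
    show "(\<lambda>x. \<bar>(\<phi>n n x - \<phi> x) / step n - v x\<bar>) integrable_on {0..1}" for n
      using step_pos[of n] by (intro integrable_continuous_interval continuous_intros cont cont_n) auto
    show "(\<lambda>x::real. 2 * C\<phi>) integrable_on {0..1}" by (rule integrable_const_ivl)
    show "norm \<bar>(\<phi>n n x - \<phi> x) / step n - v x\<bar> \<le> 2 * C\<phi>" if "x \<in> {0..1}" for n x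
      using \<phi>n_le[OF that, of n] v_le[OF that] unfolding real_norm_def abs_abs by linarith
    show "(\<lambda>n. \<bar>(\<phi>n n x - \<phi> x) / step n - v x\<bar>) \<longlonglongrightarrow> 0" if "x \<in> {0..1}" for x
      using \<phi>n_lim[OF that] by (intro tendsto_rabs_zero) (simp add: LIM_zero_iff)
  qed
  then show ?thesis by (simp add: \<delta>_def[abs_def])
qed

lemma \<delta>_nonneg: "\<delta> n \<ge> 0"
  unfolding \<delta>_def using step_pos[of n]
  by (intro integral_nonneg integrable_continuous_interval continuous_intros cont cont_n) auto

lemma z0: "z 0 = u 0" using z_eq[of 0] by (simp add: conv_def)

lemma z_initial_le: "x \<in> {0..1} \<Longrightarrow> \<bar>z x - z 0\<bar> \<le> (Lu + B * Zm) * x"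
  using z_eq[of x] u_le[of x] abs_conv_le[OF _ cont(2,6) \<phi>_le z_le, of x] z0
  by (simp add: distrib_right)

lemma nonneg': "0 \<le> Zm" "0 \<le> Am" "0 \<le> C\<phi>"
  using z_le[of 0] a_le(1)[of 0] v_le[of 0] by (auto intro: order_trans[OF abs_ge_zero])

text \<open>In this order: the boundary terms with \<open>\<beta>\<close> and with
  \<open>\<phi>\<close>, the factor of the error \<open>\<delta>\<close>, and the replacement of
  \<open>zn\<close> by \<open>z\<close> in the convolution with \<open>v\<close>.\<close>

definition C where
  "C = L\<beta> * Am + B * La + (L\<phi> * Zm + B * (Lu + B * Zm)) + Zm + C\<phi> * Lz"

lemma C_nonneg: "0 \<le> C"
  unfolding C_def using nonneg nonneg' B by (intro add_nonneg_nonneg mult_nonneg_nonneg) auto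

text \<open>Subtracting the Volterra equation of \<open>z\<close> at x + h from that of
  \<open>zn\<close> at x eliminates \<open>u\<close> by the characteristic identity. Compared with h
  times the equation for \<open>g\<close>, the difference solves a Volterra equation with kernel
  \<open>\<phi>\<close> and a source of size h times a null sequence, so the Volterra bound gives
  convergence uniformly in x.\<close>

lemma D_close:
  assumes x: "x \<in> {0..1 - step n}"
  shows "\<bar>D n x / step n - g x\<bar> \<le> 2 * (C * (step n + \<delta> n)) * exp (2 * B)"
proof -
  define h where "h = step n"
  have h: "0 < h" "h \<le> 1" using step_pos step_le_1 by (auto simp: h_def)
  let ?b = "1 - h"
  have sub: "continuous_on {0..?b} q" if "continuous_on {0..1} q" for q :: "real \<Rightarrow> real"
    using that by (rule continuous_on_subset) (use h in auto)
  note cs = cont[THEN sub] cont_n[THEN sub]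
  have czh: "continuous_on {0..?b} (\<lambda>y. z (y + h))"
    by (intro continuous_on_compose2[OF cont(6)] continuous_intros) (use h in auto)
  have cD: "continuous_on {0..?b} (D n)"
    unfolding D_def h_def[symmetric] by (intro continuous_intros czh cs)
  \<comment> \<open>The four defects of the first order expansion. The leading terms of the first
    two differ by h u(0) (\<beta> - \<phi>), since z(0) = u(0) = a(0), which is the first part of h
    \<open>f\<close>.\<close>
  define e where "e = (\<lambda>x. (conv (\<lambda>y. \<beta> (x + y)) a h - h * (\<beta> x * a 0)) -
     (conv (\<lambda>y. \<phi> (x + y)) z h - h * (\<phi> x * z 0)) +
     conv (\<lambda>y. \<phi>n n y - \<phi> y - h * v y) (zn n) x + h * conv v (\<lambda>y. zn n y - z y) x)"
  have eq: "D n y - h * g y = e y + conv \<phi> (\<lambda>y. D n y - h * g y) y" if y: "y \<in> {0..?b}" for y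
  proof -
    have y1: "y \<in> {0..1}" "0 \<le> y" "y + h \<le> 1" "y + h \<in> {0..1}" using y h by auto
    have "D n y = un n y + conv (\<phi>n n) (zn n) y - (u (y + h) + conv \<phi> z (y + h))"
      using zn_eq[OF y1(1)] z_eq[OF y1(4)] by (simp add: D_def h_def)
    also have "un n y = u (y + h) + conv (\<lambda>r. \<beta> (y + r)) a h"
      using char[of y n] y1 by (simp add: h_def)
    also have "conv \<phi> z (y + h) = conv (\<lambda>r. \<phi> (y + r)) z h + conv \<phi> (\<lambda>r. z (r + h)) y"
      using y1 h by (intro conv_shift cont) auto
    finally have 1: "D n y = conv (\<lambda>r. \<beta> (y + r)) a h - conv (\<lambda>r. \<phi> (y + r)) z h +
       conv (\<phi>n n) (zn n) y - conv \<phi> (\<lambda>r. z (r + h)) y" by simp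
    have 2: "conv \<phi> (\<lambda>y. D n y - h * g y) y = conv \<phi> (D n) y - h * conv \<phi> g y"
    proof -
      have "conv \<phi> (\<lambda>y. D n y - h * g y) y = conv \<phi> (D n) y - conv \<phi> (\<lambda>y. h * g y) y"
        by (intro conv_diff_right[OF y] continuous_intros cs cD sub cont_g)
      moreover have "conv \<phi> (\<lambda>y. h * g y) y = h * conv \<phi> g y"
        unfolding conv_def integral_mult_right[symmetric] by (simp only: ac_simps)
      ultimately show ?thesis by simp
    qed
    have 3: "conv \<phi> (D n) y = conv \<phi> (zn n) y - conv \<phi> (\<lambda>r. z (r + h)) y"
      unfolding D_def h_def[symmetric] by (rule conv_diff_right[OF y]) (intro cs czh)+
    have 4: "conv (\<lambda>y. \<phi>n n y - \<phi> y - h * v y) (zn n) y =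
        conv (\<phi>n n) (zn n) y - conv \<phi> (zn n) y - h * conv v (zn n) y"
    proof -
      have "conv (\<lambda>y. \<phi>n n y - \<phi> y - h * v y) (zn n) y =
          conv (\<lambda>y. \<phi>n n y - \<phi> y) (zn n) y - conv (\<lambda>y. h * v y) (zn n) y"
        by (intro conv_diff_left[OF y1(1)] continuous_intros cont cont_n)
      also have "conv (\<lambda>y. \<phi>n n y - \<phi> y) (zn n) y = conv (\<phi>n n) (zn n) y - conv \<phi> (zn n) y"
        by (intro conv_diff_left[OF y1(1)] continuous_intros cont cont_n)
      also have "conv (\<lambda>y. h * v y) (zn n) y = h * conv v (zn n) y"
        unfolding conv_def integral_mult_right[symmetric] by (simp only: ac_simps)
      finally show ?thesis .
    qed
    have 5: "conv v (\<lambda>y. zn n y - z y) y = conv v (zn n) y - conv v z y"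
      by (intro conv_diff_right[OF y1(1)] cont cont_n)
    have 6: "h * g y = h * (u 0 * (\<beta> y - \<phi> y)) + h * conv v z y + h * conv \<phi> g y"
      using g_eq[OF y1(1)] by (simp add: f_def distrib_left)
    have 7: "h * (\<beta> y * a 0) - h * (\<phi> y * z 0) = h * (u 0 * (\<beta> y - \<phi> y))"
      using z0 u0 by (simp add: algebra_simps)
    have 8: "h * conv v (\<lambda>y. zn n y - z y) y = h * conv v (zn n) y - h * conv v z y"
      by (simp add: 5 right_diff_distrib)
    show ?thesis unfolding e_def 2 3 4 8 using 1 6 7 by linarith
  qed
  have e_le: "\<bar>e y\<bar> \<le> h * (C * (h + \<delta> n))" if y: "y \<in> {0..?b}" for y
  proof -
    have y1: "y \<in> {0..1}" "0 \<le> y" "y + h \<le> 1" using y h by auto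
    have "\<bar>conv (\<lambda>r. \<beta> (y + r)) a h - h * (\<beta> (y + 0) * a 0)\<bar> \<le> h * (h * (L\<beta> * Am + B * La))"
    proof (rule conv_short)
      show "continuous_on {0..h} (\<lambda>r. \<beta> (y + r))"
        by (intro continuous_on_compose2[OF cont(1)] continuous_intros) (use y1 in auto)
      show "continuous_on {0..h} a" using cont(4) by (rule continuous_on_subset) (use h in auto)
      show "\<bar>\<beta> (y + r) - \<beta> (y + 0)\<bar> \<le> L\<beta> * r" if "r \<in> {0..h}" for r
        using lipschitz_onD[OF \<beta>_lip, of "y + r" y] that y1 by (simp add: dist_real_def)
      show "\<bar>\<beta> (y + r)\<bar> \<le> B" "\<bar>a r\<bar> \<le> Am" "\<bar>a r - a 0\<bar> \<le> La * r" if "r \<in> {0..h}" for r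
        using that y1 h by (auto intro!: \<beta>_le a_le)
    qed (rule less_imp_le[OF h(1)] nonneg)+
    then have 1: "\<bar>conv (\<lambda>r. \<beta> (y + r)) a h - h * (\<beta> y * a 0)\<bar> \<le> h * (h * (L\<beta> * Am + B * La))" by simp
    have "\<bar>conv (\<lambda>r. \<phi> (y + r)) z h - h * (\<phi> (y + 0) * z 0)\<bar> \<le> h * (h * (L\<phi> * Zm + B * (Lu + B * Zm)))"
    proof (rule conv_short)
      show "continuous_on {0..h} (\<lambda>r. \<phi> (y + r))"
        by (intro continuous_on_compose2[OF cont(2)] continuous_intros) (use y1 in auto)
      show "continuous_on {0..h} z" using cont(6) by (rule continuous_on_subset) (use h in auto)
      show "\<bar>\<phi> (y + r) - \<phi> (y + 0)\<bar> \<le> L\<phi> * r" if "r \<in> {0..h}" for r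
        using lipschitz_onD[OF \<phi>_lip, of "y + r" y] that y1 by (simp add: dist_real_def)
      show "\<bar>z r - z 0\<bar> \<le> (Lu + B * Zm) * r" if "r \<in> {0..h}" for r
        using z_initial_le[of r] that h by auto
      show "\<bar>\<phi> (y + r)\<bar> \<le> B" "\<bar>z r\<bar> \<le> Zm" if "r \<in> {0..h}" for r
        using that y1 h by (auto intro!: \<phi>_le z_le)
      show "0 \<le> Lu + B * Zm"
        by (intro add_nonneg_nonneg mult_nonneg_nonneg nonneg nonneg' less_imp_le[OF B])
    qed (rule less_imp_le[OF h(1)] nonneg)+
    then have 2: "\<bar>conv (\<lambda>r. \<phi> (y + r)) z h - h * (\<phi> y * z 0)\<bar> \<le> h * (h * (L\<phi> * Zm + B * (Lu + B * Zm)))" by simp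
    have "\<bar>conv (\<lambda>y. \<phi>n n y - \<phi> y - h * v y) (zn n) y\<bar> \<le> Zm * integral {0..1} (\<lambda>y. \<bar>\<phi>n n y - \<phi> y - h * v y\<bar>)"
      using nonneg' zn_le by (intro abs_conv_le_integral_left[OF y1(1)] continuous_intros cont cont_n) auto
    also have "integral {0..1} (\<lambda>y. \<bar>\<phi>n n y - \<phi> y - h * v y\<bar>) = integral {0..1} (\<lambda>y. h * \<bar>(\<phi>n n y - \<phi> y) / h - v y\<bar>)"
    proof (rule integral_cong)
      fix y
      have "h * ((\<phi>n n y - \<phi> y) / h) = \<phi>n n y - \<phi> y" using h by simp
      then have "\<phi>n n y - \<phi> y - h * v y = h * ((\<phi>n n y - \<phi> y) / h - v y)"
        by (simp only: right_diff_distrib)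
      then show "\<bar>\<phi>n n y - \<phi> y - h * v y\<bar> = h * \<bar>(\<phi>n n y - \<phi> y) / h - v y\<bar>" using h by (simp add: abs_mult)
    qed
    also have "\<dots> = h * \<delta> n" by (simp add: \<delta>_def h_def)
    finally have 3: "\<bar>conv (\<lambda>y. \<phi>n n y - \<phi> y - h * v y) (zn n) y\<bar> \<le> h * (\<delta> n * Zm)" by (simp only: ac_simps)
    have "\<bar>conv v (\<lambda>y. zn n y - z y) y\<bar> \<le> C\<phi> * (Lz * h) * y"
      using v_le zn_z by (intro abs_conv_le[OF y1(1)] continuous_intros cont cont_n) (auto simp: h_def)
    also have "\<dots> \<le> C\<phi> * (Lz * h)"
    proof (rule mult_left_le)
      show "0 \<le> C\<phi> * (Lz * h)" by (intro mult_nonneg_nonneg nonneg nonneg' less_imp_le[OF h(1)])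
    qed (use y1 in simp)
    finally have 4: "\<bar>h * conv v (\<lambda>y. zn n y - z y) y\<bar> \<le> h * (C\<phi> * (Lz * h))"
      using h by (simp add: abs_mult)
    have tri: "\<bar>p - q + r + s\<bar> \<le> P + Q + R + S"
      if "\<bar>p\<bar> \<le> P" "\<bar>q\<bar> \<le> Q" "\<bar>r\<bar> \<le> R" "\<bar>s\<bar> \<le> S" for p q r s P Q R S :: real
      using that unfolding abs_le_iff by linarith
    have "\<bar>e y\<bar> \<le> h * (h * (L\<beta> * Am + B * La)) + h * (h * (L\<phi> * Zm + B * (Lu + B * Zm))) +
       h * (\<delta> n * Zm) + h * (C\<phi> * (Lz * h))"
      unfolding e_def by (rule tri[OF 1 2 3 4])
    also have "\<dots> = h * (h * (L\<beta> * Am + B * La + (L\<phi> * Zm + B * (Lu + B * Zm)) + C\<phi> * Lz) + \<delta> n * Zm)"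
      by (simp add: algebra_simps)
    also have "\<dots> \<le> h * (h * C + \<delta> n * C)"
    proof (intro mult_left_mono add_mono)
      show "L\<beta> * Am + B * La + (L\<phi> * Zm + B * (Lu + B * Zm)) + C\<phi> * Lz \<le> C"
        unfolding C_def using nonneg' by simp
      show "Zm \<le> C"
        unfolding C_def using nonneg nonneg' B by (simp add: add_nonneg_nonneg)
    qed (use h \<delta>_nonneg in auto)
    finally show ?thesis by (simp add: algebra_simps)
  qed
  have x': "x \<in> {0..?b}" using x by (simp add: h_def)
  have "\<bar>D n x - h * g x\<bar> \<le> 2 * (h * (C * (h + \<delta> n))) * exp (2 * B * x)"
  proof (rule conv_volterra_bound[OF _ cs(2) B _ eq e_le x'])
    show "continuous_on {0..?b} (\<lambda>y. D n y - h * g y)"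
      by (intro continuous_on_diff continuous_on_mult continuous_on_const cD sub[OF cont_g])
    show "\<bar>\<phi> y\<bar> \<le> B" if "y \<in> {0..?b}" for y using that h by (intro \<phi>_le) auto
  qed
  also have "\<dots> \<le> 2 * (h * (C * (h + \<delta> n))) * exp (2 * B)"
    using x' h B C_nonneg \<delta>_nonneg[of n] by (intro mult_left_mono) (auto simp: mult_left_le)
  finally have "\<bar>D n x - h * g x\<bar> / h \<le> 2 * (C * (h + \<delta> n)) * exp (2 * B)"
    using h by (simp add: pos_divide_le_eq algebra_simps)
  moreover have "\<bar>D n x - h * g x\<bar> / h = \<bar>D n x / h - g x\<bar>"
  proof -
    have "D n x / h - g x = (D n x - h * g x) / h" using h by (simp add: diff_divide_distrib)
    then show ?thesis using h by (simp add: abs_divide)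
  qed
  ultimately show ?thesis by (simp add: h_def)
qed

lemma D_bounded: "\<exists>G. \<forall>n. \<forall>x\<in>{0..1 - step n}. \<bar>D n x / step n\<bar> \<le> G"
proof -
  obtain Gm where "\<forall>y\<in>g ` {0..1}. norm y \<le> Gm"
    using compact_imp_bounded[OF compact_continuous_image[OF cont_g compact_Icc]]
    unfolding bounded_iff by blast
  then have Gm: "\<bar>g x\<bar> \<le> Gm" if "x \<in> {0..1}" for x using that by simp
  have "\<bar>D n x / step n\<bar> \<le> Gm + 2 * (C * (1 + 2 * C\<phi>)) * exp (2 * B)" if x: "x \<in> {0..1 - step n}" for n x
  proof -
    have "\<delta> n \<le> integral {0..1} (\<lambda>x::real. 2 * C\<phi>)"
      unfolding \<delta>_def
    proof (rule integral_mono_interval)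
      show "continuous_on {0..1} (\<lambda>x. \<bar>(\<phi>n n x - \<phi> x) / step n - v x\<bar>)"
        using step_pos[of n] by (intro continuous_intros cont cont_n) auto
      show "\<bar>(\<phi>n n x - \<phi> x) / step n - v x\<bar> \<le> 2 * C\<phi>" if "x \<in> {0..1}" for x
        using \<phi>n_le[OF that, of n] v_le[OF that] by linarith
    qed (rule continuous_on_const)
    then have "step n + \<delta> n \<le> 1 + 2 * C\<phi>" using step_le_1[of n] by simp
    then have "2 * (C * (step n + \<delta> n)) * exp (2 * B) \<le> 2 * (C * (1 + 2 * C\<phi>)) * exp (2 * B)"
      using C_nonneg by (intro mult_right_mono mult_left_mono) auto
    then show ?thesis using D_close[OF x] Gm[of x] x step_pos[of n] unfolding abs_le_iff by auto
  qed
  then show ?thesis by blast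
qed

lemma D_tendsto:
  assumes x: "0 \<le> x" "x < 1"
  shows "(\<lambda>n. D n x / step n) \<longlonglongrightarrow> g x"
proof -
  have "eventually (\<lambda>n. x \<in> {0..1 - step n}) sequentially"
    using order_tendstoD(2)[OF step_tendsto_0, of "1 - x"] x by (auto elim: eventually_mono)
  then have "eventually (\<lambda>n. norm (D n x / step n - g x) \<le> 2 * (C * (step n + \<delta> n)) * exp (2 * B)) sequentially"
    by eventually_elim (use D_close in auto)
  moreover have "(\<lambda>n. 2 * (C * (step n + \<delta> n)) * exp (2 * B)) \<longlonglongrightarrow> 2 * (C * (0 + 0)) * exp (2 * B)"
    by (intro tendsto_intros step_tendsto_0 \<delta>_tendsto)
  then have "(\<lambda>n. 2 * (C * (step n + \<delta> n)) * exp (2 * B)) \<longlonglongrightarrow> 0" by simp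
  ultimately have "(\<lambda>n. D n x / step n - g x) \<longlonglongrightarrow> 0"
    by (rule Lim_null_comparison)
  then show ?thesis by (simp add: LIM_zero_iff)
qed

text \<open>The sum in the integrand comes from factoring a difference of squares. Extension by zero
  beyond 1 - step n puts all integrals on one interval, where dominated convergence applies; only
  the point 1 is never reached, which explains the exception in \<open>G\<close>.\<close>

lemma transport_integral_tendsto:
  "(\<lambda>n. integral {0..1 - step n} (\<lambda>x. exp (c * x) * (D n x / step n) * (zn n x + z (x + step n))))
     \<longlonglongrightarrow> 2 * integral {0..1} (\<lambda>x. exp (c * x) * z x * g x)"
proof -
  define F where "F = (\<lambda>n x. exp (c * x) * (D n x / step n) * (zn n x + z (x + step n)))"
  define G where "G = (\<lambda>x. if x \<in> {1} then 0 else 2 * (exp (c * x) * z x * g x))"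
  obtain Gm where Gm: "\<And>n x. x \<in> {0..1 - step n} \<Longrightarrow> \<bar>D n x / step n\<bar> \<le> Gm"
    using D_bounded by blast
  have "0 \<in> {0..1 - step 0}" using step_le_1[of 0] by simp
  from order_trans[OF abs_ge_zero Gm[OF this]] have Gm0: "0 \<le> Gm" .
  have cF: "continuous_on {0..1 - step n} (F n)" for n
  proof -
    have "continuous_on {0..1 - step n} (zn n)"
      using cont_n(2) by (rule continuous_on_subset) (use step_pos[of n] in auto)
    moreover have "continuous_on {0..1 - step n} (\<lambda>x. z (x + step n))"
      by (intro continuous_on_compose2[OF cont(6)] continuous_intros) (use step_pos[of n] in auto)
    ultimately show ?thesis
      unfolding F_def D_def using step_pos[of n] by (intro continuous_intros) auto
  qed
  have restrict: "{0..1 - step n} \<subseteq> {0..1}" for n using step_pos[of n] by auto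
  have "(\<lambda>n. integral {0..1} (\<lambda>x. if x \<in> {0..1 - step n} then F n x else 0)) \<longlonglongrightarrow> integral {0..1} G"
  proof (rule dominated_convergence(2))
    show "(\<lambda>x. if x \<in> {0..1 - step n} then F n x else 0) integrable_on {0..1}" for n
      using has_integral_restrict[OF restrict] integrable_continuous_interval[OF cF[of n]]
      unfolding integrable_on_def by blast
    show "(\<lambda>x::real. exp c * Gm * (2 * Zm)) integrable_on {0..1}" by (rule integrable_const_ivl)
    show "norm (if x \<in> {0..1 - step n} then F n x else 0) \<le> exp c * Gm * (2 * Zm)" if x: "x \<in> {0..1}" for n x
    proof (cases "x \<in> {0..1 - step n}")
      case True
      have "\<bar>zn n x + z (x + step n)\<bar> \<le> 2 * Zm"
        using zn_le[OF x, of n] z_le[of "x + step n"] True x step_pos[of n] by auto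
      moreover have "exp (c * x) \<le> exp c" using x c by (simp add: mult_left_le)
      ultimately have "\<bar>F n x\<bar> \<le> exp c * Gm * (2 * Zm)"
        unfolding F_def abs_mult[of "_ * _"] abs_mult[of "exp (c * x)"]
        using Gm[OF True] Gm0 by (intro mult_mono) auto
      then show ?thesis using True by simp
    next
      case False
      show ?thesis unfolding if_not_P[OF False] using Gm0 nonneg' by simp
    qed
    show "(\<lambda>n. if x \<in> {0..1 - step n} then F n x else 0) \<longlonglongrightarrow> G x" if x: "x \<in> {0..1}" for x
    proof (cases "x = 1")
      case True
      then have "x \<notin> {0..1 - step n}" for n using step_pos[of n] by simp
      then show ?thesis using True by (simp add: G_def)
    next
      case False
      then have x1: "0 \<le> x" "x < 1" using x by auto
      have ev: "eventually (\<lambda>n. x \<in> {0..1 - step n}) sequentially"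
        using order_tendstoD(2)[OF step_tendsto_0, of "1 - x"] x1 by (auto elim: eventually_mono)
      have "(\<lambda>n. zn n x - z x) \<longlonglongrightarrow> 0"
      proof (rule Lim_null_comparison[of _ "\<lambda>n. Lz * step n"])
        show "(\<lambda>n. Lz * step n) \<longlonglongrightarrow> 0" using tendsto_mult_left[OF step_tendsto_0, of Lz] by simp
      qed (use zn_z[OF x] in simp)
      then have zn: "(\<lambda>n. zn n x) \<longlonglongrightarrow> z x" by (simp add: LIM_zero_iff)
      have zs: "(\<lambda>n. z (x + step n)) \<longlonglongrightarrow> z x"
      proof (rule continuous_on_tendsto_compose[OF cont(6)])
        show "(\<lambda>n. x + step n) \<longlonglongrightarrow> x" using tendsto_add[OF tendsto_const step_tendsto_0, of x] by simp
        show "eventually (\<lambda>n. x + step n \<in> {0..1}) sequentially"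
          using ev by eventually_elim (use step_pos in \<open>auto simp: less_imp_le add_nonneg_nonneg\<close>)
      qed (use x in auto)
      have "F n x = exp (c * x) * (D n x / step n) * (zn n x + z (x + step n))" for n by (simp add: F_def)
      moreover have "(\<lambda>n. exp (c * x) * (D n x / step n) * (zn n x + z (x + step n)))
          \<longlonglongrightarrow> exp (c * x) * g x * (z x + z x)"
        by (intro tendsto_intros D_tendsto x1 zn zs)
      ultimately have "(\<lambda>n. F n x) \<longlonglongrightarrow> G x"
        using False by (simp add: G_def algebra_simps)
      then show ?thesis
        by (rule Lim_transform_eventually) (use ev in eventually_elim, simp)
    qed
  qed
  moreover have "integral {0..1} (\<lambda>x. if x \<in> {0..1 - step n} then F n x else 0) = integral {0..1 - step n} (F n)" for n
    using has_integral_restrict[OF restrict] integrable_integral[OF integrable_continuous_interval[OF cF[of n]]]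
    by (intro integral_unique) blast
  moreover have "integral {0..1} G = 2 * integral {0..1} (\<lambda>x. exp (c * x) * z x * g x)"
    unfolding integral_mult_right[symmetric] by (rule integral_spike[of "{1}"]) (auto simp: G_def)
  ultimately show ?thesis by (simp add: F_def)
qed

text \<open>Integration by parts in discrete form, without derivatives in space. Shifting by h
  changes the weight by exp (- c h), which yields - c times the norm; the strip at 0 that leaves the
  domain yields - z(0)^2, and the strip at 1 that enters yields exp c z(1)^2.\<close>

lemma wnorm_sq_quotient_tendsto:
  "(\<lambda>n. (wnorm_sq c (zn n) - wnorm_sq c z) / step n) \<longlonglongrightarrow>
     - c * wnorm_sq c z - (z 0)\<^sup>2 + exp c * (z 1)\<^sup>2 + 2 * integral {0..1} (\<lambda>x. exp (c * x) * z x * g x)"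
proof -
  define P where "P = (\<lambda>x. exp (c * x) * (z x)\<^sup>2)"
  define Pn where "Pn = (\<lambda>n x. exp (c * x) * (zn n x)\<^sup>2)"
  have cP: "continuous_on {0..1} P" and cPn: "continuous_on {0..1} (Pn n)" for n
    unfolding P_def Pn_def by (intro continuous_intros cont cont_n)+
  note int = integrable_continuous_interval
  note combine = Henstock_Kurzweil_Integration.integral_combine
  define N where "N = wnorm_sq c z"
  \<comment> \<open>\<open>T3\<close> is the change of the integrand over one time step on the strip
    at 1, an O(h) quantity on an interval of length h; \<open>T4\<close> carries the source along
    characteristics.\<close>
  define T3 where "T3 = (\<lambda>n. integral {1 - step n..1} (\<lambda>x. Pn n x - P x) / step n)"
  define T4 where "T4 = (\<lambda>n. integral {0..1 - step n} (\<lambda>x. exp (c * x) * (D n x / step n) * (zn n x + z (x + step n))))"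
  have eq: "(wnorm_sq c (zn n) - N) / step n = (exp (- c * step n) - 1) / step n * N
      - exp (- c * step n) * (integral {0..step n} P / step n) + integral {1 - step n..1} P / step n + T3 n + T4 n" for n
  proof -
    define h where "h = step n"
    have h: "0 < h" "h \<le> 1" using step_pos step_le_1 by (auto simp: h_def)
    have sub: "continuous_on {0..1 - h} q" "continuous_on {1 - h..1} q" if "continuous_on {0..1} q" for q :: "real \<Rightarrow> real"
      using h by (auto intro: continuous_on_subset[OF that])
    have czh: "continuous_on {0..1 - h} (\<lambda>x. z (x + h))"
      by (intro continuous_on_compose2[OF cont(6)] continuous_intros) (use h in auto)
    have "wnorm_sq c (zn n) = integral {0..1 - h} (Pn n) + integral {1 - h..1} (Pn n)"
      using combine[of 0 "1 - h" 1 "Pn n"] int[OF cPn] h by (simp add: wnorm_sq_def Pn_def)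
    moreover have "integral {1 - h..1} (Pn n) = integral {1 - h..1} P + h * T3 n"
      using integral_diff[OF int[OF sub(2)[OF cPn]] int[OF sub(2)[OF cP]]] h by (simp add: T3_def h_def)
    moreover have "integral {0..1 - h} (Pn n) = exp (- c * h) * integral {h..1} P + h * T4 n"
    proof -
      have "integral {0..1 - h} (Pn n) = integral {0..1 - h} (\<lambda>x. exp (- c * h) * P (x + h) +
          h * (exp (c * x) * (D n x / h) * (zn n x + z (x + h))))"
      proof (rule integral_cong)
        fix x
        have "exp (- c * h) * P (x + h) = exp (c * x) * (z (x + h))\<^sup>2"
        proof -
          have "exp (- c * h) * exp (c * (x + h)) = exp (c * x)"
            unfolding exp_add[symmetric] by (simp add: distrib_left)
          then show ?thesis unfolding P_def by (simp only: mult.assoc[symmetric])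
        qed
        moreover have "(zn n x)\<^sup>2 = (z (x + h))\<^sup>2 + D n x * (zn n x + z (x + h))"
          by (simp add: D_def h_def power2_eq_square algebra_simps)
        ultimately show "Pn n x = exp (- c * h) * P (x + h) +
          h * (exp (c * x) * (D n x / h) * (zn n x + z (x + h)))"
          unfolding Pn_def by (simp only: distrib_left) (use h in simp)
      qed
      also have "\<dots> = integral {0..1 - h} (\<lambda>x. exp (- c * h) * P (x + h)) + integral {0..1 - h} (\<lambda>x.
          h * (exp (c * x) * (D n x / h) * (zn n x + z (x + h))))"
      proof (intro integral_add int)
        show "continuous_on {0..1 - h} (\<lambda>x. exp (- c * h) * P (x + h))"
          unfolding P_def by (intro continuous_intros czh)
        show "continuous_on {0..1 - h} (\<lambda>x. h * (exp (c * x) * (D n x / h) * (zn n x + z (x + h))))"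
          unfolding D_def h_def[symmetric] using h by (intro continuous_intros czh sub cont_n) auto
      qed
      also have "integral {0..1 - h} (\<lambda>x. h * (exp (c * x) * (D n x / h) * (zn n x + z (x + h)))) = h * T4 n"
        unfolding T4_def h_def by (rule integral_mult_right)
      also have "integral {0..1 - h} (\<lambda>x. exp (- c * h) * P (x + h)) = exp (- c * h) * integral {h..1} P"
        using integral_shift_Icc_real[of 0 "1 - h" P h] by (simp add: o_def add.commute)
      finally show ?thesis .
    qed
    moreover have "N = integral {0..h} P + integral {h..1} P"
      using combine[of 0 h 1 P] int[OF cP] h by (simp add: N_def wnorm_sq_def P_def)
    ultimately have "wnorm_sq c (zn n) - N = (exp (- c * h) - 1) * N - exp (- c * h) * integral {0..h} P
       + integral {1 - h..1} P + h * T3 n + h * T4 n"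
      by (simp add: algebra_simps)
    moreover have "(X * N - Y * I + J + h * a + h * b) / h = X / h * N - Y * (I / h) + J / h + a + b"
      for X Y I J a b :: real
      using h by (simp add: add_divide_distrib diff_divide_distrib)
    ultimately show ?thesis unfolding h_def[symmetric] by (simp only:)
  qed
  have "(\<lambda>n. (exp (- c * (0 + step n)) - exp (- c * 0)) / step n) \<longlonglongrightarrow> - c"
    using step_pos by (intro DERIV_sequence step_tendsto_0) (auto intro!: derivative_eq_intros simp: less_imp_neq[symmetric])
  then have 1: "(\<lambda>n. (exp (- c * step n) - 1) / step n) \<longlonglongrightarrow> - c" by simp
  have "(\<lambda>n. exp (- c * step n)) \<longlonglongrightarrow> exp (- c * 0)" by (intro tendsto_intros step_tendsto_0)
  then have 2: "(\<lambda>n. exp (- c * step n)) \<longlonglongrightarrow> 1" by simp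
  have 3: "T3 \<longlonglongrightarrow> 0"
  proof (rule Lim_null_comparison)
    have "\<bar>T3 n\<bar> \<le> exp c * (2 * Zm * (Lz * step n))" for n
    proof -
      define h where "h = step n"
      have h: "0 < h" "h \<le> 1" using step_pos step_le_1 by (auto simp: h_def)
      have "\<bar>integral {1 - h..1} (\<lambda>x. Pn n x - P x)\<bar> \<le> integral {1 - h..1} (\<lambda>x. exp c * (2 * Zm * (Lz * h)))"
      proof (rule abs_integral_le)
        show "continuous_on {1 - h..1} (\<lambda>x. Pn n x - P x)"
          by (rule continuous_on_subset[of "{0..1}"]) (use h in \<open>auto intro!: continuous_intros cP cPn\<close>)
        fix x assume "x \<in> {1 - h..1}"
        then have x: "x \<in> {0..1}" using h by auto
        have "Pn n x - P x = exp (c * x) * ((zn n x + z x) * (zn n x - z x))"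
          by (simp add: Pn_def P_def power2_eq_square algebra_simps)
        also have "\<bar>\<dots>\<bar> \<le> exp c * (2 * Zm * (Lz * h))"
          unfolding abs_mult
        proof (intro mult_mono)
          show "\<bar>exp (c * x)\<bar> \<le> exp c" using x c by (simp add: mult_left_le)
          show "\<bar>zn n x + z x\<bar> \<le> 2 * Zm" using zn_le[OF x, of n] z_le[OF x] by linarith
          show "\<bar>zn n x - z x\<bar> \<le> Lz * h" using zn_z[OF x] by (simp add: h_def)
        qed (use nonneg' in auto)
        finally show "\<bar>Pn n x - P x\<bar> \<le> exp c * (2 * Zm * (Lz * h))" .
      qed (rule continuous_on_const)
      also have "\<dots> = h * (exp c * (2 * Zm * (Lz * h)))" using h by simp
      finally show ?thesis using h
        unfolding T3_def h_def[symmetric] by (simp add: abs_divide pos_divide_le_eq mult.commute)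
    qed
    then show "eventually (\<lambda>n. norm (T3 n) \<le> exp c * (2 * Zm * (Lz * step n))) sequentially" by simp
    have "(\<lambda>n. exp c * (2 * Zm * (Lz * step n))) \<longlonglongrightarrow> exp c * (2 * Zm * (Lz * 0))"
      by (intro tendsto_intros step_tendsto_0)
    then show "(\<lambda>n. exp c * (2 * Zm * (Lz * step n))) \<longlonglongrightarrow> 0" by simp
  qed
  have 4: "T4 \<longlonglongrightarrow> 2 * integral {0..1} (\<lambda>x. exp (c * x) * z x * g x)"
    unfolding T4_def by (rule transport_integral_tendsto)
  have "(\<lambda>n. (exp (- c * step n) - 1) / step n * N
      - exp (- c * step n) * (integral {0..step n} P / step n) + integral {1 - step n..1} P / step n + T3 n + T4 n)
    \<longlonglongrightarrow> - c * N - 1 * P 0 + P 1 + 0 + 2 * integral {0..1} (\<lambda>x. exp (c * x) * z x * g x)"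
    by (intro tendsto_intros 1 2 3 4 average_left_tendsto average_right_tendsto cP)
  then show ?thesis unfolding eq[symmetric] by (simp add: N_def P_def)
qed

lemma estimation_error_quotient_tendsto:
  "(\<lambda>n. (integral {0..1} (\<lambda>x. (\<beta> x - \<phi>n n x)\<^sup>2) - integral {0..1} (\<lambda>x. (\<beta> x - \<phi> x)\<^sup>2)) / step n)
     \<longlonglongrightarrow> - 2 * integral {0..1} (\<lambda>x. (\<beta> x - \<phi> x) * v x)"
proof -
  define q where "q = (\<lambda>n x. (\<phi>n n x - \<phi> x) / step n)"
  have cq: "continuous_on {0..1} (q n)" for n
    unfolding q_def using step_pos[of n] by (intro continuous_intros cont cont_n) auto
  note int = integrable_continuous_interval
  have "(integral {0..1} (\<lambda>x. (\<beta> x - \<phi>n n x)\<^sup>2) - integral {0..1} (\<lambda>x. (\<beta> x - \<phi> x)\<^sup>2)) / step n =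
      integral {0..1} (\<lambda>x. - q n x * (2 * (\<beta> x - \<phi> x) - step n * q n x))" for n
  proof -
    have "integral {0..1} (\<lambda>x. (\<beta> x - \<phi>n n x)\<^sup>2) - integral {0..1} (\<lambda>x. (\<beta> x - \<phi> x)\<^sup>2) =
       integral {0..1} (\<lambda>x. (\<beta> x - \<phi>n n x)\<^sup>2 - (\<beta> x - \<phi> x)\<^sup>2)"
      by (intro integral_diff[symmetric] int continuous_intros cont cont_n)
    also have "\<dots> = integral {0..1} (\<lambda>x. step n * (- q n x * (2 * (\<beta> x - \<phi> x) - step n * q n x)))"
    proof (rule integral_cong)
      fix x
      have "step n * q n x = \<phi>n n x - \<phi> x" using step_pos[of n] by (simp add: q_def)
      moreover have "step n * (- q n x * (2 * (\<beta> x - \<phi> x) - step n * q n x)) =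
          - (step n * q n x) * (2 * (\<beta> x - \<phi> x) - step n * q n x)" by simp
      ultimately have "step n * (- q n x * (2 * (\<beta> x - \<phi> x) - step n * q n x)) =
          - (\<phi>n n x - \<phi> x) * (2 * (\<beta> x - \<phi> x) - (\<phi>n n x - \<phi> x))" by (simp only:)
      then show "(\<beta> x - \<phi>n n x)\<^sup>2 - (\<beta> x - \<phi> x)\<^sup>2 = step n * (- q n x * (2 * (\<beta> x - \<phi> x) - step n * q n x))"
        by (simp only:) (simp add: power2_eq_square algebra_simps)
    qed
    also have "\<dots> = step n * integral {0..1} (\<lambda>x. - q n x * (2 * (\<beta> x - \<phi> x) - step n * q n x))"
      by (rule integral_mult_right)
    finally show ?thesis using step_pos[of n] by simp
  qed
  moreover have "(\<lambda>n. integral {0..1} (\<lambda>x. - q n x * (2 * (\<beta> x - \<phi> x) - step n * q n x)))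
      \<longlonglongrightarrow> integral {0..1} (\<lambda>x. - v x * (2 * (\<beta> x - \<phi> x) - 0 * v x))"
  proof (rule dominated_convergence(2))
    show "(\<lambda>x. - q n x * (2 * (\<beta> x - \<phi> x) - step n * q n x)) integrable_on {0..1}" for n
      by (intro int continuous_intros cont cq)
    show "(\<lambda>x::real. C\<phi> * (4 * B + C\<phi>)) integrable_on {0..1}" by (rule integrable_const_ivl)
    show "norm (- q n x * (2 * (\<beta> x - \<phi> x) - step n * q n x)) \<le> C\<phi> * (4 * B + C\<phi>)" if x: "x \<in> {0..1}" for n x
    proof -
      have q: "\<bar>q n x\<bar> \<le> C\<phi>" using \<phi>n_le[OF x] by (simp add: q_def)
      have "\<bar>step n * q n x\<bar> \<le> 1 * C\<phi>"
        unfolding abs_mult using q step_pos[of n] step_le_1[of n] by (intro mult_mono) auto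
      moreover have "\<bar>2 * (\<beta> x - \<phi> x)\<bar> \<le> 4 * B"
        using \<beta>_le[OF x] \<phi>_le[OF x] unfolding right_diff_distrib by linarith
      ultimately have "\<bar>2 * (\<beta> x - \<phi> x) - step n * q n x\<bar> \<le> 4 * B + C\<phi>"
        by (intro order_trans[OF abs_triangle_ineq4] add_mono) simp_all
      then show ?thesis unfolding real_norm_def abs_mult abs_minus_cancel
        using q nonneg' by (intro mult_mono) auto
    qed
    show "(\<lambda>n. - q n x * (2 * (\<beta> x - \<phi> x) - step n * q n x)) \<longlonglongrightarrow> - v x * (2 * (\<beta> x - \<phi> x) - 0 * v x)"
      if x: "x \<in> {0..1}" for x
      unfolding q_def by (intro tendsto_intros step_tendsto_0 \<phi>n_lim[OF x])
  qed
  moreover have "integral {0..1} (\<lambda>x. - v x * (2 * (\<beta> x - \<phi> x) - 0 * v x)) =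
      integral {0..1} (\<lambda>x. - 2 * ((\<beta> x - \<phi> x) * v x))"
    by (intro integral_cong) simp
  ultimately show ?thesis by simp
qed

end

section \<open>Trajectories of the closed loop\<close>

lemma abs_continuous_on_ivl_imp_continuous_on:
  assumes "abs_continuous_on_ivl a b f"
  shows "continuous_on {a..b} f"
  unfolding continuous_on_iff
proof (intro ballI allI impI)
  fix x e :: real assume x: "x \<in> {a..b}" and e: "e > 0"
  from assms e obtain d where d: "d > 0"
    and dI: "\<And>I. finite I \<Longrightarrow> (\<forall>(s, t)\<in>I. a \<le> s \<and> s \<le> t \<and> t \<le> b) \<Longrightarrow>
        pairwise (\<lambda>(s, t) (s', t'). {s<..<t} \<inter> {s'<..<t'} = {}) I \<Longrightarrow>
        (\<Sum>(s, t)\<in>I. t - s) < d \<Longrightarrow> (\<Sum>(s, t)\<in>I. \<bar>f t - f s\<bar>) < e"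
    unfolding abs_continuous_on_ivl_def by meson
  show "\<exists>d>0. \<forall>x'\<in>{a..b}. dist x' x < d \<longrightarrow> dist (f x') (f x) < e"
  proof (intro exI[of _ d] conjI ballI impI)
    fix y assume y: "y \<in> {a..b}" "dist y x < d"
    have "(\<Sum>(s, t)\<in>{(min x y, max x y)}. \<bar>f t - f s\<bar>) < e"
      using x y by (intro dI) (auto simp: dist_real_def)
    then show "dist (f y) (f x) < e"
      by (auto simp: dist_real_def min_def max_def abs_minus_commute split: if_splits)
  qed (rule d)
qed

lemma AE_le_imp_le:
  fixes f :: "real \<Rightarrow> real"
  assumes f: "\<And>T. continuous_on {0..T} f" and ae: "AE t in lborel. t \<ge> 0 \<longrightarrow> f t \<le> b" and t: "t \<ge> 0"
  shows "f t \<le> b"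
proof (rule ccontr)
  assume "\<not> f t \<le> b"
  then have e: "f t - b > 0" by simp
  obtain N where N: "negligible N" "\<And>t. t \<notin> N \<Longrightarrow> t \<ge> 0 \<longrightarrow> f t \<le> b"
    using AE_lborel_negligible[OF ae] by blast
  from f[of "t + 1", unfolded continuous_on_iff] t e obtain d where d: "d > 0"
    "\<And>s. s \<in> {0..t + 1} \<Longrightarrow> dist s t < d \<Longrightarrow> dist (f s) (f t) < f t - b"
    by (metis atLeastAtMost_iff less_add_one less_imp_le)
  have "{t..t + min 1 (d / 2)} \<subseteq> N"
  proof
    fix s assume s: "s \<in> {t..t + min 1 (d / 2)}"
    then have "dist (f s) (f t) < f t - b" using t d(1) by (intro d(2)) (auto simp: dist_real_def)
    then have "\<not> f s \<le> b" unfolding dist_real_def by linarith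
    then show "s \<in> N" using N(2)[of s] s t by auto
  qed
  then have "negligible {t..t + min 1 (d / 2)}" using N(1) negligible_subset by blast
  moreover have "{t<..<t + min 1 (d / 2)} \<noteq> {}" using d(1) by auto
  ultimately show False
    using negligible_interval(1)[of t "t + min 1 (d / 2)"] by simp
qed

lemma nonneg_on_rationals_imp_nonneg:
  fixes f :: "real \<Rightarrow> real"
  assumes f: "continuous_on {0..1} f" and nonneg: "\<And>x. x \<in> \<rat> \<inter> {0..1} \<Longrightarrow> 0 \<le> f x" and x: "x \<in> {0..1}"
  shows "0 \<le> f x"
proof (rule ccontr)
  assume "\<not> 0 \<le> f x"
  then obtain d where d: "d > 0" "\<And>y. y \<in> {0..1} \<Longrightarrow> dist y x < d \<Longrightarrow> dist (f y) (f x) < - f x"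
    using f x unfolding continuous_on_iff by (metis neg_0_less_iff_less not_less)
  have "max 0 (x - d) < min 1 (x + d)" using x d(1) by auto
  then obtain q where q: "q \<in> \<rat>" "max 0 (x - d) < q" "q < min 1 (x + d)"
    using Rats_dense_in_real by blast
  then have "dist (f q) (f x) < - f x" by (intro d(2)) (auto simp: dist_real_def)
  then have "f q < 0" unfolding dist_real_def by linarith
  moreover have "0 \<le> f q" by (rule nonneg) (use q in auto)
  ultimately show False by simp
qed

lemma filippov_Proj_nonempty_imp: "v \<in> filippov_Proj B a b \<Longrightarrow> \<bar>b\<bar> \<le> B"
  using filippov_Proj_outside[of B b a] by fastforce

lemma filippov_Proj_abs_le:
  assumes "v \<in> filippov_Proj B a b"
  shows "\<bar>v\<bar> \<le> \<bar>a\<bar>"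
  using subsetD[OF filippov_Proj_subset_segment assms]
  by (auto simp: closed_segment_eq_real_ivl split: if_splits)

text \<open>The projection acts only at \<bar>b\<bar> = B and only on an outward velocity. As
  \<bar>\<beta>\<bar> \<le> B, the error \<beta> - b does not point outward there, so what is
  removed has the favourable sign for every choice in the segment.\<close>

lemma filippov_Proj_error_le:
  assumes v: "v \<in> filippov_Proj B a b" and \<beta>: "\<bar>\<beta>\<bar> \<le> B"
  shows "(\<beta> - b) * (a - v) \<le> 0"
proof (cases "\<bar>b\<bar> = B \<and> a * b > 0")
  case True
  have v': "v \<in> closed_segment 0 a" using v filippov_Proj_subset_segment by blast
  from True consider "a > 0" "b = B" | "a < 0" "b = - B"
    by (auto simp: zero_less_mult_iff)
  then show ?thesis
  proof cases
    case 1
    then have "\<beta> - b \<le> 0" "0 \<le> a - v" using \<beta> v' by (auto simp: closed_segment_eq_real_ivl)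
    then show ?thesis by (rule mult_nonpos_nonneg)
  next
    case 2
    then have "0 \<le> \<beta> - b" "a - v \<le> 0" using \<beta> v' by (auto simp: closed_segment_eq_real_ivl)
    then show ?thesis by (rule mult_nonneg_nonpos)
  qed
next
  case False
  then have "v = a" using filippov_Proj_regular[OF filippov_Proj_nonempty_imp[OF v]] v by auto
  then show ?thesis by simp
qed

lemma H_memberI:
  assumes "K-lipschitz_on {0..1} \<alpha>" "\<And>x. x \<in> {0..1} \<Longrightarrow> \<bar>\<alpha> x\<bar> \<le> M"
  shows "\<alpha> \<in> H M K"
  using assms lipschitz_on_continuous_on[OF assms(1)]
  by (auto simp: H_def sup_norm_def intro!: cSUP_least)

lemma abs_le_sup_norm:
  assumes f: "continuous_on {0..1} f" and x: "x \<in> {0..1}"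
  shows "\<bar>f x\<bar> \<le> sup_norm f"
proof -
  have "compact ((\<lambda>x. \<bar>f x\<bar>) ` {0..1})"
    by (intro compact_continuous_image continuous_intros f) auto
  then have "bdd_above ((\<lambda>x. \<bar>f x\<bar>) ` {0..1})" by (intro bounded_imp_bdd_above compact_imp_bounded)
  then show ?thesis unfolding sup_norm_def using x by (intro cSUP_upper)
qed

locale adaptive_trajectory =
  fixes B c \<epsilon> \<gamma> M K L\<beta> :: real
    and Khat :: "(real \<Rightarrow> real) \<Rightarrow> real \<Rightarrow> real" and Khat1 :: "(real \<Rightarrow> real) \<Rightarrow> (real \<Rightarrow> real) \<Rightarrow> real \<Rightarrow> real"
    and \<beta> :: "real \<Rightarrow> real" and \<beta>hat u :: "real \<Rightarrow> real \<Rightarrow> real"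
  assumes B: "B > 0" and c: "c > 0" and \<epsilon>: "\<epsilon> > 0" and \<gamma>: "\<gamma> > 0" and M: "B \<le> M"
    and \<epsilon>_small: "1024 * exp (2 * c + 9 * B) * \<epsilon> \<le> min 1 c"
    and \<gamma>_small: "1024 * exp (2 * c + 9 * B) * \<gamma> \<le> min 1 c"
    and approx: "neural_approximation M K \<epsilon> Khat Khat1"
    and \<beta>_lip: "L\<beta>-lipschitz_on {0..1} \<beta>" and \<beta>_le: "\<And>x. x \<in> {0..1} \<Longrightarrow> \<bar>\<beta> x\<bar> \<le> B"
    and loop: "closed_loop B c \<gamma> Khat \<beta> \<beta>hat u"
    and regular: "regular_solution M K Khat \<beta>hat"
begin

definition khat where "khat x t = Khat (\<lambda>y. \<beta>hat y t) x"
definition k where "k t = kernel_op (\<lambda>y. \<beta>hat y t)"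
definition \<kappa> where "\<kappa> = 2 * B * exp (2 * B)"
definition z where "z t x = u x t - conv (k t) (\<lambda>y. u y t) x"
definition \<tau> where "\<tau> = tau c \<gamma> khat (backstepping khat u)"

lemma plant: "plant_solution \<beta> (feedback khat u) u"
  and update: "update_solution B \<tau> \<beta>hat"
  using loop by (simp_all add: closed_loop_def Let_def \<tau>_def khat_def[abs_def])

lemma cont_\<beta>: "continuous_on {0..1} \<beta>"
  using \<beta>_lip by (rule lipschitz_on_continuous_on)

lemma u_continuous: "continuous_on ({0..1} \<times> {0..}) (\<lambda>(x, t). u x t)"
  using plant by (simp add: plant_solution_def)

lemma cont_u: "t \<ge> 0 \<Longrightarrow> continuous_on {0..1} (\<lambda>x. u x t)"
  by (rule continuous_on_uncurry[OF u_continuous]) (auto intro: continuous_intros)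

lemma cont_u_time: "x \<in> {0..1} \<Longrightarrow> continuous_on {0..} (u x)"
  using continuous_on_uncurry[OF u_continuous, of "{0..}" "\<lambda>_. x" "\<lambda>t. t"]
  by (auto intro: continuous_intros)

lemma \<beta>hat_lip: "t \<ge> 0 \<Longrightarrow> K-lipschitz_on {0..1} (\<lambda>x. \<beta>hat x t)"
  using regular by (simp add: regular_solution_def)

lemma cont_\<beta>hat: "t \<ge> 0 \<Longrightarrow> continuous_on {0..1} (\<lambda>x. \<beta>hat x t)"
  using \<beta>hat_lip by (rule lipschitz_on_continuous_on)

lemma \<beta>hat_ac: "x \<in> {0..1} \<Longrightarrow> T \<ge> 0 \<Longrightarrow> abs_continuous_on_ivl 0 T (\<beta>hat x)"
  and \<beta>hat_inclusion: "x \<in> {0..1} \<Longrightarrow> AE t in lborel. t \<ge> 0 \<longrightarrow>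
           (\<exists>v\<in>filippov_Proj B (\<tau> x t) (\<beta>hat x t). (\<beta>hat x has_real_derivative v) (at t))"
  using update by (auto simp: update_solution_def)

text \<open>The regularized projection is empty where \<bar>b\<bar> > B, so the mere solvability of
  the inclusion gives the bound at almost every time, and continuity in time gives it
  always.\<close>

lemma \<beta>hat_le:
  assumes x: "x \<in> {0..1}" and t: "t \<ge> 0"
  shows "\<bar>\<beta>hat x t\<bar> \<le> B"
proof (rule AE_le_imp_le[OF _ _ t])
  show "continuous_on {0..T} (\<lambda>t. \<bar>\<beta>hat x t\<bar>)" for T
  proof (cases "T \<ge> 0")
    case True
    then show ?thesis
      using abs_continuous_on_ivl_imp_continuous_on[OF \<beta>hat_ac[OF x]] by (intro continuous_intros)
  qed simp
  show "AE t in lborel. t \<ge> 0 \<longrightarrow> \<bar>\<beta>hat x t\<bar> \<le> B"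
    using \<beta>hat_inclusion[OF x] by eventually_elim (use filippov_Proj_nonempty_imp in blast)
qed

text \<open>Places the estimate in the set on which the neural operator is accurate.\<close>

lemma \<beta>hat_H: "t \<ge> 0 \<Longrightarrow> (\<lambda>x. \<beta>hat x t) \<in> H M K"
  using \<beta>hat_le M by (intro H_memberI \<beta>hat_lip) (auto intro: order_trans)

lemma cont_k: "t \<ge> 0 \<Longrightarrow> continuous_on {0..1} (k t)"
  and k_eq: "t \<ge> 0 \<Longrightarrow> x \<in> {0..1} \<Longrightarrow> k t x = - \<beta>hat x t + conv (\<lambda>y. \<beta>hat y t) (k t) x"
  and k_le: "t \<ge> 0 \<Longrightarrow> x \<in> {0..1} \<Longrightarrow> \<bar>k t x\<bar> \<le> \<kappa>"
  unfolding k_def \<kappa>_def by (rule kernel_op[OF cont_\<beta>hat B \<beta>hat_le]; assumption)+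

lemma khat_close: "t \<ge> 0 \<Longrightarrow> x \<in> {0..1} \<Longrightarrow> \<bar>k t x - khat x t\<bar> \<le> \<epsilon>"
proof -
  assume t: "t \<ge> 0" and x: "x \<in> {0..1}"
  let ?\<phi> = "\<lambda>y. \<beta>hat y t"
  \<comment> \<open>The accuracy condition concerns pairs; the estimate itself fills the second
    argument, and the nonnegative second summand is then dropped.\<close>
  have "\<bar>kernel_op ?\<phi> x - Khat ?\<phi> x\<bar> + \<bar>kernel_op1 ?\<phi> ?\<phi> x - Khat1 ?\<phi> ?\<phi> x\<bar> < \<epsilon>"
    using approx \<beta>hat_H[OF t] x unfolding neural_approximation_def by blast
  then show "\<bar>k t x - khat x t\<bar> \<le> \<epsilon>" by (simp add: k_def khat_def)
qed

lemma cont_khat: "continuous_on {0..1} (\<lambda>x. khat x t)"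
proof -
  have "is_deeponet 1 (\<lambda>us. Khat (us ! 0))" using approx by (simp add: neural_approximation_def)
  from deeponet_continuous[OF this, of "[\<lambda>y. \<beta>hat y t]"] show ?thesis by (simp add: khat_def[abs_def])
qed

lemma u_boundary: "t \<ge> 0 \<Longrightarrow> u 1 t = conv (\<lambda>x. khat x t) (\<lambda>x. u x t) 1"
  using plant by (simp add: plant_solution_def feedback_def conv_def)

lemma \<epsilon>_le_1: "\<epsilon> \<le> 1"
proof -
  have "1 * \<epsilon> \<le> 1024 * exp (2 * c + 9 * B) * \<epsilon>"
  proof (rule mult_right_mono)
    have "1 \<le> exp (2 * c + 9 * B)" using B c by simp
    then show "1 \<le> 1024 * exp (2 * c + 9 * B)" by linarith
  qed (use \<epsilon> in simp)
  also have "\<dots> \<le> 1" using \<epsilon>_small by simp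
  finally show ?thesis by simp
qed

lemma khat_le: "t \<ge> 0 \<Longrightarrow> x \<in> {0..1} \<Longrightarrow> \<bar>khat x t\<bar> \<le> \<kappa> + 1"
  using khat_close[of t x] k_le[of t x] \<epsilon>_le_1 by linarith

lemma \<kappa>_nonneg: "\<kappa> \<ge> 0" using B by (simp add: \<kappa>_def)

text \<open>The value 2 exp (3 B) is chosen as a majorant that turns the smallness conditions into a
  single exponential in B and c.\<close>

lemma \<kappa>_le: "\<kappa> + 2 \<le> 2 * exp (3 * B)" "1 + B \<le> 2 * exp (3 * B)"
proof -
  have e: "1 + B \<le> exp B" by (rule exp_ge_add_one_self)
  have e2: "1 \<le> exp (2 * B)" using B by simp
  have "(1 + B) * exp (2 * B) \<le> exp B * exp (2 * B)" using e by (intro mult_right_mono) auto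
  also have "\<dots> = exp (3 * B)" by (simp add: mult_exp_exp)
  finally have "(1 + B) * exp (2 * B) \<le> exp (3 * B)" .
  then show "\<kappa> + 2 \<le> 2 * exp (3 * B)" 
  proof -
    assume "(1 + B) * exp (2 * B) \<le> exp (3 * B)"
    then have "exp (2 * B) + B * exp (2 * B) \<le> exp (3 * B)" by (simp add: distrib_right)
    moreover have "\<kappa> = 2 * (B * exp (2 * B))" by (simp add: \<kappa>_def)
    ultimately show ?thesis using e2 by linarith
  qed
  have "exp B \<le> exp (3 * B)" using B by simp
  then show "1 + B \<le> 2 * exp (3 * B)" using e exp_gt_zero[of "3 * B"] by linarith
qed

lemma scale_eq: "128 * (exp c)\<^sup>2 * (2 * exp (3 * B)) ^ 3 = 1024 * exp (2 * c + 9 * B)"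
proof -
  have "exp (3 * B) ^ 3 = exp (9 * B)" using exp_of_nat_mult[of 3 "3 * B"] by simp
  moreover have "(exp c)\<^sup>2 = exp (2 * c)" by (rule exp_double[symmetric])
  moreover have "exp (2 * c) * exp (9 * B) = exp (2 * c + 9 * B)" by (rule exp_add[symmetric])
  ultimately show ?thesis by (simp only: power_mult_distrib) simp
qed

lemma lyapunov_inequality:
  assumes t: "t \<ge> 0" and v: "continuous_on {0..1} v"
  shows "lyapunov_inequality B c \<epsilon> \<gamma> \<kappa> (2 * exp (3 * B)) (\<lambda>x. \<beta>hat x t) (k t) (\<lambda>x. khat x t) \<beta> (\<lambda>x. u x t) v"
proof (rule lyapunov_inequality.intro, unfold scale_eq)
qed (assumption | rule B c \<epsilon> \<gamma> \<kappa>_le \<kappa>_nonneg \<epsilon>_small \<gamma>_small cont_\<beta>hat[OF t] cont_k[OF t] cont_khat cont_\<beta>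
      cont_u[OF t] v \<beta>hat_le[OF _ t] \<beta>_le k_eq[OF t] k_le[OF t] khat_close[OF t] u_boundary[OF t])+

lemma \<tau>_locale_eq:
  fixes v :: "real \<Rightarrow> real"
  assumes t: "t \<ge> 0" and v: "continuous_on {0..1} v"
  shows "lyapunov_inequality.\<tau> c \<gamma> (\<lambda>x. khat x t) (\<lambda>x. u x t) x = \<tau> x t"
proof -
  interpret L: lyapunov_inequality B c \<epsilon> \<gamma> \<kappa> "2 * exp (3 * B)" "\<lambda>x. \<beta>hat x t" "k t" "\<lambda>x. khat x t" \<beta> "\<lambda>x. u x t" v
    by (rule lyapunov_inequality[OF assms])
  show ?thesis
    by (simp add: L.\<tau>_def L.w_def[abs_def] \<tau>_def tau_def backstepping_def)
qed

definition good_derivative where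
  "good_derivative t v \<longleftrightarrow> continuous_on {0..1} v \<and>
     (\<forall>x\<in>{0..1}. (\<beta>hat x has_real_derivative v x) (at t) \<and> \<bar>v x\<bar> \<le> \<bar>\<tau> x t\<bar> \<and>
        (\<beta> x - \<beta>hat x t) * (\<tau> x t - v x) \<le> 0)"

lemma cont_\<tau>:
  assumes t: "t \<ge> 0"
  shows "continuous_on {0..1} (\<lambda>x. \<tau> x t)"
  by (rule continuous_on_eq[OF lyapunov_inequality.cont_\<tau>[OF lyapunov_inequality[OF t continuous_on_const]]])
    (rule \<tau>_locale_eq[OF t continuous_on_const])

text \<open>For each \<open>x\<close> the differential inclusion holds outside a null set depending on \<open>x\<close>; one null
  set serves all rational \<open>x\<close>, and the consequences used are closed conditions on \<open>x\<close>.\<close>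

lemma good_times:
  shows "\<exists>E. negligible E \<and> (\<forall>t\<ge>0. t \<notin> E \<longrightarrow> (\<exists>v. good_derivative t v))"
proof -
  have 1: "AE t in lborel. t \<ge> 0 \<longrightarrow>
        (\<exists>v\<in>H M K. \<forall>x\<in>{0..1}. (\<beta>hat x has_real_derivative v x) (at t))"
    using regular by (simp add: regular_solution_def)
  have 2: "AE t in lborel. \<forall>x\<in>\<rat> \<inter> {0..1}. t \<ge> 0 \<longrightarrow>
           (\<exists>v\<in>filippov_Proj B (\<tau> x t) (\<beta>hat x t). (\<beta>hat x has_real_derivative v) (at t))"
    using \<beta>hat_inclusion by (subst AE_ball_countable) (auto simp: countable_rat)
  obtain E where E: "negligible E" and
    P: "\<forall>t. t \<notin> E \<longrightarrow> (t \<ge> 0 \<longrightarrow> (\<exists>v\<in>H M K. \<forall>x\<in>{0..1}. (\<beta>hat x has_real_derivative v x) (at t))) \<and>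
      (\<forall>x\<in>\<rat> \<inter> {0..1}. t \<ge> 0 \<longrightarrow>
           (\<exists>v\<in>filippov_Proj B (\<tau> x t) (\<beta>hat x t). (\<beta>hat x has_real_derivative v) (at t)))"
    using AE_lborel_negligible[OF AE_conjI[OF 1 2]] by blast
  have "\<exists>v. good_derivative t v" if t: "t \<ge> 0" "t \<notin> E" for t
  proof -
    note P = P[THEN spec, THEN mp, OF t(2)]
    from P t(1) obtain v where v: "v \<in> H M K"
      "\<And>x. x \<in> {0..1} \<Longrightarrow> (\<beta>hat x has_real_derivative v x) (at t)" by blast
    have cv: "continuous_on {0..1} v" using v(1) by (simp add: H_def)
    have rat: "v x \<in> filippov_Proj B (\<tau> x t) (\<beta>hat x t)" if "x \<in> \<rat> \<inter> {0..1}" for x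
    proof -
      from P t(1) that obtain v' where "v' \<in> filippov_Proj B (\<tau> x t) (\<beta>hat x t)" "(\<beta>hat x has_real_derivative v') (at t)"
        by blast
      then show ?thesis using v(2)[of x] that DERIV_unique by blast
    qed
    have "0 \<le> \<bar>\<tau> x t\<bar> - \<bar>v x\<bar>" if "x \<in> {0..1}" for x
    proof (rule nonneg_on_rationals_imp_nonneg[OF _ _ that])
      show "continuous_on {0..1} (\<lambda>x. \<bar>\<tau> x t\<bar> - \<bar>v x\<bar>)"
        by (intro continuous_intros cont_\<tau>[OF t(1)] cv)
      show "0 \<le> \<bar>\<tau> x t\<bar> - \<bar>v x\<bar>" if "x \<in> \<rat> \<inter> {0..1}" for x
        using filippov_Proj_abs_le[OF rat[OF that]] by simp
    qed
    moreover have "0 \<le> - ((\<beta> x - \<beta>hat x t) * (\<tau> x t - v x))" if "x \<in> {0..1}" for x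
    proof (rule nonneg_on_rationals_imp_nonneg[OF _ _ that])
      show "continuous_on {0..1} (\<lambda>x. - ((\<beta> x - \<beta>hat x t) * (\<tau> x t - v x)))"
        by (intro continuous_intros cont_\<tau>[OF t(1)] cv cont_\<beta> cont_\<beta>hat t(1))
      show "0 \<le> - ((\<beta> x - \<beta>hat x t) * (\<tau> x t - v x))" if "x \<in> \<rat> \<inter> {0..1}" for x
        using filippov_Proj_error_le[OF rat[OF that] \<beta>_le] that by simp
    qed
    ultimately have "good_derivative t v" using cv v(2) by (auto simp: good_derivative_def)
    then show ?thesis by blast
  qed
  with E show ?thesis by blast
qed

section \<open>Bounds and Lipschitz continuity in time on bounded time intervals\<close>

lemma u_bounded:
  shows "\<exists>U\<ge>0. \<forall>x\<in>{0..1}. \<forall>t\<in>{0..T}. \<bar>u x t\<bar> \<le> U"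
proof -
  have "compact ((\<lambda>(x, t). u x t) ` ({0..1} \<times> {0..T}))"
    by (intro compact_continuous_image continuous_on_subset[OF u_continuous] compact_Times) auto
  from bounded_iff[THEN iffD1, OF compact_imp_bounded[OF this]]
  obtain U where U: "\<forall>y\<in>(\<lambda>(x, t). u x t) ` ({0..1} \<times> {0..T}). norm y \<le> U" by (elim exE)
  have "\<bar>u x t\<bar> \<le> \<bar>U\<bar>" if "x \<in> {0..1}" "t \<in> {0..T}" for x t
  proof -
    have "u x t \<in> (\<lambda>(x, t). u x t) ` ({0..1} \<times> {0..T})"
      by (rule image_eqI[of _ _ "(x, t)"]) (use that in simp_all)
    from bspec[OF U this] show ?thesis by simp
  qed
  then show ?thesis by (intro exI[of _ "\<bar>U\<bar>"]) auto
qed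

text \<open>The state is bounded on compact time intervals by continuity; the approximate kernel is
  bounded for all times through its distance \<open>\<epsilon>\<close> to the exact one. The bound
  is uniform in x, as the Lipschitz constant of the estimate must be.\<close>

lemma \<tau>_bounded:
  shows "\<exists>C\<ge>0. \<forall>x\<in>{0..1}. \<forall>t\<in>{0..T}. \<bar>\<tau> x t\<bar> \<le> C"
proof -
  obtain U where U: "U \<ge> 0" "\<And>x t. x \<in> {0..1} \<Longrightarrow> t \<in> {0..T} \<Longrightarrow> \<bar>u x t\<bar> \<le> U"
    using u_bounded[of T] by blast
  define w where "w = backstepping khat u"
  define Q where "Q = (1 + (\<kappa> + 1)) * U"
  have Q: "Q \<ge> 0" using U(1) \<kappa>_nonneg by (simp add: Q_def)
  have w_le: "\<bar>w x t\<bar> \<le> Q" if x: "x \<in> {0..1}" and t: "t \<in> {0..T}" for x t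
  proof -
    have t0: "t \<ge> 0" using t by simp
    have "\<bar>conv (\<lambda>y. khat y t) (\<lambda>y. u y t) x\<bar> \<le> (\<kappa> + 1) * U * x"
      using khat_le[OF t0] U(2)[OF _ t] by (intro abs_conv_le[OF x cont_khat cont_u[OF t0]]) auto
    also have "\<dots> \<le> (\<kappa> + 1) * U" using x \<kappa>_nonneg U(1) by (intro mult_left_le) auto
    finally have "\<bar>conv (\<lambda>y. khat y t) (\<lambda>y. u y t) x\<bar> \<le> (\<kappa> + 1) * U" .
    moreover have "Q = U + (\<kappa> + 1) * U" by (simp add: Q_def distrib_right)
    ultimately show ?thesis using U(2)[OF x t] unfolding w_def backstepping_def by linarith
  qed
  define m where "m = (\<lambda>t x. exp (c * x) * w x t)"
  have m_le: "\<bar>m t x\<bar> \<le> exp c * Q" if x: "x \<in> {0..1}" and t: "t \<in> {0..T}" for x t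
    unfolding m_def abs_mult using w_le[OF x t] x c by (intro mult_mono) (auto simp: mult_left_le)
  define C where "C = \<gamma> * (exp c * Q + (\<kappa> + 1) * (exp c * Q)) * Q"
  have "\<bar>\<tau> x t\<bar> \<le> C" if x: "x \<in> {0..1}" and t: "t \<in> {0..T}" for x t
  proof -
    have t0: "t \<ge> 0" using t by simp
    have cw: "continuous_on {0..1} (\<lambda>x. w x t)"
      unfolding w_def backstepping_def by (intro continuous_intros cont_khat cont_u t0)
    have cm: "continuous_on {0..1} (m t)" unfolding m_def by (intro continuous_intros cw)
    have "\<bar>integral {x..1} (\<lambda>y. khat (y - x) t * m t y)\<bar> \<le> integral {x..1} (\<lambda>y. (\<kappa> + 1) * (exp c * Q))"
    proof (rule abs_integral_le)
      show "continuous_on {x..1} (\<lambda>y. khat (y - x) t * m t y)"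
        using x by (auto intro!: continuous_intros continuous_on_compose2[OF cont_khat] continuous_on_subset[OF cm])
      show "\<bar>khat (y - x) t * m t y\<bar> \<le> (\<kappa> + 1) * (exp c * Q)" if "y \<in> {x..1}" for y
        unfolding abs_mult using that x t khat_le[OF t0] \<kappa>_nonneg by (intro mult_mono m_le khat_le t0) auto
    qed (rule continuous_on_const)
    also have "\<dots> \<le> (\<kappa> + 1) * (exp c * Q)"
    proof -
      have "(1 - x) * ((\<kappa> + 1) * (exp c * Q)) \<le> 1 * ((\<kappa> + 1) * (exp c * Q))"
        using x \<kappa>_nonneg Q by (intro mult_right_mono) auto
      then show ?thesis using x by (simp add: mult_ac)
    qed
    finally have J: "\<bar>m t x - integral {x..1} (\<lambda>y. khat (y - x) t * m t y)\<bar> \<le> exp c * Q + (\<kappa> + 1) * (exp c * Q)"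
      using m_le[OF x t] by linarith
    have n: "0 \<le> wnorm_sq c (\<lambda>y. w y t)"
      unfolding wnorm_sq_def by (intro integral_nonneg integrable_continuous_interval continuous_intros cw) simp
    have "\<bar>\<gamma> / (1 + wnorm_sq c (\<lambda>y. w y t))\<bar> \<le> \<gamma>"
      using \<gamma> n by (simp add: pos_divide_le_eq distrib_left)
    moreover have "\<tau> x t = \<gamma> / (1 + wnorm_sq c (\<lambda>y. w y t)) *
        (m t x - integral {x..1} (\<lambda>y. khat (y - x) t * m t y)) * w 0 t"
      by (simp add: \<tau>_def tau_def w_def m_def mult.assoc)
    moreover have "\<bar>w 0 t\<bar> \<le> Q" using w_le[of 0 t] t by simp
    ultimately show ?thesis
      unfolding C_def using J Q \<kappa>_nonneg \<gamma>
      by (simp only: abs_mult) (intro mult_mono; auto)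
  qed
  moreover have "C \<ge> 0" unfolding C_def using Q \<kappa>_nonneg \<gamma> by simp
  ultimately show ?thesis by blast
qed

text \<open>The null set of times at which the inclusion fails may depend on x, but the resulting
  Lipschitz constant does not, since it is a bound for \<open>\<tau>\<close>.\<close>

lemma \<beta>hat_time_lipschitz:
  assumes T: "T \<ge> 0"
  shows "\<exists>C\<ge>0. \<forall>x\<in>{0..1}. \<forall>s\<in>{0..T}. \<forall>t\<in>{0..T}. \<bar>\<beta>hat x t - \<beta>hat x s\<bar> \<le> C * \<bar>t - s\<bar>"
proof -
  obtain C where C: "C \<ge> 0" "\<And>x t. x \<in> {0..1} \<Longrightarrow> t \<in> {0..T} \<Longrightarrow> \<bar>\<tau> x t\<bar> \<le> C"
    using \<tau>_bounded[of T] by blast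
  have *: "\<bar>\<beta>hat x t - \<beta>hat x s\<bar> \<le> C * (t - s)" if x: "x \<in> {0..1}" and st: "0 \<le> s" "s \<le> t" "t \<le> T" for x s t
  proof -
    obtain E where E: "negligible E" "\<And>t. t \<notin> E \<Longrightarrow> t \<ge> 0 \<longrightarrow>
           (\<exists>v\<in>filippov_Proj B (\<tau> x t) (\<beta>hat x t). (\<beta>hat x has_real_derivative v) (at t))"
      using AE_lborel_negligible[OF \<beta>hat_inclusion[OF x]] by blast
    show ?thesis
    proof (rule abs_continuous_bounded_derivative_imp_lipschitz[OF \<beta>hat_ac[OF x T] E(1) C(1) _ st])
      fix r assume r: "r \<in> {0..T} - E"
      then obtain v where v: "v \<in> filippov_Proj B (\<tau> x r) (\<beta>hat x r)" "(\<beta>hat x has_real_derivative v) (at r)"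
        using E(2)[of r] by auto
      have "\<bar>v\<bar> \<le> C" using filippov_Proj_abs_le[OF v(1)] C(2)[OF x, of r] r by auto
      with v(2) show "\<exists>D. \<bar>D\<bar> \<le> C \<and> (\<beta>hat x has_real_derivative D) (at r)" by blast
    qed
  qed
  have "\<bar>\<beta>hat x t - \<beta>hat x s\<bar> \<le> C * \<bar>t - s\<bar>" if "x \<in> {0..1}" "s \<in> {0..T}" "t \<in> {0..T}" for x s t
    using *[of x s t] *[of x t s] that by (cases "s \<le> t") (auto simp: abs_minus_commute)
  then show ?thesis using C(1) by blast
qed

lemma boundary_lipschitz:
  shows "\<exists>L\<ge>0. \<forall>s\<in>{0..T}. \<forall>t\<in>{0..T}. \<bar>u 0 t - u 0 s\<bar> \<le> L * \<bar>t - s\<bar>"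
proof -
  have "\<forall>r<1. \<forall>T. \<exists>L. L-lipschitz_on ({0..r} \<times> {0..T}) (\<lambda>(x, t). u x t)"
    using plant by (simp add: plant_solution_def)
  then obtain L where L: "L-lipschitz_on ({0..0} \<times> {0..T}) (\<lambda>(x, t). u x t)"
    by (metis zero_less_one)
  have "\<bar>u 0 t - u 0 s\<bar> \<le> L * \<bar>t - s\<bar>" if "s \<in> {0..T}" "t \<in> {0..T}" for s t
    using lipschitz_onD[OF L, of "(0, t)" "(0, s)"] that by (simp add: dist_Pair_Pair dist_real_def)
  then show ?thesis using lipschitz_on_nonneg[OF L] by blast
qed

lemma characteristics:
  assumes "0 \<le> t" "0 \<le> h" "0 \<le> x" "x + h \<le> 1"
  shows "u x (t + h) = u (x + h) t + conv (\<lambda>y. \<beta> (x + y)) (\<lambda>r. u 0 (t + r)) h"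
  by (rule plant_characteristics[OF plant cont_\<beta> assms])

lemma u_from_boundary:
  assumes "0 \<le> t" "x \<in> {0..1}"
  shows "u x t = u 0 (t + x) - conv \<beta> (\<lambda>r. u 0 (t + r)) x"
  using characteristics[of t x 0] assms by simp

lemma cont_boundary: "t \<ge> 0 \<Longrightarrow> continuous_on {0..1} (\<lambda>r. u 0 (t + r))"
  by (rule continuous_on_compose2[OF cont_u_time[of 0]]) (auto intro!: continuous_intros)

text \<open>The assumed Lipschitz bounds of \<open>u\<close> may degenerate as x tends to 1.
  Expressing u(x, \<cdot>) by the boundary values u(0, \<cdot>), which are Lipschitz, gives a
  constant that is uniform up to x = 1.\<close>

lemma u_time_lipschitz:
  assumes T: "T \<ge> 0"
  shows "\<exists>L\<ge>0. \<forall>x\<in>{0..1}. \<forall>s\<in>{0..T}. \<forall>t\<in>{0..T}. \<bar>u x t - u x s\<bar> \<le> L * \<bar>t - s\<bar>"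
proof -
  obtain L where L: "L \<ge> 0" "\<And>s t. s \<in> {0..T + 1} \<Longrightarrow> t \<in> {0..T + 1} \<Longrightarrow> \<bar>u 0 t - u 0 s\<bar> \<le> L * \<bar>t - s\<bar>"
    using boundary_lipschitz[of "T + 1"] by blast
  have "\<bar>u x t - u x s\<bar> \<le> (L + B * L) * \<bar>t - s\<bar>" if x: "x \<in> {0..1}" and st: "s \<in> {0..T}" "t \<in> {0..T}" for x s t
  proof -
    have st0: "0 \<le> s" "0 \<le> t" using st by auto
    have "\<bar>conv \<beta> (\<lambda>r. u 0 (t + r) - u 0 (s + r)) x\<bar> \<le> B * (L * \<bar>t - s\<bar>) * x"
    proof (rule abs_conv_le[OF x cont_\<beta> _ \<beta>_le])
      show "\<bar>u 0 (t + r) - u 0 (s + r)\<bar> \<le> L * \<bar>t - s\<bar>" if "r \<in> {0..1}" for r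
        using L(2)[of "s + r" "t + r"] that st by auto
    qed (intro continuous_intros cont_boundary st0)
    also have "\<dots> \<le> B * (L * \<bar>t - s\<bar>)" using x B L(1) by (intro mult_left_le) auto
    also have "conv \<beta> (\<lambda>r. u 0 (t + r) - u 0 (s + r)) x = conv \<beta> (\<lambda>r. u 0 (t + r)) x - conv \<beta> (\<lambda>r. u 0 (s + r)) x"
      by (rule conv_diff_right[OF x cont_\<beta> cont_boundary[OF st0(2)] cont_boundary[OF st0(1)]])
    finally have "\<bar>conv \<beta> (\<lambda>r. u 0 (t + r)) x - conv \<beta> (\<lambda>r. u 0 (s + r)) x\<bar> \<le> B * L * \<bar>t - s\<bar>" by simp
    moreover have "\<bar>u 0 (t + x) - u 0 (s + x)\<bar> \<le> L * \<bar>t - s\<bar>"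
      using L(2)[of "s + x" "t + x"] x st by auto
    ultimately show ?thesis
      unfolding u_from_boundary[OF st0(2) x] u_from_boundary[OF st0(1) x] distrib_right by linarith
  qed
  moreover have "0 \<le> L + B * L" using L(1) B by simp
  ultimately show ?thesis by blast
qed

lemma u_initial_lipschitz:
  shows "\<exists>L\<ge>0. \<forall>x\<in>{0..1}. \<forall>t\<in>{0..T}. \<bar>u x t - u 0 t\<bar> \<le> L * x"
proof -
  obtain L where L: "L \<ge> 0" "\<And>s t. s \<in> {0..T + 1} \<Longrightarrow> t \<in> {0..T + 1} \<Longrightarrow> \<bar>u 0 t - u 0 s\<bar> \<le> L * \<bar>t - s\<bar>"
    using boundary_lipschitz[of "T + 1"] by blast
  obtain U where U: "U \<ge> 0" "\<And>x t. x \<in> {0..1} \<Longrightarrow> t \<in> {0..T + 1} \<Longrightarrow> \<bar>u x t\<bar> \<le> U"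
    using u_bounded[of "T + 1"] by blast
  have "\<bar>u x t - u 0 t\<bar> \<le> (L + B * U) * x" if x: "x \<in> {0..1}" and t: "t \<in> {0..T}" for x t
  proof -
    have t0: "0 \<le> t" using t by auto
    have "\<bar>conv \<beta> (\<lambda>r. u 0 (t + r)) x\<bar> \<le> B * U * x"
      using U(2)[of 0] t by (intro abs_conv_le[OF x cont_\<beta> cont_boundary[OF t0] \<beta>_le]) auto
    moreover have "\<bar>u 0 (t + x) - u 0 t\<bar> \<le> L * x"
      using L(2)[of t "t + x"] x t by auto
    ultimately show ?thesis
      unfolding u_from_boundary[OF t0 x] distrib_right by linarith
  qed
  moreover have "0 \<le> L + B * U" using L(1) U(1) B by simp
  ultimately show ?thesis by blast
qed

end

section \<open>The Lyapunov function along a trajectory\<close>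

lemma abs_integral_diff_le:
  fixes f g h :: "real \<Rightarrow> real"
  assumes "continuous_on {a..b} f" "continuous_on {a..b} g" "continuous_on {a..b} h"
    "\<And>x. x \<in> {a..b} \<Longrightarrow> \<bar>f x - g x\<bar> \<le> h x"
  shows "\<bar>integral {a..b} f - integral {a..b} g\<bar> \<le> integral {a..b} h"
  using abs_integral_le[of a b "\<lambda>x. f x - g x" h] assms
  by (simp add: integral_diff integrable_continuous_interval continuous_intros)

lemma ln_1_plus_diff_le:
  fixes x y :: real
  assumes "0 \<le> x" "0 \<le> y"
  shows "ln (1 + x) - ln (1 + y) \<le> (x - y) / (1 + y)"
  using ln_diff_le[of "1 + x" "1 + y"] assms by simp

lemma abs_ln_1_plus_diff_le:
  fixes x y :: real
  assumes "0 \<le> x" "0 \<le> y"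
  shows "\<bar>ln (1 + x) - ln (1 + y)\<bar> \<le> \<bar>x - y\<bar>"
proof -
  have *: "ln (1 + p) - ln (1 + q) \<le> \<bar>p - q\<bar>" if "0 \<le> p" "0 \<le> q" for p q :: real
  proof -
    have "(p - q) / (1 + q) \<le> \<bar>p - q\<bar> / (1 + q)" using that by (intro divide_right_mono) auto
    also have "\<dots> \<le> \<bar>p - q\<bar> / 1" using that by (intro divide_left_mono) auto
    finally show ?thesis using ln_1_plus_diff_le[OF that] by simp
  qed
  show ?thesis using *[of x y] *[of y x] assms by (simp add: abs_le_iff abs_minus_commute)
qed

context adaptive_trajectory
begin

definition N where "N t = wnorm_sq c (z t)"
definition W where "W t = integral {0..1} (\<lambda>x. (\<beta> x - \<beta>hat x t)\<^sup>2)"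
definition V where "V t = ln (1 + N t) + W t / \<gamma>"

lemma cont_z: "t \<ge> 0 \<Longrightarrow> continuous_on {0..1} (z t)"
  unfolding z_def by (intro continuous_intros cont_u cont_k)

lemma z_eq: "t \<ge> 0 \<Longrightarrow> x \<in> {0..1} \<Longrightarrow> z t x = u x t + conv (\<lambda>y. \<beta>hat y t) (z t) x"
  using volterra_solution[OF cont_\<beta>hat cont_k k_eq cont_u] by (simp add: z_def[abs_def])

lemma N_nonneg: "t \<ge> 0 \<Longrightarrow> 0 \<le> N t"
  unfolding N_def wnorm_sq_def
  by (intro integral_nonneg integrable_continuous_interval continuous_intros cont_z) auto

lemma W_nonneg: "t \<ge> 0 \<Longrightarrow> 0 \<le> W t"
  unfolding W_def
  by (intro integral_nonneg integrable_continuous_interval continuous_intros cont_\<beta> cont_\<beta>hat) auto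

lemma z_bounded: "\<exists>Q\<ge>0. \<forall>x\<in>{0..1}. \<forall>t\<in>{0..T}. \<bar>z t x\<bar> \<le> Q"
proof -
  obtain U where U: "U \<ge> 0" "\<And>x t. x \<in> {0..1} \<Longrightarrow> t \<in> {0..T} \<Longrightarrow> \<bar>u x t\<bar> \<le> U"
    using u_bounded[of T] by blast
  have "\<bar>z t x\<bar> \<le> 2 * U * exp (2 * B)" if x: "x \<in> {0..1}" and t: "t \<in> {0..T}" for x t
  proof -
    have t0: "t \<ge> 0" using t by simp
    have "\<bar>z t x\<bar> \<le> 2 * U * exp (2 * B * x)"
      by (rule conv_volterra_bound[OF cont_z[OF t0] cont_\<beta>hat[OF t0] B \<beta>hat_le[OF _ t0] z_eq[OF t0] U(2)[OF _ t] x])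
    also have "\<dots> \<le> 2 * U * exp (2 * B)"
      using U(1) x B by (intro mult_left_mono) (auto simp: mult_left_le)
    finally show ?thesis .
  qed
  then show ?thesis using U(1) by (intro exI[of _ "2 * U * exp (2 * B)"]) auto
qed

text \<open>The difference of the target states at two times solves a Volterra equation with the
  estimate at one of them as kernel; its source is the change of \<open>u\<close> plus the change of
  the estimate convolved with \<open>z\<close>. The exact kernel \<open>k\<close> need not be
  compared at the two times.\<close>

lemma z_time_lipschitz:
  assumes T: "T \<ge> 0"
  shows "\<exists>L\<ge>0. \<forall>x\<in>{0..1}. \<forall>s\<in>{0..T}. \<forall>t\<in>{0..T}. \<bar>z t x - z s x\<bar> \<le> L * \<bar>t - s\<bar>"
proof -
  obtain Q where Q: "Q \<ge> 0" "\<And>x t. x \<in> {0..1} \<Longrightarrow> t \<in> {0..T} \<Longrightarrow> \<bar>z t x\<bar> \<le> Q"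
    using z_bounded[of T] by blast
  obtain L where L: "L \<ge> 0" "\<And>x s t. x \<in> {0..1} \<Longrightarrow> s \<in> {0..T} \<Longrightarrow> t \<in> {0..T} \<Longrightarrow> \<bar>u x t - u x s\<bar> \<le> L * \<bar>t - s\<bar>"
    using u_time_lipschitz[OF T] by blast
  obtain C where C: "C \<ge> 0" "\<And>x s t. x \<in> {0..1} \<Longrightarrow> s \<in> {0..T} \<Longrightarrow> t \<in> {0..T} \<Longrightarrow> \<bar>\<beta>hat x t - \<beta>hat x s\<bar> \<le> C * \<bar>t - s\<bar>"
    using \<beta>hat_time_lipschitz[OF T] by blast
  let ?L = "2 * (L + C * Q) * exp (2 * B)"
  have "\<bar>z t x - z s x\<bar> \<le> ?L * \<bar>t - s\<bar>" if x: "x \<in> {0..1}" and s: "s \<in> {0..T}" and t: "t \<in> {0..T}" for x s t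
  proof -
    have t0: "t \<ge> 0" and s0: "s \<ge> 0" using t s by auto
    define h where "h = (\<lambda>x. (u x t - u x s) + conv (\<lambda>y. \<beta>hat y t - \<beta>hat y s) (z t) x)"
    have eq: "z t y - z s y = h y + conv (\<lambda>y. \<beta>hat y s) (\<lambda>y. z t y - z s y) y" if y: "y \<in> {0..1}" for y
      using z_eq[OF t0 y] z_eq[OF s0 y]
        conv_diff_right[OF y cont_\<beta>hat[OF s0] cont_z[OF t0] cont_z[OF s0]]
        conv_diff_left[OF y cont_z[OF t0] cont_\<beta>hat[OF t0] cont_\<beta>hat[OF s0]]
      by (simp add: h_def)
    have h_le: "\<bar>h y\<bar> \<le> (L + C * Q) * \<bar>t - s\<bar>" if y: "y \<in> {0..1}" for y
    proof -
      have "\<bar>conv (\<lambda>y. \<beta>hat y t - \<beta>hat y s) (z t) y\<bar> \<le> C * \<bar>t - s\<bar> * Q * y"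
        using C(2)[OF _ s t] Q(2)[OF _ t]
        by (intro abs_conv_le[OF y] continuous_intros cont_\<beta>hat cont_z t0 s0) auto
      also have "\<dots> \<le> C * \<bar>t - s\<bar> * Q" using y C(1) Q(1) by (intro mult_left_le) auto
      finally have "\<bar>conv (\<lambda>y. \<beta>hat y t - \<beta>hat y s) (z t) y\<bar> \<le> C * Q * \<bar>t - s\<bar>" by (simp only: ac_simps)
      then show ?thesis using L(2)[OF y s t] unfolding h_def distrib_right by linarith
    qed
    have "\<bar>z t x - z s x\<bar> \<le> 2 * ((L + C * Q) * \<bar>t - s\<bar>) * exp (2 * B * x)"
      by (rule conv_volterra_bound[OF _ cont_\<beta>hat[OF s0] B \<beta>hat_le[OF _ s0] eq h_le x])
        (intro continuous_intros cont_z t0 s0)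
    also have "\<dots> \<le> 2 * ((L + C * Q) * \<bar>t - s\<bar>) * exp (2 * B)"
      using L(1) C(1) Q(1) x B by (intro mult_left_mono) (auto simp: mult_left_le)
    finally show ?thesis by (simp only: ac_simps)
  qed
  moreover have "?L \<ge> 0" using L(1) C(1) Q(1) by simp
  ultimately show ?thesis by blast
qed

lemma V_lipschitz:
  assumes T: "T \<ge> 0"
  shows "\<exists>L. L-lipschitz_on {0..T} V"
proof -
  obtain Q where Q: "Q \<ge> 0" "\<And>x t. x \<in> {0..1} \<Longrightarrow> t \<in> {0..T} \<Longrightarrow> \<bar>z t x\<bar> \<le> Q"
    using z_bounded[of T] by blast
  obtain L where L: "L \<ge> 0" "\<And>x s t. x \<in> {0..1} \<Longrightarrow> s \<in> {0..T} \<Longrightarrow> t \<in> {0..T} \<Longrightarrow> \<bar>z t x - z s x\<bar> \<le> L * \<bar>t - s\<bar>"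
    using z_time_lipschitz[OF T] by blast
  obtain C where C: "C \<ge> 0" "\<And>x s t. x \<in> {0..1} \<Longrightarrow> s \<in> {0..T} \<Longrightarrow> t \<in> {0..T} \<Longrightarrow> \<bar>\<beta>hat x t - \<beta>hat x s\<bar> \<le> C * \<bar>t - s\<bar>"
    using \<beta>hat_time_lipschitz[OF T] by blast
  let ?L = "exp c * (2 * Q * L) + 4 * B * C / \<gamma>"
  have "\<bar>V t - V s\<bar> \<le> ?L * \<bar>t - s\<bar>" if s: "s \<in> {0..T}" and t: "t \<in> {0..T}" for s t
  proof -
    have t0: "t \<ge> 0" and s0: "s \<ge> 0" using t s by auto
    have "\<bar>N t - N s\<bar> \<le> integral {0..1} (\<lambda>x::real. exp c * (2 * Q * (L * \<bar>t - s\<bar>)))"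
      unfolding N_def wnorm_sq_def
    proof (rule abs_integral_diff_le)
      fix x :: real assume x: "x \<in> {0..1}"
      have "exp (c * x) * (z t x)\<^sup>2 - exp (c * x) * (z s x)\<^sup>2 = exp (c * x) * ((z t x + z s x) * (z t x - z s x))"
        by (simp add: power2_eq_square algebra_simps)
      also have "\<bar>\<dots>\<bar> \<le> exp c * (2 * Q * (L * \<bar>t - s\<bar>))"
        unfolding abs_mult
      proof (intro mult_mono)
        show "\<bar>exp (c * x)\<bar> \<le> exp c" using x c by (simp add: mult_left_le)
        show "\<bar>z t x + z s x\<bar> \<le> 2 * Q" using Q(2)[OF x t] Q(2)[OF x s] by linarith
      qed (use L(2)[OF x s t] Q(1) in auto)
      finally show "\<bar>exp (c * x) * (z t x)\<^sup>2 - exp (c * x) * (z s x)\<^sup>2\<bar> \<le> exp c * (2 * Q * (L * \<bar>t - s\<bar>))" .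
    qed (intro continuous_intros cont_z t0 s0)+
    then have N: "\<bar>ln (1 + N t) - ln (1 + N s)\<bar> \<le> exp c * (2 * Q * L) * \<bar>t - s\<bar>"
      using abs_ln_1_plus_diff_le[OF N_nonneg[OF t0] N_nonneg[OF s0]] by simp
    have "\<bar>W t - W s\<bar> \<le> integral {0..1} (\<lambda>x::real. 4 * B * (C * \<bar>t - s\<bar>))"
      unfolding W_def
    proof (rule abs_integral_diff_le)
      fix x :: real assume x: "x \<in> {0..1}"
      have "(\<beta> x - \<beta>hat x t)\<^sup>2 - (\<beta> x - \<beta>hat x s)\<^sup>2 = (\<beta>hat x t + \<beta>hat x s - 2 * \<beta> x) * (\<beta>hat x t - \<beta>hat x s)"
        by (simp add: power2_eq_square algebra_simps)
      also have "\<bar>\<dots>\<bar> \<le> 4 * B * (C * \<bar>t - s\<bar>)"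
        unfolding abs_mult
      proof (intro mult_mono)
        show "\<bar>\<beta>hat x t + \<beta>hat x s - 2 * \<beta> x\<bar> \<le> 4 * B"
          using \<beta>hat_le[OF x t0] \<beta>hat_le[OF x s0] \<beta>_le[OF x] by linarith
      qed (use C(2)[OF x s t] B in auto)
      finally show "\<bar>(\<beta> x - \<beta>hat x t)\<^sup>2 - (\<beta> x - \<beta>hat x s)\<^sup>2\<bar> \<le> 4 * B * (C * \<bar>t - s\<bar>)" .
    qed (intro continuous_intros cont_\<beta> cont_\<beta>hat t0 s0)+
    then have "\<bar>W t - W s\<bar> \<le> 4 * B * C * \<bar>t - s\<bar>" by simp
    then have "\<bar>W t - W s\<bar> / \<gamma> \<le> 4 * B * C * \<bar>t - s\<bar> / \<gamma>" using \<gamma> by (intro divide_right_mono) auto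
    moreover have "\<bar>W t / \<gamma> - W s / \<gamma>\<bar> = \<bar>W t - W s\<bar> / \<gamma>"
      using \<gamma> by (simp add: diff_divide_distrib[symmetric] abs_divide)
    ultimately have "\<bar>W t / \<gamma> - W s / \<gamma>\<bar> \<le> 4 * B * C / \<gamma> * \<bar>t - s\<bar>" by simp
    then show ?thesis using N unfolding V_def distrib_right by linarith
  qed
  moreover have "?L \<ge> 0" using L(1) C(1) Q(1) B \<gamma> by simp
  ultimately have "?L-lipschitz_on {0..T} V" by (auto intro!: lipschitz_onI simp: dist_real_def)
  then show ?thesis by blast
qed

text \<open>Only an upper bound is wanted, so concavity of ln replaces the increment of the
  logarithm by a linear one. The majorants \<open>q\<close> converge by the limits at a fixed time,
  and their limit is what the Lyapunov inequality estimates.\<close>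

lemma V_quotient_limit:
  assumes t: "t \<ge> 0" and good: "good_derivative t v"
  shows "\<exists>q D. q \<longlonglongrightarrow> D \<and> D \<le> - (u 0 t)\<^sup>2 / (2 * (1 + N t)) \<and>
    (\<forall>n. (V (t + step n) - V t) / step n \<le> q n)"
proof -
  define T where "T = t + 1"
  have T0: "T \<ge> 0" and tT: "t \<in> {0..T}" using t by (auto simp: T_def)
  have tn: "t + step n \<in> {0..T}" "0 \<le> t + step n" for n
    using t step_pos[of n] step_le_1[of n] by (auto simp: T_def)
  obtain Q where Q: "Q \<ge> 0" "\<And>x t. x \<in> {0..1} \<Longrightarrow> t \<in> {0..T} \<Longrightarrow> \<bar>z t x\<bar> \<le> Q"
    using z_bounded[of T] by blast
  obtain Lz where Lz: "Lz \<ge> 0" "\<And>x s t. x \<in> {0..1} \<Longrightarrow> s \<in> {0..T} \<Longrightarrow> t \<in> {0..T} \<Longrightarrow> \<bar>z t x - z s x\<bar> \<le> Lz * \<bar>t - s\<bar>"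
    using z_time_lipschitz[OF T0] by blast
  obtain C where C: "C \<ge> 0" "\<And>x s t. x \<in> {0..1} \<Longrightarrow> s \<in> {0..T} \<Longrightarrow> t \<in> {0..T} \<Longrightarrow> \<bar>\<beta>hat x t - \<beta>hat x s\<bar> \<le> C * \<bar>t - s\<bar>"
    using \<beta>hat_time_lipschitz[OF T0] by blast
  obtain U where U: "U \<ge> 0" "\<And>x t. x \<in> {0..1} \<Longrightarrow> t \<in> {0..T} \<Longrightarrow> \<bar>u x t\<bar> \<le> U"
    using u_bounded[of T] by blast
  obtain La where La: "La \<ge> 0" "\<And>s t. s \<in> {0..T} \<Longrightarrow> t \<in> {0..T} \<Longrightarrow> \<bar>u 0 t - u 0 s\<bar> \<le> La * \<bar>t - s\<bar>"
    using boundary_lipschitz[of T] by blast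
  obtain Lu where Lu: "Lu \<ge> 0" "\<And>x t. x \<in> {0..1} \<Longrightarrow> t \<in> {0..T} \<Longrightarrow> \<bar>u x t - u 0 t\<bar> \<le> Lu * x"
    using u_initial_lipschitz[of T] by blast
  from good have cv: "continuous_on {0..1} v"
    and vd: "\<And>x. x \<in> {0..1} \<Longrightarrow> (\<beta>hat x has_real_derivative v x) (at t)"
    and v_le: "\<And>x. x \<in> {0..1} \<Longrightarrow> \<bar>v x\<bar> \<le> \<bar>\<tau> x t\<bar>"
    and v_proj: "\<And>x. x \<in> {0..1} \<Longrightarrow> (\<beta> x - \<beta>hat x t) * (\<tau> x t - v x) \<le> 0"
    by (auto simp: good_derivative_def)
  have q_le: "\<bar>(\<beta>hat x (t + step n) - \<beta>hat x t) / step n\<bar> \<le> C" if x: "x \<in> {0..1}" for x n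
    using C(2)[OF x tT tn(1)[of n]] step_pos[of n] by (simp add: abs_divide pos_divide_le_eq)
  have q_lim: "(\<lambda>n. (\<beta>hat x (t + step n) - \<beta>hat x t) / step n) \<longlonglongrightarrow> v x" if x: "x \<in> {0..1}" for x
    using step_pos by (intro DERIV_sequence vd x step_tendsto_0) (simp add: less_imp_neq[symmetric])
  have K0: "K \<ge> 0" using \<beta>hat_lip[OF t] by (rule lipschitz_on_nonneg)
  interpret Q: quotient_limit B c L\<beta> K La Lu Lz U Q C \<beta> "\<lambda>x. \<beta>hat x t" "k t" "\<lambda>r. u 0 (t + r)"
      "\<lambda>x. u x t" "z t" v "\<lambda>n x. \<beta>hat x (t + step n)" "\<lambda>n x. u x (t + step n)" "\<lambda>n. z (t + step n)"
  proof
    show "\<bar>v x\<bar> \<le> C" if x: "x \<in> {0..1}" for x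
      using tendsto_rabs[OF q_lim[OF x]] q_le[OF x] by (intro LIMSEQ_le_const2) auto
    show "0 \<le> L\<beta>" using \<beta>_lip by (rule lipschitz_on_nonneg)
    show "\<bar>u 0 (t + x)\<bar> \<le> U" if "x \<in> {0..1}" for x using U(2)[of 0 "t + x"] that t by (auto simp: T_def)
    show "\<bar>u 0 (t + x) - u 0 (t + 0)\<bar> \<le> La * x" if "x \<in> {0..1}" for x
      using La(2)[of t "t + x"] that t by (auto simp: T_def)
    show "u x (t + step n) = u (x + step n) t + conv (\<lambda>y. \<beta> (x + y)) (\<lambda>r. u 0 (t + r)) (step n)"
      if "0 \<le> x" "x + step n \<le> 1" for n x
      using t step_pos[of n] that by (intro characteristics) auto
    show "\<bar>z (t + step n) x - z t x\<bar> \<le> Lz * step n" if "x \<in> {0..1}" for n x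
      using Lz(2)[OF that tT tn(1)[of n]] step_pos[of n] by simp
    show "u 0 t = u 0 (t + 0)" by simp
  qed (assumption | rule B c K0 La(1) Lu(1) Lz(1) cont_\<beta> cont_\<beta>hat[OF t] cont_k[OF t] cont_boundary[OF t] cont_u[OF t] cont_z[OF t] cv
      cont_\<beta>hat[OF tn(2)] cont_u[OF tn(2)] cont_z[OF tn(2)] \<beta>hat_le[OF _ t] \<beta>_le \<beta>_lip \<beta>hat_lip[OF t] Lu(2)[OF _ tT]
      Q(2)[OF _ tT] Q(2)[OF _ tn(1)] k_eq[OF t] z_eq[OF t] z_eq[OF tn(2)] q_le q_lim)+
  interpret L: lyapunov_inequality B c \<epsilon> \<gamma> \<kappa> "2 * exp (3 * B)" "\<lambda>x. \<beta>hat x t" "k t" "\<lambda>x. khat x t" \<beta> "\<lambda>x. u x t" v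
    by (rule lyapunov_inequality[OF t cv])
  have Lz_eq: "L.z = z t" by (simp add: fun_eq_iff L.z_def z_def)
  \<comment> \<open>The source in the Lyapunov inequality is the one found as a limit of difference
    quotients; this joins the algebraic and the analytic half of the argument.\<close>
  have Lg_eq: "L.g = Q.g"
    unfolding fun_eq_iff L.g_def Q.g_def Q.f_def[abs_def] L.bt_def Lz_eq by simp
  have LN: "L.N = N t" by (simp add: L.N_def N_def Lz_eq)
  have Lt: "L.\<tau> x = \<tau> x t" for x by (rule \<tau>_locale_eq[OF t cv])
  define DN where "DN = - c * N t - (u 0 t)\<^sup>2 + exp c * (z t 1)\<^sup>2 + 2 * integral {0..1} (\<lambda>x. exp (c * x) * z t x * Q.g x)"
  define DW where "DW = - 2 * integral {0..1} (\<lambda>x. (\<beta> x - \<beta>hat x t) * v x)"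
  have "DN / (1 + N t) - 2 / \<gamma> * integral {0..1} (\<lambda>x. (\<beta> x - \<beta>hat x t) * v x) \<le> - (u 0 t)\<^sup>2 / (2 * (1 + N t))"
    using L.decay v_le v_proj unfolding Lz_eq Lg_eq LN Lt L.bt_def DN_def by blast
  then have D: "DN / (1 + N t) + DW / \<gamma> \<le> - (u 0 t)\<^sup>2 / (2 * (1 + N t))" by (simp add: DW_def)
  define q where "q = (\<lambda>n. (N (t + step n) - N t) / step n / (1 + N t) + (W (t + step n) - W t) / step n / \<gamma>)"
  have "q \<longlonglongrightarrow> DN / (1 + N t) + DW / \<gamma>"
    unfolding q_def
  proof (intro tendsto_intros)
    show "(\<lambda>n. (N (t + step n) - N t) / step n) \<longlonglongrightarrow> DN"
      using Q.wnorm_sq_quotient_tendsto unfolding N_def DN_def Q.z0 .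
    show "(\<lambda>n. (W (t + step n) - W t) / step n) \<longlonglongrightarrow> DW"
      using Q.estimation_error_quotient_tendsto unfolding W_def DW_def .
  qed (use N_nonneg[OF t] \<gamma> in auto)
  moreover have "(V (t + step n) - V t) / step n \<le> q n" for n
  proof -
    have "V (t + step n) - V t \<le> (N (t + step n) - N t) / (1 + N t) + (W (t + step n) - W t) / \<gamma>"
      using ln_1_plus_diff_le[OF N_nonneg[OF tn(2)[of n]] N_nonneg[OF t]]
      by (simp add: V_def diff_divide_distrib)
    then have "(V (t + step n) - V t) / step n \<le> ((N (t + step n) - N t) / (1 + N t) + (W (t + step n) - W t) / \<gamma>) / step n"
      using step_pos[of n] by (intro divide_right_mono) auto
    also have "\<dots> = q n" by (simp add: q_def add_divide_distrib mult.commute)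
    finally show ?thesis .
  qed
  ultimately show ?thesis using D by blast
qed

text \<open>The parameter \<open>\<theta>\<close> allows two uses. With \<theta> = 0 it yields
  monotonicity of \<open>V\<close> and thereby a bound on \<open>N\<close>; that bound makes a
  positive constant \<open>\<theta>\<close> admissible, and the second use gives square
  integrability of u(0, \<cdot>).\<close>

lemma V_decreasing:
  assumes \<theta>: "0 \<le> \<theta>" "\<And>s. s \<in> {0..t} \<Longrightarrow> \<theta> \<le> 1 / (2 * (1 + N s))" and t: "t \<ge> 0"
  shows "V t + \<theta> * integral {0..t} (\<lambda>s. (u 0 s)\<^sup>2) \<le> V 0"
proof -
  define A where "A = (\<lambda>s. integral {0..s} (\<lambda>s. (u 0 s)\<^sup>2))"
  obtain L where L: "L-lipschitz_on {0..t + 1} V" using V_lipschitz[of "t + 1"] t by auto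
  obtain U where U: "U \<ge> 0" "\<And>x s. x \<in> {0..1} \<Longrightarrow> s \<in> {0..t + 1} \<Longrightarrow> \<bar>u x s\<bar> \<le> U"
    using u_bounded[of "t + 1"] by blast
  have ca: "continuous_on {r..s} (\<lambda>s. (u 0 s)\<^sup>2)" if "0 \<le> r" for r s
    by (intro continuous_intros continuous_on_subset[OF cont_u_time[of 0]]) (use that in auto)
  have A_diff: "A s - A r = integral {r..s} (\<lambda>s. (u 0 s)\<^sup>2)" if "0 \<le> r" "r \<le> s" for r s
    using Henstock_Kurzweil_Integration.integral_combine[of 0 r s "\<lambda>s. (u 0 s)\<^sup>2"] that
      integrable_continuous_interval[OF ca[of 0 s]] by (simp add: A_def)
  have A_le: "\<bar>A s - A r\<bar> \<le> U\<^sup>2 * (s - r)" if "0 \<le> r" "r \<le> s" "s \<le> t + 1" for r s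
  proof -
    have "\<bar>integral {r..s} (\<lambda>s. (u 0 s)\<^sup>2)\<bar> \<le> integral {r..s} (\<lambda>_. U\<^sup>2)"
    proof (rule abs_integral_le[OF ca])
      show "\<bar>(u 0 q)\<^sup>2\<bar> \<le> U\<^sup>2" if "q \<in> {r..s}" for q
        using U(2)[of 0 q] that \<open>0 \<le> r\<close> \<open>s \<le> t + 1\<close> abs_le_square_iff[of "u 0 q" U] U(1) by auto
    qed (use that in auto)
    then show ?thesis using A_diff[OF that(1,2)] that(2) by (simp add: mult.commute)
  qed
  have LA: "(U\<^sup>2)-lipschitz_on {0..t + 1} A"
  proof (rule lipschitz_onI)
    fix r s assume "r \<in> {0..t + 1}" "s \<in> {0..t + 1}"
    then show "dist (A r) (A s) \<le> U\<^sup>2 * dist r s"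
      using A_le[of r s] A_le[of s r] by (cases "r \<le> s") (auto simp: dist_real_def abs_minus_commute)
  qed simp
  obtain E where E: "negligible E" "\<And>s. s \<ge> 0 \<Longrightarrow> s \<notin> E \<Longrightarrow> \<exists>v. good_derivative s v"
    using good_times by blast
  have "V t + \<theta> * A t \<le> V 0 + \<theta> * A 0"
  proof (rule lipschitz_nonincreasing[OF _ t E(1), where L = "L + \<bar>\<theta>\<bar> * U\<^sup>2"])
    show "(L + \<bar>\<theta>\<bar> * U\<^sup>2)-lipschitz_on {0..t + 1} (\<lambda>s. V s + \<theta> * A s)"
      by (intro lipschitz_on_add L lipschitz_on_cmult_real LA)
    fix s e :: real assume s: "s \<in> {0..t} - E" and e: "e > 0"
    then have s0: "s \<ge> 0" by simp
    from E(2)[OF s0] s obtain v where "good_derivative s v" by blast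
    from V_quotient_limit[OF s0 this] obtain q D where q: "q \<longlonglongrightarrow> D" "D \<le> - (u 0 s)\<^sup>2 / (2 * (1 + N s))"
      "\<And>n. (V (s + step n) - V s) / step n \<le> q n" by blast
    have "(A has_real_derivative (u 0 s)\<^sup>2) (at s within {0..s + 1})"
      unfolding A_def using s0 by (intro integral_has_real_derivative ca) auto
    then have "((\<lambda>r. (A r - A s) / (r - s)) \<longlongrightarrow> (u 0 s)\<^sup>2) (at s within {0..s + 1})"
      by (simp add: has_field_derivative_iff)
    then have "((\<lambda>r. (A r - A s) / (r - s)) \<circ> (\<lambda>n. s + step n)) \<longlonglongrightarrow> (u 0 s)\<^sup>2"
      unfolding tendsto_at_iff_sequentially
    proof (elim allE[of _ "\<lambda>n. s + step n"] impE)
      show "\<forall>i. s + step i \<in> {0..s + 1} - {s}"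
        using step_pos step_le_1 s0 by (auto simp: less_imp_neq[symmetric] add_nonneg_nonneg less_imp_le)
      show "(\<lambda>n. s + step n) \<longlonglongrightarrow> s" using tendsto_add[OF tendsto_const step_tendsto_0, of s] by simp
    qed
    then have A: "(\<lambda>n. (A (s + step n) - A s) / step n) \<longlonglongrightarrow> (u 0 s)\<^sup>2" by (simp add: o_def)
    have lim: "(\<lambda>n. q n + \<theta> * ((A (s + step n) - A s) / step n)) \<longlonglongrightarrow> D + \<theta> * (u 0 s)\<^sup>2"
      by (intro tendsto_intros q(1) A)
    have "\<theta> * (u 0 s)\<^sup>2 \<le> 1 / (2 * (1 + N s)) * (u 0 s)\<^sup>2"
      using \<theta>(2)[of s] s by (intro mult_right_mono) auto
    then have "D + \<theta> * (u 0 s)\<^sup>2 < e" using q(2) e by simp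
    from order_tendstoD(2)[OF lim this]
    show "eventually (\<lambda>n. ((V (s + step n) + \<theta> * A (s + step n)) - (V s + \<theta> * A s)) / step n \<le> e) sequentially"
    proof eventually_elim
      case (elim n)
      have "((V (s + step n) + \<theta> * A (s + step n)) - (V s + \<theta> * A s)) / step n =
         (V (s + step n) - V s) / step n + \<theta> * ((A (s + step n) - A s) / step n)"
        by (simp add: diff_divide_distrib add_divide_distrib right_diff_distrib)
      then show ?case using q(3)[of n] elim by linarith
    qed
  qed
  then show ?thesis by (simp add: A_def)
qed

lemma V_le: "t \<ge> 0 \<Longrightarrow> V t \<le> V 0"
  using V_decreasing[of 0 t] N_nonneg by simp

end

section \<open>Boundedness and convergence\<close>

text \<open>Used in both directions between \<open>u\<close> and \<open>z\<close>, which differ by a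
  convolution. It rests on f^2 \<le> 2 g^2 + 2 (f - g)^2 and Cauchy-Schwarz.\<close>

lemma integral_square_perturbation_le:
  fixes f g :: "real \<Rightarrow> real"
  assumes f: "continuous_on {0..1} f" and g: "continuous_on {0..1} g"
    and le: "\<And>x. x \<in> {0..1} \<Longrightarrow> \<bar>f x - g x\<bar> \<le> P * integral {0..1} (\<lambda>y. \<bar>g y\<bar>)"
  shows "integral {0..1} (\<lambda>x. (f x)\<^sup>2) \<le> (2 + 2 * P\<^sup>2) * integral {0..1} (\<lambda>x. (g x)\<^sup>2)"
proof -
  define G where "G = integral {0..1} (\<lambda>y. \<bar>g y\<bar>)"
  have "(f x)\<^sup>2 \<le> 2 * (g x)\<^sup>2 + 2 * P\<^sup>2 * G\<^sup>2" if "x \<in> {0..1}" for x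
  proof -
    have "(f x - g x)\<^sup>2 \<le> (P * G)\<^sup>2"
      using power_mono[OF le[OF that], of 2] by (simp add: G_def)
    moreover have "(f x)\<^sup>2 \<le> 2 * (g x)\<^sup>2 + 2 * (f x - g x)\<^sup>2"
    proof -
      have "2 * (g x)\<^sup>2 + 2 * (f x - g x)\<^sup>2 - (f x)\<^sup>2 = (f x - 2 * g x)\<^sup>2"
        by (simp add: power2_eq_square algebra_simps)
      then show ?thesis using zero_le_power2[of "f x - 2 * g x"] by linarith
    qed
    ultimately show ?thesis by (simp add: power_mult_distrib)
  qed
  then have "integral {0..1} (\<lambda>x. (f x)\<^sup>2) \<le> integral {0..1} (\<lambda>x. 2 * (g x)\<^sup>2 + 2 * P\<^sup>2 * G\<^sup>2)"
    by (intro integral_mono_interval continuous_intros f g) auto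
  also have "\<dots> = integral {0..1} (\<lambda>x. 2 * (g x)\<^sup>2) + integral {0..1} (\<lambda>x::real. 2 * P\<^sup>2 * G\<^sup>2)"
    by (intro integral_add integrable_continuous_interval continuous_intros g)
  also have "\<dots> = 2 * integral {0..1} (\<lambda>x. (g x)\<^sup>2) + 2 * P\<^sup>2 * G\<^sup>2" by simp
  also have "\<dots> \<le> 2 * integral {0..1} (\<lambda>x. (g x)\<^sup>2) + 2 * P\<^sup>2 * integral {0..1} (\<lambda>x. (g x)\<^sup>2)"
    unfolding G_def by (intro add_left_mono mult_left_mono integral_abs_squared_le g) simp
  finally show ?thesis by (simp add: distrib_right)
qed

lemma filterlim_add_at_top: "filterlim (\<lambda>t. t + a) at_top (at_top :: real filter)"
  unfolding filterlim_at_top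
proof
  fix Z :: real
  show "eventually (\<lambda>t. Z \<le> t + a) at_top"
    using eventually_ge_at_top[of "Z - a"] by eventually_elim simp
qed

lemma bounded_mono_increment_tendsto_0:
  fixes G :: "real \<Rightarrow> real"
  assumes mono: "\<And>s t. 0 \<le> s \<Longrightarrow> s \<le> t \<Longrightarrow> G s \<le> G t" and bound: "\<And>t. 0 \<le> t \<Longrightarrow> G t \<le> b"
  shows "((\<lambda>t. G (t + 1) - G t) \<longlongrightarrow> 0) at_top"
proof (rule tendstoI)
  fix e :: real assume e: "e > 0"
  have bdd: "bdd_above (G ` {0..})" using bound by (intro bdd_aboveI[of _ b]) auto
  obtain T where T: "T \<ge> 0" "Sup (G ` {0..}) - e < G T"
    using less_cSup_iff[OF _ bdd, of "Sup (G ` {0..}) - e"] e by auto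
  show "eventually (\<lambda>t. dist (G (t + 1) - G t) 0 < e) at_top"
    using eventually_ge_at_top[of T]
  proof eventually_elim
    case (elim t)
    have "G (t + 1) \<le> Sup (G ` {0..})" using elim T(1) by (intro cSup_upper bdd) auto
    moreover have "G T \<le> G t" "G t \<le> G (t + 1)" using elim T(1) by (auto intro: mono)
    ultimately show ?case using T(2) by (simp add: dist_real_def)
  qed
qed

context adaptive_trajectory
begin

section \<open>Comparison of the Lyapunov function with the norm to be bounded\<close>

lemma u_energy_le:
  assumes t: "t \<ge> 0"
  shows "integral {0..1} (\<lambda>x. (u x t)\<^sup>2) \<le> (2 + 2 * B\<^sup>2) * integral {0..1} (\<lambda>x. (z t x)\<^sup>2)"
proof (rule integral_square_perturbation_le[OF cont_u[OF t] cont_z[OF t]])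
  fix x :: real assume x: "x \<in> {0..1}"
  have "\<bar>conv (\<lambda>y. \<beta>hat y t) (z t) x\<bar> \<le> B * integral {0..x} (\<lambda>y. \<bar>z t y\<bar>)"
    by (rule abs_conv_le_integral[OF x cont_\<beta>hat[OF t] cont_z[OF t] \<beta>hat_le[OF _ t]])
  also have "\<dots> \<le> B * integral {0..1} (\<lambda>y. \<bar>z t y\<bar>)"
    using B x by (intro mult_left_mono integral_initial_le continuous_intros cont_z t) auto
  finally show "\<bar>u x t - z t x\<bar> \<le> B * integral {0..1} (\<lambda>y. \<bar>z t y\<bar>)"
    using z_eq[OF t x] by simp
qed

lemma z_energy_le:
  assumes t: "t \<ge> 0"
  shows "integral {0..1} (\<lambda>x. (z t x)\<^sup>2) \<le> (2 + 2 * \<kappa>\<^sup>2) * integral {0..1} (\<lambda>x. (u x t)\<^sup>2)"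
proof (rule integral_square_perturbation_le[OF cont_z[OF t] cont_u[OF t]])
  fix x :: real assume x: "x \<in> {0..1}"
  have "\<bar>conv (k t) (\<lambda>y. u y t) x\<bar> \<le> \<kappa> * integral {0..x} (\<lambda>y. \<bar>u y t\<bar>)"
    by (rule abs_conv_le_integral[OF x cont_k[OF t] cont_u[OF t] k_le[OF t]])
  also have "\<dots> \<le> \<kappa> * integral {0..1} (\<lambda>y. \<bar>u y t\<bar>)"
    using \<kappa>_nonneg x by (intro mult_left_mono integral_initial_le continuous_intros cont_u t) auto
  finally show "\<bar>z t x - u x t\<bar> \<le> \<kappa> * integral {0..1} (\<lambda>y. \<bar>u y t\<bar>)"
    by (simp add: z_def)
qed

lemma Gamma_eq: "t \<ge> 0 \<Longrightarrow> Gamma_fun \<beta> \<beta>hat u t = integral {0..1} (\<lambda>x. (u x t)\<^sup>2) + W t"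
  unfolding Gamma_fun_def W_def
  by (intro integral_add integrable_continuous_interval continuous_intros cont_u cont_\<beta> cont_\<beta>hat)

lemma N_le: "t \<ge> 0 \<Longrightarrow> 1 + N t \<le> exp (V 0)"
proof -
  assume t: "t \<ge> 0"
  have "ln (1 + N t) \<le> V t" using W_nonneg[OF t] \<gamma> by (simp add: V_def)
  then have "exp (ln (1 + N t)) \<le> exp (V 0)" using V_le[OF t] by simp
  then show "1 + N t \<le> exp (V 0)" using N_nonneg[OF t] by simp
qed

lemma V_nonneg: "t \<ge> 0 \<Longrightarrow> 0 \<le> V t"
  unfolding V_def using N_nonneg[of t] W_nonneg[of t] \<gamma> by (intro add_nonneg_nonneg) auto

text \<open>The outer factor is the cost of recovering \<Gamma> from \<open>V\<close>: 2 + 2 B^2 for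
  returning from \<open>z\<close> to \<open>u\<close>, and \<open>\<gamma>\<close> for the
  estimation error. The exponent is the cost of the opposite passage at time 0: exp c for the
  weight, 2 + 2 \<kappa>^2 for the transformation, 1 / \<gamma> for the error. Since exp (V 0) - 1
  dominates both \<open>N t\<close> and \<open>V 0\<close>, it serves both parts of
  \<Gamma>.\<close>

lemma Gamma_bound:
  assumes t: "t \<ge> 0"
  shows "Gamma_fun \<beta> \<beta>hat u t \<le> (2 + 2 * B\<^sup>2 + \<gamma>) *
    (exp ((exp c * (2 + 2 * \<kappa>\<^sup>2) + 1 / \<gamma>) * Gamma_fun \<beta> \<beta>hat u 0) - 1)"
proof -
  let ?I = "\<lambda>t. integral {0..1} (\<lambda>x. (u x t)\<^sup>2)"
  have I0: "0 \<le> ?I 0" by (intro integral_nonneg integrable_continuous_interval continuous_intros cont_u) auto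
  have "integral {0..1} (\<lambda>x. (z t x)\<^sup>2) \<le> N t"
    unfolding N_def using c by (intro wnorm_sq_bounds cont_z t) auto
  then have "integral {0..1} (\<lambda>x. (z t x)\<^sup>2) \<le> exp (V 0) - 1" using N_le[OF t] by simp
  then have "(2 + 2 * B\<^sup>2) * integral {0..1} (\<lambda>x. (z t x)\<^sup>2) \<le> (2 + 2 * B\<^sup>2) * (exp (V 0) - 1)"
    by (intro mult_left_mono) auto
  then have I: "?I t \<le> (2 + 2 * B\<^sup>2) * (exp (V 0) - 1)" using u_energy_le[OF t] by linarith
  have "W t / \<gamma> \<le> V t" using N_nonneg[OF t] by (simp add: V_def)
  then have "W t / \<gamma> \<le> V 0" using V_le[OF t] by linarith
  then have "W t / \<gamma> \<le> exp (V 0) - 1" using exp_ge_add_one_self[of "V 0"] by linarith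
  then have "W t \<le> \<gamma> * (exp (V 0) - 1)" using \<gamma> by (simp add: pos_divide_le_eq mult.commute)
  with I have 1: "Gamma_fun \<beta> \<beta>hat u t \<le> (2 + 2 * B\<^sup>2 + \<gamma>) * (exp (V 0) - 1)"
    by (simp add: Gamma_eq[OF t] distrib_right)
  have "ln (1 + N 0) \<le> N 0" using N_nonneg[of 0] by (intro ln_add_one_self_le_self) auto
  also have "N 0 \<le> exp c * integral {0..1} (\<lambda>x. (z 0 x)\<^sup>2)"
    unfolding N_def using c by (intro wnorm_sq_bounds cont_z) auto
  also have "\<dots> \<le> exp c * ((2 + 2 * \<kappa>\<^sup>2) * ?I 0)" using z_energy_le[of 0] by simp
  finally have "V 0 \<le> exp c * (2 + 2 * \<kappa>\<^sup>2) * ?I 0 + 1 / \<gamma> * W 0" by (simp add: V_def mult.assoc)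
  also have "\<dots> \<le> (exp c * (2 + 2 * \<kappa>\<^sup>2) + 1 / \<gamma>) * ?I 0 + (exp c * (2 + 2 * \<kappa>\<^sup>2) + 1 / \<gamma>) * W 0"
    using I0 W_nonneg[of 0] \<gamma> by (intro add_mono mult_right_mono) auto
  also have "\<dots> = (exp c * (2 + 2 * \<kappa>\<^sup>2) + 1 / \<gamma>) * Gamma_fun \<beta> \<beta>hat u 0"
    by (simp add: Gamma_eq distrib_left)
  finally have "exp (V 0) - 1 \<le> exp ((exp c * (2 + 2 * \<kappa>\<^sup>2) + 1 / \<gamma>) * Gamma_fun \<beta> \<beta>hat u 0) - 1" by simp
  then have "(2 + 2 * B\<^sup>2 + \<gamma>) * (exp (V 0) - 1) \<le> (2 + 2 * B\<^sup>2 + \<gamma>) *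
     (exp ((exp c * (2 + 2 * \<kappa>\<^sup>2) + 1 / \<gamma>) * Gamma_fun \<beta> \<beta>hat u 0) - 1)"
    using \<gamma> by (intro mult_left_mono) (auto intro: add_nonneg_nonneg)
  then show ?thesis using 1 by linarith
qed

section \<open>Convergence of the state to zero\<close>

definition \<mu> where "\<mu> t = integral {0..1} (\<lambda>r. \<bar>u 0 (t + r)\<bar>)"

lemma \<mu>_tendsto_0: "(\<mu> \<longlongrightarrow> 0) at_top"
proof -
  define G where "G = (\<lambda>t. integral {0..t} (\<lambda>s. (u 0 s)\<^sup>2))"
  have ca: "continuous_on {r..s} (\<lambda>s. (u 0 s)\<^sup>2)" if "0 \<le> r" for r s
    by (intro continuous_intros continuous_on_subset[OF cont_u_time[of 0]]) (use that in auto)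
  have G_diff: "G s - G r = integral {r..s} (\<lambda>s. (u 0 s)\<^sup>2)" if "0 \<le> r" "r \<le> s" for r s
    using Henstock_Kurzweil_Integration.integral_combine[of 0 r s "\<lambda>s. (u 0 s)\<^sup>2"] that
      integrable_continuous_interval[OF ca[of 0 s]] by (simp add: G_def)
  have G_lim: "((\<lambda>t. G (t + 1) - G t) \<longlongrightarrow> 0) at_top"
  proof (rule bounded_mono_increment_tendsto_0)
    fix s t :: real assume "0 \<le> s" "s \<le> t"
    then have "0 \<le> G t - G s"
      unfolding G_diff[OF \<open>0 \<le> s\<close> \<open>s \<le> t\<close>] by (intro integral_nonneg integrable_continuous_interval ca) auto
    then show "G s \<le> G t" by simp
  next
    fix t :: real assume t: "0 \<le> t"
    let ?\<theta> = "1 / (2 * exp (V 0))"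
    have "V t + ?\<theta> * G t \<le> V 0"
      unfolding G_def
    proof (rule V_decreasing[OF _ _ t])
      show "?\<theta> \<le> 1 / (2 * (1 + N s))" if "s \<in> {0..t}" for s
        using N_le[of s] N_nonneg[of s] that by (intro divide_left_mono) auto
    qed simp
    then have "?\<theta> * G t \<le> V 0" using V_nonneg[OF t] by linarith
    then show "G t \<le> V 0 * (2 * exp (V 0))" by (simp add: pos_divide_le_eq)
  qed
  have sq: "(\<mu> t)\<^sup>2 \<le> G (t + 1) - G t" if t: "t \<ge> 0" for t
  proof -
    have "(\<mu> t)\<^sup>2 \<le> integral {0..1} (\<lambda>r. (u 0 (t + r))\<^sup>2)"
      unfolding \<mu>_def by (rule integral_abs_squared_le[OF cont_boundary[OF t]])
    also have "\<dots> = integral {t..t + 1} (\<lambda>s. (u 0 s)\<^sup>2)"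
      using integral_shift_Icc_real[of 0 1 "\<lambda>s. (u 0 s)\<^sup>2" t] by (simp add: o_def add.commute)
    finally show ?thesis using G_diff[of t "t + 1"] t by simp
  qed
  have "eventually (\<lambda>t. norm ((\<mu> t)\<^sup>2) \<le> G (t + 1) - G t) at_top"
    using eventually_ge_at_top[of 0] by eventually_elim (use sq in simp)
  then have "((\<lambda>t. (\<mu> t)\<^sup>2) \<longlongrightarrow> 0) at_top"
    by (rule Lim_null_comparison) (rule G_lim)
  from tendsto_real_sqrt[OF this] have "((\<lambda>t. \<bar>\<mu> t\<bar>) \<longlongrightarrow> 0) at_top" by simp
  then show ?thesis by (simp add: tendsto_rabs_zero_iff)
qed

lemma conv_boundary_le:
  assumes t: "t \<ge> 0" and x: "x \<in> {0..1}"
  shows "\<bar>conv \<beta> (\<lambda>r. u 0 (t + r)) x\<bar> \<le> B * \<mu> t"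
proof -
  have "\<bar>conv \<beta> (\<lambda>r. u 0 (t + r)) x\<bar> \<le> B * integral {0..x} (\<lambda>r. \<bar>u 0 (t + r)\<bar>)"
    by (rule abs_conv_le_integral[OF x cont_\<beta> cont_boundary[OF t] \<beta>_le])
  also have "\<dots> \<le> B * \<mu> t"
    unfolding \<mu>_def using B x by (intro mult_left_mono integral_initial_le continuous_intros cont_boundary t) auto
  finally show ?thesis .
qed

lemma u_le_boundary:
  assumes t: "t \<ge> 0" and x: "x \<in> {0..1}"
  shows "\<bar>u x t\<bar> \<le> \<bar>u 0 (t + x)\<bar> + B * \<mu> t"
  using conv_boundary_le[OF assms] u_from_boundary[OF assms] by linarith

text \<open>Square integrability gives decay in the mean only. The pointwise bound comes from the
  characteristic that starts at x = 1: it carries u(1, t) to u(0, t + 1), and u(1, t) is set by the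
  feedback, which is an integral of the state.\<close>

lemma boundary_le_\<mu>:
  assumes t: "t \<ge> 0"
  shows "\<bar>u 0 (t + 1)\<bar> \<le> ((\<kappa> + 1) * (1 + B) + B) * \<mu> t"
proof -
  have 1: "(1::real) \<in> {0..1}" by simp
  have "\<bar>u 1 t\<bar> \<le> (\<kappa> + 1) * integral {0..1} (\<lambda>x. \<bar>u x t\<bar>)"
    unfolding u_boundary[OF t] by (rule abs_conv_le_integral[OF 1 cont_khat cont_u[OF t] khat_le[OF t]])
  also have "\<dots> \<le> (\<kappa> + 1) * ((1 + B) * \<mu> t)"
  proof (rule mult_left_mono)
    have "integral {0..1} (\<lambda>x. \<bar>u x t\<bar>) \<le> integral {0..1} (\<lambda>x. \<bar>u 0 (t + x)\<bar> + B * \<mu> t)"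
      using u_le_boundary[OF t] by (intro integral_mono_interval continuous_intros cont_u cont_boundary t)
    also have "\<dots> = \<mu> t + integral {0..1} (\<lambda>x::real. B * \<mu> t)"
      unfolding \<mu>_def by (intro integral_add integrable_continuous_interval continuous_intros cont_boundary t)
    finally show "integral {0..1} (\<lambda>x. \<bar>u x t\<bar>) \<le> (1 + B) * \<mu> t" by (simp add: distrib_right)
  qed (use \<kappa>_nonneg in simp)
  finally have "\<bar>u 1 t\<bar> \<le> (\<kappa> + 1) * (1 + B) * \<mu> t" by simp
  then show ?thesis
    using conv_boundary_le[OF t 1] u_from_boundary[OF t 1] unfolding distrib_right[of _ B "\<mu> t"] by linarith
qed

lemma u_tendsto_0:
  assumes x: "x \<in> {0..1}"
  shows "((\<lambda>t. u x t) \<longlongrightarrow> 0) at_top"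
proof -
  let ?C = "(\<kappa> + 1) * (1 + B) + B"
  have "((\<lambda>t. u 0 (t + 1)) \<longlongrightarrow> 0) at_top"
  proof (rule Lim_null_comparison)
    show "eventually (\<lambda>t. norm (u 0 (t + 1)) \<le> ?C * \<mu> t) at_top"
      using eventually_ge_at_top[of 0] by eventually_elim (use boundary_le_\<mu> in simp)
    show "((\<lambda>t. ?C * \<mu> t) \<longlongrightarrow> 0) at_top" using tendsto_mult_left[OF \<mu>_tendsto_0, of ?C] by simp
  qed
  from filterlim_compose[OF this filterlim_add_at_top[of "x - 1"]]
  have a: "((\<lambda>t. u 0 (t + x)) \<longlongrightarrow> 0) at_top" by (simp add: algebra_simps)
  show ?thesis
  proof (rule Lim_null_comparison)
    show "eventually (\<lambda>t. norm (u x t) \<le> \<bar>u 0 (t + x)\<bar> + B * \<mu> t) at_top"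
      using eventually_ge_at_top[of 0] by eventually_elim (use u_le_boundary[OF _ x] in simp)
    show "((\<lambda>t. \<bar>u 0 (t + x)\<bar> + B * \<mu> t) \<longlongrightarrow> 0) at_top"
      using tendsto_add[OF tendsto_rabs_zero[OF a] tendsto_mult_left[OF \<mu>_tendsto_0, of B]] by simp
  qed
qed

end

theorem theorem4:
  shows "\<exists>\<epsilon>0 \<gamma>0 :: real \<Rightarrow> real \<Rightarrow> real.
    (\<forall>B>0. \<forall>c>0. \<epsilon>0 B c > 0 \<and> \<gamma>0 B c > 0) \<and>
    (\<forall>B>0. (\<lambda>c. \<epsilon>0 B c) \<in> O[at_top](\<lambda>c. c * exp (- c / 2)) \<and>
            (\<lambda>c. \<gamma>0 B c) \<in> O[at_top](\<lambda>c. exp (- c))) \<and>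
    (\<forall>c>0. strict_antimono_on {0<..} (\<lambda>B. \<epsilon>0 B c) \<and>
            strict_antimono_on {0<..} (\<lambda>B. \<gamma>0 B c)) \<and>
    (\<forall>B>0. \<forall>c>0. \<forall>\<epsilon>\<in>{0<..<\<epsilon>0 B c}. \<forall>\<gamma>\<in>{0<..<\<gamma>0 B c}.
      \<exists>\<rho>>0. \<exists>R>0.
        \<forall>M\<ge>B. \<forall>K>0. \<forall>Khat Khat1 \<beta> \<beta>hat u.
          neural_approximation M K \<epsilon> Khat Khat1 \<longrightarrow>
          (\<exists>L. L-lipschitz_on {0..1} \<beta>) \<longrightarrow> sup_norm \<beta> \<le> B \<longrightarrow>
          (\<exists>L. L-lipschitz_on {0..1} (\<lambda>x. \<beta>hat x 0)) \<longrightarrow> sup_norm (\<lambda>x. \<beta>hat x 0) \<le> B \<longrightarrow>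
          closed_loop B c \<gamma> Khat \<beta> \<beta>hat u \<longrightarrow>
          regular_solution M K Khat \<beta>hat \<longrightarrow>
            (\<forall>t\<ge>0. Gamma_fun \<beta> \<beta>hat u t \<le> R * (exp (\<rho> * Gamma_fun \<beta> \<beta>hat u 0) - 1)) \<and>
            (\<forall>x\<in>{0..1}. ((\<lambda>t. u x t) \<longlongrightarrow> 0) at_top))"
proof -
  \<comment> \<open>The factor is \<open>128 (exp c)\<^sup>2 A\<^sup>3\<close> of the Lyapunov inequality for \<open>A = 2 exp (3 B)\<close>.\<close>
  define e where "e = (\<lambda>B c :: real. min 1 c * exp (- (2 * c + 9 * B)) / 1024)"
  have pos: "e B c > 0" if "c > 0" for B c using that by (simp add: e_def)
  have e_le: "e B c \<le> min 1 c * exp (- c)" if "B > 0" "c > 0" for B c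
  proof -
    have "min 1 c * exp (- (2 * c + 9 * B)) / 1024 \<le> min 1 c * exp (- (2 * c + 9 * B)) / 1"
      using that by (intro divide_left_mono) auto
    also have "\<dots> \<le> min 1 c * exp (- c)" using that by simp
    finally show ?thesis by (simp add: e_def)
  qed
  \<comment> \<open>\<open>e\<close> serves both as \<open>\<epsilon>0\<close> and as
    \<open>\<gamma>0\<close>. For large c it is a multiple of exp (- 2 c); both order conditions are
    read off the cruder bound min 1 c exp (- c).\<close>
  have O1: "(\<lambda>c. e B c) \<in> O[at_top](\<lambda>c. c * exp (- c / 2))" if B: "B > 0" for B
  proof (rule bigoI[where c = 1])
    show "eventually (\<lambda>c. norm (e B c) \<le> 1 * norm (c * exp (- c / 2))) at_top"
      using eventually_gt_at_top[of 0]
    proof eventually_elim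
      case (elim c)
      have "min 1 c * exp (- c) \<le> c * exp (- c / 2)" using elim by (intro mult_mono) auto
      then show ?case using e_le[OF B elim] pos[OF elim, of B] elim by simp
    qed
  qed
  have O2: "(\<lambda>c. e B c) \<in> O[at_top](\<lambda>c. exp (- c))" if B: "B > 0" for B
  proof (rule bigoI[where c = 1])
    show "eventually (\<lambda>c. norm (e B c) \<le> 1 * norm (exp (- c))) at_top"
      using eventually_gt_at_top[of 0]
    proof eventually_elim
      case (elim c)
      have "min 1 c * exp (- c) \<le> 1 * exp (- c)" using elim by (intro mult_right_mono) auto
      then have "e B c \<le> exp (- c)" using e_le[OF B elim] by linarith
      then show ?case using pos[OF elim, of B] by simp
    qed
  qed
  have anti: "strict_antimono_on {0<..} (\<lambda>B. e B c)" if "c > 0" for c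
    using that by (intro monotone_onI) (simp add: e_def)
  have main: "\<exists>\<rho>>0. \<exists>R>0.
        \<forall>M\<ge>B. \<forall>K>0. \<forall>Khat Khat1 \<beta> \<beta>hat u.
          neural_approximation M K \<epsilon> Khat Khat1 \<longrightarrow>
          (\<exists>L. L-lipschitz_on {0..1} \<beta>) \<longrightarrow> sup_norm \<beta> \<le> B \<longrightarrow>
          (\<exists>L. L-lipschitz_on {0..1} (\<lambda>x. \<beta>hat x 0)) \<longrightarrow> sup_norm (\<lambda>x. \<beta>hat x 0) \<le> B \<longrightarrow>
          closed_loop B c \<gamma> Khat \<beta> \<beta>hat u \<longrightarrow>
          regular_solution M K Khat \<beta>hat \<longrightarrow>
            (\<forall>t\<ge>0. Gamma_fun \<beta> \<beta>hat u t \<le> R * (exp (\<rho> * Gamma_fun \<beta> \<beta>hat u 0) - 1)) \<and>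
            (\<forall>x\<in>{0..1}. ((\<lambda>t. u x t) \<longlongrightarrow> 0) at_top)"
    if B: "B > 0" and c: "c > 0" and \<epsilon>: "\<epsilon> \<in> {0<..<e B c}" and \<gamma>: "\<gamma> \<in> {0<..<e B c}" for B c \<epsilon> \<gamma>
  proof -
    have small: "1024 * exp (2 * c + 9 * B) * \<delta> \<le> min 1 c" if "\<delta> \<in> {0<..<e B c}" for \<delta>
    proof -
      have "1024 * exp (2 * c + 9 * B) * \<delta> \<le> 1024 * exp (2 * c + 9 * B) * e B c"
        using that by (intro mult_left_mono) auto
      also have "\<dots> = min 1 c * (exp (2 * c + 9 * B) * exp (- (2 * c + 9 * B)))" by (simp add: e_def)
      also have "\<dots> = min 1 c" unfolding exp_add[symmetric] by simp
      finally show ?thesis .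
    qed
    \<comment> \<open>The constants depend on B, c and \<open>\<gamma>\<close> only, so they can be
      fixed before M, K, the neural operator, the plant and the solution.\<close>
    define \<kappa> where "\<kappa> = 2 * B * exp (2 * B)"
    define \<rho> where "\<rho> = exp c * (2 + 2 * \<kappa>\<^sup>2) + 1 / \<gamma>"
    define R where "R = 2 + 2 * B\<^sup>2 + \<gamma>"
    have \<rho>: "\<rho> > 0" unfolding \<rho>_def using \<gamma> by (intro add_nonneg_pos) auto
    have R: "R > 0" unfolding R_def using \<gamma> by (intro add_nonneg_pos) auto
    have bounds: "(\<forall>t\<ge>0. Gamma_fun \<beta> \<beta>hat u t \<le> R * (exp (\<rho> * Gamma_fun \<beta> \<beta>hat u 0) - 1)) \<and>
            (\<forall>x\<in>{0..1}. ((\<lambda>t. u x t) \<longlongrightarrow> 0) at_top)"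
      if M: "M \<ge> B" and approx: "neural_approximation M K \<epsilon> Khat Khat1"
        and lip: "\<exists>L. L-lipschitz_on {0..1} \<beta>" and sup: "sup_norm \<beta> \<le> B"
        and loop: "closed_loop B c \<gamma> Khat \<beta> \<beta>hat u" and reg: "regular_solution M K Khat \<beta>hat"
      for M K Khat Khat1 \<beta> \<beta>hat u
    proof -
      from lip obtain L where L: "L-lipschitz_on {0..1} \<beta>" by blast
      have \<beta>: "\<bar>\<beta> x\<bar> \<le> B" if "x \<in> {0..1}" for x
        using abs_le_sup_norm[OF lipschitz_on_continuous_on[OF L] that] sup by simp
      interpret A: adaptive_trajectory B c \<epsilon> \<gamma> M K L Khat Khat1 \<beta> \<beta>hat u
        by unfold_locales (use B c \<epsilon> \<gamma> M small[OF \<epsilon>] small[OF \<gamma>] approx L \<beta> loop reg in auto)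
      show ?thesis
        unfolding \<rho>_def R_def using A.Gamma_bound A.u_tendsto_0 by (simp add: \<kappa>_def A.\<kappa>_def)
    qed
    show ?thesis
      by (rule exI[of _ \<rho>], rule conjI[OF \<rho>], rule exI[of _ R], rule conjI[OF R], intro allI impI)
        (rule bounds)
  qed
  show ?thesis
    by (intro exI[of _ e] conjI allI impI ballI pos O1 O2 anti main)
qed

end
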